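(* Let $K\subseteq[-1,1]$ be a set having $0$ as a limit point and let $f:\mathcal{A}\to\mathcal{B}$ be a $\ast$-homomorphism of C$^\ast$-algebras. Then: (i) $\tilde f$ is a contraction (for the norms $\|\cdot\|_K$). (ii) $\tilde f$ and $\hat f$ are isometries provided that $f$ is an isometry. (iii) $\tilde f$ is surjective provided that $f$ is surjective. (iv) If $f$ is a $\ast$-isomorphism, then both $\tilde f$ and $\hat f$ are $\ast$-isomorphisms. (v) $\ker\tilde f=(\ker f)[Z]$. (vi) $\operatorname{Im}\tilde f=(\operatorname{Im}f)[Z]$. (vii) If $\mathcal{I}$ is a closed ideal of $\mathcal{A}$, then $\mathcal{I}[Z]$ is a closed ideal of $(\mathcal{A}[Z],\|\cdot\|_K)$. In particular, $$0\longrightarrow\mathcal{I}[Z]\hookrightarrow\mathcal{A}[Z]\overset{p'}{\longrightarrow}\mathcal{A}[Z]/\mathcal{I}[Z]\longrightarrow0$$ and $$0\longrightarrow\mathcal{I}[Z]\hookrightarrow\mathcal{A}[Z]\overset{\tilde p}{\longrightarrow}(\mathcal{A}/\mathcal{I})[Z]\longrightarrow0$$ are short exact sequences, where $p'$ is the quotient map and $\tilde p$ is induced by the quotient map $p:\mathcal{A}\to\mathcal{A}/\mathcal{I}$. (viii) $[\mathcal{A}\oplus\mathcal{B}]_K\cong[\mathcal{A}]_K\oplus[\mathcal{B}]_K$. (ix) $\widehat{(\mathcal{A}\oplus\mathcal{B})}_1\cong\hat{\mathcal{A}}_1\oplus\hat{\mathcal{B}}_1$.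
   Context: All C$^\ast$-algebras are complex; $\cong$ means $\ast$-isomorphic, and $\oplus$ is the C$^\ast$-direct sum. For a C$^\ast$-algebra $\mathcal{A}$, $\mathcal{A}[Z]$ is the $\ast$-algebra of all formal power series $F(Z)=\sum_{n=0}^\infty a_nZ^n$ with $a_n\in\mathcal{A}$ and $\sum_{n=0}^\infty\|a_n\|<\infty$, with coefficientwise linear operations, Cauchy product, and involution $(\sum a_nZ^n)^\ast=\sum a_n^\ast Z^n$. For $t\in[-1,1]$, $F(t)=\sum_{n=0}^\infty a_nt^n\in\mathcal{A}$. The norm $\|F\|_K=\sup_{t\in K}\|F(t)\|$ makes $\mathcal{A}[Z]$ a pre-C$^\ast$-algebra, and its completion is the C$^\ast$-algebra $[\mathcal{A}]_K$. The ideal $\mathcal{A}_1=\{\sum a_nZ^n\in\mathcal{A}[Z]:a_0=0\}$ has completion (closure in $[\mathcal{A}]_K$) denoted $\hat{\mathcal{A}}_1$. The $\ast$-homomorphism $f$ induces $\tilde f:\mathcal{A}[Z]\to\mathcal{B}[Z]$, $\tilde f(\sum a_nZ^n)=\sum f(a_n)Z^n$, and $\hat f:[\mathcal{A}]_K\to[\mathcal{B}]_K$ is the continuous extension of $\tilde f$ to the completions. *)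

theory Defs
  imports "HOL-Analysis.Abstract_Metric_Spaces" "HOL-Algebra.QuotRing" "HOL-Algebra.Module"
begin

section \<open>C*-algebras\<close>

text \<open>
  C*-algebras are carrier-based, because quotients, kernels and images have to be C*-algebras
  again. They need not be unital: the record field \<^const>\<open>one\<close> is inherited from
  \<^type>\<open>ring\<close> and is not constrained by any of the axioms below.
\<close>

record 'a normed_star_algebra = "(complex, 'a) module" +
  star :: "'a \<Rightarrow> 'a"
  nrm :: "'a \<Rightarrow> real"

locale star_algebra = abelian_group A for A (structure) +
  assumes m_closed: "\<lbrakk>x \<in> carrier A; y \<in> carrier A\<rbrakk> \<Longrightarrow> x \<otimes> y \<in> carrier A"
    and m_assoc: "\<lbrakk>x \<in> carrier A; y \<in> carrier A; z \<in> carrier A\<rbrakk>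
      \<Longrightarrow> (x \<otimes> y) \<otimes> z = x \<otimes> (y \<otimes> z)"
    and l_distr: "\<lbrakk>x \<in> carrier A; y \<in> carrier A; z \<in> carrier A\<rbrakk>
      \<Longrightarrow> (x \<oplus> y) \<otimes> z = x \<otimes> z \<oplus> y \<otimes> z"
    and r_distr: "\<lbrakk>x \<in> carrier A; y \<in> carrier A; z \<in> carrier A\<rbrakk>
      \<Longrightarrow> z \<otimes> (x \<oplus> y) = z \<otimes> x \<oplus> z \<otimes> y"
    and smult_closed: "x \<in> carrier A \<Longrightarrow> c \<odot> x \<in> carrier A"
    and smult_l_distr: "x \<in> carrier A \<Longrightarrow> (c + d) \<odot> x = c \<odot> x \<oplus> d \<odot> x"
    and smult_r_distr: "\<lbrakk>x \<in> carrier A; y \<in> carrier A\<rbrakk>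
      \<Longrightarrow> c \<odot> (x \<oplus> y) = c \<odot> x \<oplus> c \<odot> y"
    and smult_assoc1: "x \<in> carrier A \<Longrightarrow> (c * d) \<odot> x = c \<odot> (d \<odot> x)"
    and smult_one: "x \<in> carrier A \<Longrightarrow> 1 \<odot> x = x"
    and smult_mult_left: "\<lbrakk>x \<in> carrier A; y \<in> carrier A\<rbrakk>
      \<Longrightarrow> (c \<odot> x) \<otimes> y = c \<odot> (x \<otimes> y)"
    and smult_mult_right: "\<lbrakk>x \<in> carrier A; y \<in> carrier A\<rbrakk>
      \<Longrightarrow> x \<otimes> (c \<odot> y) = c \<odot> (x \<otimes> y)"
    and star_closed: "x \<in> carrier A \<Longrightarrow> star A x \<in> carrier A"
    and star_star: "x \<in> carrier A \<Longrightarrow> star A (star A x) = x"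
    and star_add: "\<lbrakk>x \<in> carrier A; y \<in> carrier A\<rbrakk>
      \<Longrightarrow> star A (x \<oplus> y) = star A x \<oplus> star A y"
    and star_mult: "\<lbrakk>x \<in> carrier A; y \<in> carrier A\<rbrakk>
      \<Longrightarrow> star A (x \<otimes> y) = star A y \<otimes> star A x"
    and star_smult: "x \<in> carrier A \<Longrightarrow> star A (c \<odot> x) = cnj c \<odot> star A x"

text \<open>
  The distance is cut off outside the carrier, since \<^locale>\<open>Metric_space\<close> requires
  nonnegativity and symmetry on the whole type.
\<close>

definition cdist :: "('a, 'm) normed_star_algebra_scheme \<Rightarrow> 'a \<Rightarrow> 'a \<Rightarrow> real" where
  "cdist A x y = (if x \<in> carrier A \<and> y \<in> carrier A then nrm A (x \<ominus>\<^bsub>A\<^esub> y) else 0)"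

abbreviation ctop :: "('a, 'm) normed_star_algebra_scheme \<Rightarrow> 'a topology" where
  "ctop A \<equiv> Metric_space.mtopology (carrier A) (cdist A)"

locale pre_cstar_algebra = star_algebra A for A (structure) +
  assumes nrm_nonneg: "x \<in> carrier A \<Longrightarrow> 0 \<le> nrm A x"
    and nrm_eq_0: "x \<in> carrier A \<Longrightarrow> nrm A x = 0 \<longleftrightarrow> x = \<zero>"
    and nrm_triangle: "\<lbrakk>x \<in> carrier A; y \<in> carrier A\<rbrakk>
      \<Longrightarrow> nrm A (x \<oplus> y) \<le> nrm A x + nrm A y"
    and nrm_smult: "x \<in> carrier A \<Longrightarrow> nrm A (c \<odot> x) = cmod c * nrm A x"
    and nrm_mult: "\<lbrakk>x \<in> carrier A; y \<in> carrier A\<rbrakk>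
      \<Longrightarrow> nrm A (x \<otimes> y) \<le> nrm A x * nrm A y"
    and nrm_cstar: "x \<in> carrier A \<Longrightarrow> nrm A (star A x \<otimes> x) = (nrm A x)\<^sup>2"
begin

lemma smult_minus_one: "x \<in> carrier A \<Longrightarrow> (-1) \<odot> x = \<ominus> x"
proof -
  assume x: "x \<in> carrier A"
  have "(0::complex) \<odot> x \<oplus> 0 \<odot> x = 0 \<odot> x"
    using smult_l_distr[OF x, of 0 0] by simp
  then have z: "(0::complex) \<odot> x = \<zero>"
    using x smult_closed by (metis add.r_cancel_one)
  have "(-1) \<odot> x \<oplus> x = \<zero>"
    using smult_l_distr[OF x, of "-1" 1] smult_one[OF x] z by simp
  then show ?thesis
    using x smult_closed by (metis minus_equality)
qed

lemma Metric_space_cdist: "Metric_space (carrier A) (cdist A)"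
proof
  fix x y z
  show "0 \<le> cdist A x y"
    by (auto simp: cdist_def nrm_nonneg)
  show "cdist A x y = cdist A y x"
  proof (cases "x \<in> carrier A \<and> y \<in> carrier A")
    case True
    then have "y \<ominus> x = (-1) \<odot> (x \<ominus> y)"
      by (simp add: smult_minus_one minus_eq minus_add a_comm)
    then show ?thesis
      using True nrm_smult[of "x \<ominus> y" "-1"] by (simp add: cdist_def)
  qed (auto simp: cdist_def)
  show "cdist A x y = 0 \<longleftrightarrow> x = y" if "x \<in> carrier A" "y \<in> carrier A"
  proof -
    have "x \<ominus> y = \<zero> \<longleftrightarrow> x = y"
      using that by (metis a_minus_def add.inv_closed add.inv_equality add.r_inv minus_minus)
    then show ?thesis
      using that by (simp add: cdist_def nrm_eq_0)
  qed
  show "cdist A x z \<le> cdist A x y + cdist A y z"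
    if "x \<in> carrier A" "y \<in> carrier A" "z \<in> carrier A"
  proof -
    have "x \<ominus> z = (x \<ominus> y) \<oplus> (y \<ominus> z)"
      using that by (simp add: minus_eq a_assoc r_neg1)
    then show ?thesis
      using that nrm_triangle[of "x \<ominus> y" "y \<ominus> z"] by (simp add: cdist_def)
  qed
qed

end

locale cstar_algebra = pre_cstar_algebra +
  assumes complete: "Metric_space.mcomplete (carrier A) (cdist A)"

section \<open>Homomorphisms, ideals, quotients, direct sums\<close>

definition star_hom ::
  "('a, 'm) normed_star_algebra_scheme \<Rightarrow> ('b, 'n) normed_star_algebra_scheme \<Rightarrow> ('a \<Rightarrow> 'b) set"
  where "star_hom A B = {h \<in> carrier A \<rightarrow> carrier B.
    (\<forall>x\<in>carrier A. \<forall>y\<in>carrier A. h (x \<oplus>\<^bsub>A\<^esub> y) = h x \<oplus>\<^bsub>B\<^esub> h y) \<and>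
    (\<forall>x\<in>carrier A. \<forall>y\<in>carrier A. h (x \<otimes>\<^bsub>A\<^esub> y) = h x \<otimes>\<^bsub>B\<^esub> h y) \<and>
    (\<forall>c. \<forall>x\<in>carrier A. h (c \<odot>\<^bsub>A\<^esub> x) = c \<odot>\<^bsub>B\<^esub> h x) \<and>
    (\<forall>x\<in>carrier A. h (star A x) = star B (h x))}"

definition star_iso ::
  "('a, 'm) normed_star_algebra_scheme \<Rightarrow> ('b, 'n) normed_star_algebra_scheme \<Rightarrow> ('a \<Rightarrow> 'b) set"
  where "star_iso A B = {h \<in> star_hom A B. bij_betw h (carrier A) (carrier B)}"

definition star_isomorphic ::
  "('a, 'm) normed_star_algebra_scheme \<Rightarrow> ('b, 'n) normed_star_algebra_scheme \<Rightarrow> bool"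
    (infix \<open>\<cong>\<^sub>*\<close> 60)
  where "A \<cong>\<^sub>* B \<longleftrightarrow> star_iso A B \<noteq> {}"

definition contractive_hom ::
  "('a, 'm) normed_star_algebra_scheme \<Rightarrow> ('b, 'n) normed_star_algebra_scheme \<Rightarrow> ('a \<Rightarrow> 'b) set"
  where "contractive_hom A B = {h \<in> star_hom A B. \<forall>x\<in>carrier A. nrm B (h x) \<le> nrm A x}"

definition isometric_hom ::
  "('a, 'm) normed_star_algebra_scheme \<Rightarrow> ('b, 'n) normed_star_algebra_scheme \<Rightarrow> ('a \<Rightarrow> 'b) set"
  where "isometric_hom A B = {h \<in> star_hom A B. \<forall>x\<in>carrier A. nrm B (h x) = nrm A x}"

text \<open>
  Ideals are two-sided, and are not assumed to be closed under the involution.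
\<close>

definition closed_ideal :: "'a set \<Rightarrow> ('a, 'm) normed_star_algebra_scheme \<Rightarrow> bool" where
  "closed_ideal I A \<longleftrightarrow> additive_subgroup I A \<and>
    (\<forall>c. \<forall>x\<in>I. c \<odot>\<^bsub>A\<^esub> x \<in> I) \<and>
    (\<forall>a\<in>carrier A. \<forall>x\<in>I. a \<otimes>\<^bsub>A\<^esub> x \<in> I \<and> x \<otimes>\<^bsub>A\<^esub> a \<in> I) \<and>
    closedin (ctop A) I"

definition quotient_algebra ::
  "('a, 'm) normed_star_algebra_scheme \<Rightarrow> 'a set \<Rightarrow> 'a set normed_star_algebra" where
  "quotient_algebra A I =
    \<lparr>carrier = a_rcosets\<^bsub>A\<^esub> I, mult = rcoset_mult A I, one = I +>\<^bsub>A\<^esub> \<one>\<^bsub>A\<^esub>,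
     zero = I, add = set_add A,
     smult = (\<lambda>c X. \<Union>x\<in>X. I +>\<^bsub>A\<^esub> (c \<odot>\<^bsub>A\<^esub> x)),
     star = (\<lambda>X. \<Union>x\<in>X. I +>\<^bsub>A\<^esub> star A x),
     nrm = (\<lambda>X. INF x\<in>X. nrm A x)\<rparr>"

definition direct_sum ::
  "('a, 'm) normed_star_algebra_scheme \<Rightarrow> ('b, 'n) normed_star_algebra_scheme \<Rightarrow>
    ('a \<times> 'b) normed_star_algebra" (infixr \<open>\<oplus>\<^sub>*\<close> 65) where
  "A \<oplus>\<^sub>* B =
    \<lparr>carrier = carrier A \<times> carrier B,
     mult = (\<lambda>(x, y) (x', y'). (x \<otimes>\<^bsub>A\<^esub> x', y \<otimes>\<^bsub>B\<^esub> y')), one = (\<one>\<^bsub>A\<^esub>, \<one>\<^bsub>B\<^esub>),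
     zero = (\<zero>\<^bsub>A\<^esub>, \<zero>\<^bsub>B\<^esub>), add = (\<lambda>(x, y) (x', y'). (x \<oplus>\<^bsub>A\<^esub> x', y \<oplus>\<^bsub>B\<^esub> y')),
     smult = (\<lambda>c (x, y). (c \<odot>\<^bsub>A\<^esub> x, c \<odot>\<^bsub>B\<^esub> y)),
     star = (\<lambda>(x, y). (star A x, star B y)),
     nrm = (\<lambda>(x, y). max (nrm A x) (nrm B y))\<rparr>"

text \<open>Short exact sequences of *-algebras and *-homomorphisms; the norms play no role.\<close>

definition short_exact ::
  "('a, 'k) normed_star_algebra_scheme \<Rightarrow> ('b, 'm) normed_star_algebra_scheme \<Rightarrow>
    ('c, 'n) normed_star_algebra_scheme \<Rightarrow> ('a \<Rightarrow> 'b) \<Rightarrow> ('b \<Rightarrow> 'c) \<Rightarrow> bool" where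
  "short_exact A B C i p \<longleftrightarrow>
    star_algebra A \<and> star_algebra B \<and> star_algebra C \<and>
    i \<in> star_hom A B \<and> p \<in> star_hom B C \<and>
    inj_on i (carrier A) \<and> i ` carrier A = a_kernel B C p \<and> p ` carrier B = carrier C"

section \<open>Completion\<close>

text \<open>Cauchy sequences modulo null sequences.\<close>

definition cauchy_seqs :: "('a, 'm) normed_star_algebra_scheme \<Rightarrow> (nat \<Rightarrow> 'a) set" where
  "cauchy_seqs A = {s. Metric_space.MCauchy (carrier A) (cdist A) s}"

definition cauchy_rel :: "('a, 'm) normed_star_algebra_scheme \<Rightarrow> (nat \<Rightarrow> 'a) rel" where
  "cauchy_rel A = {(s, t). s \<in> cauchy_seqs A \<and> t \<in> cauchy_seqs A \<and>
    (\<lambda>n. cdist A (s n) (t n)) \<longlonglongrightarrow> 0}"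

definition to_completion ::
  "('a, 'm) normed_star_algebra_scheme \<Rightarrow> 'a \<Rightarrow> (nat \<Rightarrow> 'a) set" where
  "to_completion A x = cauchy_rel A `` {\<lambda>_. x}"

definition completion ::
  "('a, 'm) normed_star_algebra_scheme \<Rightarrow> (nat \<Rightarrow> 'a) set normed_star_algebra" where
  "completion A =
    \<lparr>carrier = cauchy_seqs A // cauchy_rel A,
     mult = (\<lambda>X Y. \<Union>s\<in>X. \<Union>t\<in>Y. cauchy_rel A `` {\<lambda>n. s n \<otimes>\<^bsub>A\<^esub> t n}),
     one = to_completion A \<one>\<^bsub>A\<^esub>,
     zero = to_completion A \<zero>\<^bsub>A\<^esub>,
     add = (\<lambda>X Y. \<Union>s\<in>X. \<Union>t\<in>Y. cauchy_rel A `` {\<lambda>n. s n \<oplus>\<^bsub>A\<^esub> t n}),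
     smult = (\<lambda>c X. \<Union>s\<in>X. cauchy_rel A `` {\<lambda>n. c \<odot>\<^bsub>A\<^esub> s n}),
     star = (\<lambda>X. \<Union>s\<in>X. cauchy_rel A `` {\<lambda>n. star A (s n)}),
     nrm = (\<lambda>X. the_elem ((\<lambda>s. lim (\<lambda>n. nrm A (s n))) ` X))\<rparr>"

text \<open>
  A continuous extension of a map is unique on the completion, since the image of
  \<^term>\<open>to_completion A\<close> is dense; extensionality fixes it outside the carrier.
\<close>

definition completion_map ::
  "('a, 'm) normed_star_algebra_scheme \<Rightarrow> ('b, 'n) normed_star_algebra_scheme \<Rightarrow> ('a \<Rightarrow> 'b) \<Rightarrow>
    (nat \<Rightarrow> 'a) set \<Rightarrow> (nat \<Rightarrow> 'b) set" where
  "completion_map A B h = (THE g. g \<in> extensional (carrier (completion A)) \<and>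
    continuous_map (ctop (completion A)) (ctop (completion B)) g \<and>
    (\<forall>x\<in>carrier A. g (to_completion A x) = to_completion B (h x)))"

section \<open>Power series\<close>

text \<open>
  A power series is the sequence of its coefficients. For a subalgebra or ideal with carrier
  \<open>S\<close>, the power series with coefficients in \<open>S\<close> are \<open>power_series (A\<lparr>carrier := S\<rparr>)\<close>.
\<close>

definition power_series :: "('a, 'm) normed_star_algebra_scheme \<Rightarrow> (nat \<Rightarrow> 'a) set" where
  "power_series A = {F. (\<forall>n. F n \<in> carrier A) \<and> summable (\<lambda>n. nrm A (F n))}"

definition ps_eval :: "('a, 'm) normed_star_algebra_scheme \<Rightarrow> (nat \<Rightarrow> 'a) \<Rightarrow> real \<Rightarrow> 'a" where
  "ps_eval A F t = (THE s.
    limitin (ctop A) (\<lambda>N. \<Oplus>\<^bsub>A\<^esub>n\<in>{..<N}. complex_of_real (t ^ n) \<odot>\<^bsub>A\<^esub> F n) s sequentially)"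

definition power_series_algebra ::
  "real set \<Rightarrow> ('a, 'm) normed_star_algebra_scheme \<Rightarrow> (nat \<Rightarrow> 'a) normed_star_algebra" where
  "power_series_algebra K A =
    \<lparr>carrier = power_series A,
     mult = (\<lambda>F G n. \<Oplus>\<^bsub>A\<^esub>i\<in>{..n}. F i \<otimes>\<^bsub>A\<^esub> G (n - i)),
     one = (\<lambda>n. if n = 0 then \<one>\<^bsub>A\<^esub> else \<zero>\<^bsub>A\<^esub>),
     zero = (\<lambda>n. \<zero>\<^bsub>A\<^esub>),
     add = (\<lambda>F G n. F n \<oplus>\<^bsub>A\<^esub> G n),
     smult = (\<lambda>c F n. c \<odot>\<^bsub>A\<^esub> F n),
     star = (\<lambda>F n. star A (F n)),
     nrm = (\<lambda>F. SUP t\<in>K. nrm A (ps_eval A F t))\<rparr>"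

abbreviation ps_completion ::
  "real set \<Rightarrow> ('a, 'm) normed_star_algebra_scheme \<Rightarrow>
    (nat \<Rightarrow> nat \<Rightarrow> 'a) set normed_star_algebra" where
  "ps_completion K A \<equiv> completion (power_series_algebra K A)"

definition ps_map :: "('a \<Rightarrow> 'b) \<Rightarrow> (nat \<Rightarrow> 'a) \<Rightarrow> nat \<Rightarrow> 'b" where
  "ps_map f F = (\<lambda>n. f (F n))"

definition ps_completion_map ::
  "real set \<Rightarrow> ('a, 'm) normed_star_algebra_scheme \<Rightarrow> ('b, 'n) normed_star_algebra_scheme \<Rightarrow>
    ('a \<Rightarrow> 'b) \<Rightarrow> (nat \<Rightarrow> nat \<Rightarrow> 'a) set \<Rightarrow> (nat \<Rightarrow> nat \<Rightarrow> 'b) set" where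
  "ps_completion_map K A B f =
    completion_map (power_series_algebra K A) (power_series_algebra K B) (ps_map f)"

text \<open>The closure, in the completion, of the ideal of power series without constant term.\<close>

definition ps_ideal1_completion ::
  "real set \<Rightarrow> ('a, 'm) normed_star_algebra_scheme \<Rightarrow>
    (nat \<Rightarrow> nat \<Rightarrow> 'a) set normed_star_algebra" where
  "ps_ideal1_completion K A = (ps_completion K A)\<lparr>carrier :=
    ctop (ps_completion K A) closure_of
      (to_completion (power_series_algebra K A) ` {F \<in> power_series A. F 0 = \<zero>\<^bsub>A\<^esub>})\<rparr>"

end

theory Submission
  imports Defs
begin

text \<open>
  Spectral theory is avoided by means of unitaries. If \<open>h\<close> and \<open>g\<close> are commuting selfadjoint elements
  with \<open>h\<^sup>2 + (1 - g)\<^sup>2 = 1\<close>, then \<open>h + i(1 - g)\<close> is formally unitary, so \<open>\<parallel>h\<parallel> \<le> 1\<close>. Such a \<open>g\<close> exists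
  whenever \<open>\<parallel>h\<parallel> < 1\<close>, and *-homomorphisms preserve the relation; hence they are contractive. The
  Cayley transform gives \<open>\<parallel>a / (1 + a\<^sup>2)\<parallel> \<le> 1/2\<close> for every selfadjoint \<open>a\<close>. Since
  \<open>b - b / (1 + b\<^sup>2)\<close> has norm at most \<open>1/2\<close> if \<open>\<parallel>b\<parallel> = 1\<close>, iteration lifts every element of the image
  of a *-homomorphism to an element of at most twice its norm; applied to each coefficient, this
  yields \<open>Im f~ = (Im f)[Z]\<close>. The elements \<open>a\<^sup>2 / (1 + a\<^sup>2)\<close> also serve as approximate units, which
  shows that closed ideals are selfadjoint.

  Since \<open>0\<close> is a limit point of \<open>K\<close>, the coefficients of \<open>F\<close> are successive limits of difference
  quotients of \<open>F(t)\<close>. Thus the supremum over \<open>K\<close> is a norm, and \<open>F\<close> has coefficients in a closed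
  ideal as soon as its values on \<open>K\<close> lie there.
\<close>

section \<open>Star algebras\<close>

text \<open>The algebras need not be unital, so 1 - g and the unitary built from it are not
  elements. They are replaced by left multiplication: \<open>y \<ominus> g \<otimes> y\<close>
  stands for (1 - g) y, bounds are proved for all y, and for selfadjoint h the choice y = h recovers
  the norm of h. Square roots and inverses arise as fixed points of contractions on sets of
  selfadjoint elements commuting with the given one. Surjectivity is delicate because of absolute
  summability: arbitrary preimages of the coefficients can have norms that are not summable, so a
  lift with a norm bound uniform in the element is required. The constant 1/2 is the maximum of s/(1
  + s^2). It bounds the correction whatever the norm of the preimage at hand, and for an image of
  norm 1 it bounds the remaining error too. The factor 2 comes from lifting real and imaginary parts
  separately. Ideals are not assumed selfadjoint, whereas the exact sequences consist of star
  algebras; this is the purpose of the approximate units.\<close>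

lemma additive_map_zero:
  assumes "abelian_group A" "abelian_group B" "h \<in> carrier A \<rightarrow> carrier B"
    and "\<And>x y. \<lbrakk>x \<in> carrier A; y \<in> carrier A\<rbrakk> \<Longrightarrow> h (x \<oplus>\<^bsub>A\<^esub> y) = h x \<oplus>\<^bsub>B\<^esub> h y"
  shows "h \<zero>\<^bsub>A\<^esub> = \<zero>\<^bsub>B\<^esub>"
proof -
  interpret A: abelian_group A by fact
  interpret B: abelian_group B by fact
  have z: "h \<zero>\<^bsub>A\<^esub> \<in> carrier B" using assms(3) by auto
  have "h \<zero>\<^bsub>A\<^esub> \<oplus>\<^bsub>B\<^esub> h \<zero>\<^bsub>A\<^esub> = h \<zero>\<^bsub>A\<^esub>" using assms(4)[of "\<zero>\<^bsub>A\<^esub>" "\<zero>\<^bsub>A\<^esub>"] by simp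
  then show ?thesis using z by (metis B.add.r_cancel_one)
qed

text \<open>Stated for bare additive maps, because one-sided multiplication, multiplication by a
  scalar and the conjugate-linear involution are not star homomorphisms.\<close>

lemma additive_map_finsum:
  assumes "abelian_group A" "abelian_group B" "h \<in> carrier A \<rightarrow> carrier B"
    and add: "\<And>x y. \<lbrakk>x \<in> carrier A; y \<in> carrier A\<rbrakk> \<Longrightarrow> h (x \<oplus>\<^bsub>A\<^esub> y) = h x \<oplus>\<^bsub>B\<^esub> h y"
    and f: "\<And>i. i \<in> S \<Longrightarrow> f i \<in> carrier A"
  shows "h (\<Oplus>\<^bsub>A\<^esub>i\<in>S. f i) = (\<Oplus>\<^bsub>B\<^esub>i\<in>S. h (f i))"
proof -
  interpret A: abelian_group A by fact
  interpret B: abelian_group B by fact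
  have z: "h \<zero>\<^bsub>A\<^esub> = \<zero>\<^bsub>B\<^esub>" using additive_map_zero assms(1-4) by blast
  show ?thesis using f
  proof (induction S rule: infinite_finite_induct)
    case (insert x F)
    then have "h (f x) \<in> carrier B" "\<And>i. i \<in> F \<Longrightarrow> h (f i) \<in> carrier B" using assms(3) by auto
    with insert show ?case by (simp add: Pi_def add)
  qed (simp_all add: z)
qed

lemma star_hom_closed: "h \<in> star_hom A B \<Longrightarrow> x \<in> carrier A \<Longrightarrow> h x \<in> carrier B"
  and star_hom_add: "h \<in> star_hom A B \<Longrightarrow> x \<in> carrier A \<Longrightarrow> y \<in> carrier A
    \<Longrightarrow> h (x \<oplus>\<^bsub>A\<^esub> y) = h x \<oplus>\<^bsub>B\<^esub> h y"
  and star_hom_mult: "h \<in> star_hom A B \<Longrightarrow> x \<in> carrier A \<Longrightarrow> y \<in> carrier A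
    \<Longrightarrow> h (x \<otimes>\<^bsub>A\<^esub> y) = h x \<otimes>\<^bsub>B\<^esub> h y"
  and star_hom_smult: "h \<in> star_hom A B \<Longrightarrow> x \<in> carrier A \<Longrightarrow> h (c \<odot>\<^bsub>A\<^esub> x) = c \<odot>\<^bsub>B\<^esub> h x"
  and star_hom_star: "h \<in> star_hom A B \<Longrightarrow> x \<in> carrier A \<Longrightarrow> h (star A x) = star B (h x)"
  by (auto simp: star_hom_def)

lemmas star_hom_simps = star_hom_closed star_hom_add star_hom_mult star_hom_smult star_hom_star

lemma star_homI:
  assumes "\<And>x. x \<in> carrier A \<Longrightarrow> h x \<in> carrier B"
    and "\<And>x y. x \<in> carrier A \<Longrightarrow> y \<in> carrier A \<Longrightarrow> h (x \<oplus>\<^bsub>A\<^esub> y) = h x \<oplus>\<^bsub>B\<^esub> h y"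
    and "\<And>x y. x \<in> carrier A \<Longrightarrow> y \<in> carrier A \<Longrightarrow> h (x \<otimes>\<^bsub>A\<^esub> y) = h x \<otimes>\<^bsub>B\<^esub> h y"
    and "\<And>c x. x \<in> carrier A \<Longrightarrow> h (c \<odot>\<^bsub>A\<^esub> x) = c \<odot>\<^bsub>B\<^esub> h x"
    and "\<And>x. x \<in> carrier A \<Longrightarrow> h (star A x) = star B (h x)"
  shows "h \<in> star_hom A B"
  using assms by (auto simp: star_hom_def)

context star_algebra
begin

declare m_closed [simp, intro] smult_closed [simp, intro] star_closed [simp, intro]

lemma smult_zero_left [simp]: "x \<in> carrier A \<Longrightarrow> 0 \<odot> x = \<zero>"
  using smult_l_distr[of x 0 0] by simp

lemma smult_zero_right [simp]: "c \<odot> \<zero> = \<zero>"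
  using smult_r_distr[of \<zero> \<zero> c] by simp

lemma smult_minus_left: "x \<in> carrier A \<Longrightarrow> (-c) \<odot> x = \<ominus> (c \<odot> x)"
  using smult_l_distr[of x "-c" c] by (simp, metis minus_equality smult_closed)

lemma smult_minus_right: "x \<in> carrier A \<Longrightarrow> c \<odot> (\<ominus> x) = \<ominus> (c \<odot> x)"
  using smult_r_distr[of "\<ominus> x" x c] by (simp add: l_neg, metis minus_equality smult_closed a_inv_closed)

lemma l_null [simp]: "x \<in> carrier A \<Longrightarrow> \<zero> \<otimes> x = \<zero>"
  using l_distr[of \<zero> \<zero> x] by simp

lemma r_null [simp]: "x \<in> carrier A \<Longrightarrow> x \<otimes> \<zero> = \<zero>"
  using r_distr[of \<zero> \<zero> x] by simp

lemma l_minus: "\<lbrakk>x \<in> carrier A; y \<in> carrier A\<rbrakk> \<Longrightarrow> (\<ominus> x) \<otimes> y = \<ominus> (x \<otimes> y)"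
  using l_distr[of "\<ominus> x" x y] by (simp add: l_neg, metis minus_equality m_closed a_inv_closed)

lemma r_minus: "\<lbrakk>x \<in> carrier A; y \<in> carrier A\<rbrakk> \<Longrightarrow> x \<otimes> (\<ominus> y) = \<ominus> (x \<otimes> y)"
  using r_distr[of "\<ominus> y" y x] by (simp add: l_neg, metis minus_equality m_closed a_inv_closed)

lemma star_zero [simp]: "star A \<zero> = \<zero>"
  using star_add[of \<zero> \<zero>] by simp

lemma star_minus: "x \<in> carrier A \<Longrightarrow> star A (\<ominus> x) = \<ominus> (star A x)"
  using star_add[of "\<ominus> x" x] by (simp add: l_neg, metis minus_equality star_closed a_inv_closed)

lemma minus_zero' [simp]: "\<ominus> \<zero> = \<zero>"
  by (metis l_zero minus_equality zero_closed)

lemma smult_smult: "x \<in> carrier A \<Longrightarrow> c \<odot> (d \<odot> x) = (c * d) \<odot> x"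
  by (simp add: smult_assoc1)

text \<open>Attached to the \<open>ring\<close> normaliser, so that \<open>algebra\<close> works in
  non-unital noncommutative star algebras. Scalars move out of products, the involution moves in to
  the factors.\<close>

lemmas star_algebra_simprules
  [algebra ring "zero A" "add A" "a_inv A" "a_minus A" "one A" "mult A"] =
  a_closed zero_closed a_inv_closed minus_closed m_closed smult_closed star_closed
  a_assoc l_zero l_neg a_comm m_assoc l_distr minus_eq
  r_zero r_neg r_neg2 r_neg1 minus_add minus_minus minus_zero'
  a_lcomm r_distr l_null r_null l_minus r_minus
  smult_zero_right smult_r_distr smult_minus_right smult_minus_left smult_mult_left smult_mult_right smult_smult
  star_add star_minus star_mult star_smult star_zero star_star smult_one

lemma finsum_ldistr:
  assumes "a \<in> carrier A" "\<And>i. i \<in> S \<Longrightarrow> f i \<in> carrier A"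
  shows "(\<Oplus>i\<in>S. f i) \<otimes> a = (\<Oplus>i\<in>S. f i \<otimes> a)"
  using assms by (intro additive_map_finsum[where h="\<lambda>x. x \<otimes> a"])
    (auto simp: l_distr abelian_group_axioms)

lemma smult_finsum:
  assumes "\<And>i. i \<in> S \<Longrightarrow> f i \<in> carrier A"
  shows "c \<odot> (\<Oplus>i\<in>S. f i) = (\<Oplus>i\<in>S. c \<odot> f i)"
  using assms by (intro additive_map_finsum[where h="\<lambda>x. c \<odot> x"])
    (auto simp: smult_r_distr abelian_group_axioms)

lemma star_finsum:
  assumes "\<And>i. i \<in> S \<Longrightarrow> f i \<in> carrier A"
  shows "star A (\<Oplus>i\<in>S. f i) = (\<Oplus>i\<in>S. star A (f i))"
  using assms by (intro additive_map_finsum[where h="star A"])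
    (auto simp: star_add abelian_group_axioms)

end

text \<open>Identities and negatives descend along a surjection that preserves the operations;
  quotients and completions obtain their laws from here. Preservation of zero is a separate
  assumption because \<open>B\<close> is not yet known to be a group.\<close>

lemma star_algebra_image:
  assumes "star_algebra A" "h \<in> star_hom A B" and onto: "h ` carrier A = carrier B"
    and z: "h \<zero>\<^bsub>A\<^esub> = \<zero>\<^bsub>B\<^esub>"
  shows "star_algebra B"
proof -
  interpret A: star_algebra A by fact
  note hs = star_hom_simps[OF assms(2)]
  have ex: "\<exists>a\<in>carrier A. x = h a" if "x \<in> carrier B" for x using onto that by auto
  have "abelian_group B"
  proof (rule abelian_groupI)
    fix x assume "x \<in> carrier B"
    then obtain a where a: "a \<in> carrier A" "x = h a" using ex by blast
    have "h (\<ominus>\<^bsub>A\<^esub> a) \<oplus>\<^bsub>B\<^esub> x = \<zero>\<^bsub>B\<^esub>" using a hs(2)[of "\<ominus>\<^bsub>A\<^esub> a" a] by (simp add: z A.l_neg)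
    then show "\<exists>y\<in>carrier B. y \<oplus>\<^bsub>B\<^esub> x = \<zero>\<^bsub>B\<^esub>" using a hs(1) by auto
    show "\<zero>\<^bsub>B\<^esub> \<oplus>\<^bsub>B\<^esub> x = x" using a hs(2)[of "\<zero>\<^bsub>A\<^esub>" a] by (simp add: z)
    fix y assume "y \<in> carrier B"
    then obtain b where b: "b \<in> carrier A" "y = h b" using ex by blast
    show "x \<oplus>\<^bsub>B\<^esub> y \<in> carrier B" using a b hs(1)[of "a \<oplus>\<^bsub>A\<^esub> b"] by (simp add: hs(2))
    show "x \<oplus>\<^bsub>B\<^esub> y = y \<oplus>\<^bsub>B\<^esub> x"
      using a b by (simp add: A.a_comm flip: hs(2))
    fix w assume "w \<in> carrier B"
    then obtain c where c: "c \<in> carrier A" "w = h c" using ex by blast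
    show "x \<oplus>\<^bsub>B\<^esub> y \<oplus>\<^bsub>B\<^esub> w = x \<oplus>\<^bsub>B\<^esub> (y \<oplus>\<^bsub>B\<^esub> w)"
      using a b c by (simp add: A.a_assoc flip: hs(2))
  next
    show "\<zero>\<^bsub>B\<^esub> \<in> carrier B" using onto z A.zero_closed by (metis imageI)
  qed
  moreover have "star_algebra_axioms B"
  proof
    fix x c d assume "x \<in> carrier B"
    then obtain a where a: "a \<in> carrier A" "x = h a" using ex by blast
    show "c \<odot>\<^bsub>B\<^esub> x \<in> carrier B" "(c + d) \<odot>\<^bsub>B\<^esub> x = c \<odot>\<^bsub>B\<^esub> x \<oplus>\<^bsub>B\<^esub> d \<odot>\<^bsub>B\<^esub> x"
      "(c * d) \<odot>\<^bsub>B\<^esub> x = c \<odot>\<^bsub>B\<^esub> (d \<odot>\<^bsub>B\<^esub> x)" "1 \<odot>\<^bsub>B\<^esub> x = x" "star B x \<in> carrier B"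
      "star B (star B x) = x" "star B (c \<odot>\<^bsub>B\<^esub> x) = cnj c \<odot>\<^bsub>B\<^esub> star B x"
      using a by (simp_all add: hs(1) A.smult_l_distr A.smult_assoc1 A.smult_one A.star_star A.star_smult
          flip: hs(2-5))
    fix y assume "y \<in> carrier B"
    then obtain b where b: "b \<in> carrier A" "y = h b" using ex by blast
    show "x \<otimes>\<^bsub>B\<^esub> y \<in> carrier B" "c \<odot>\<^bsub>B\<^esub> (x \<oplus>\<^bsub>B\<^esub> y) = c \<odot>\<^bsub>B\<^esub> x \<oplus>\<^bsub>B\<^esub> c \<odot>\<^bsub>B\<^esub> y"
      "(c \<odot>\<^bsub>B\<^esub> x) \<otimes>\<^bsub>B\<^esub> y = c \<odot>\<^bsub>B\<^esub> (x \<otimes>\<^bsub>B\<^esub> y)" "x \<otimes>\<^bsub>B\<^esub> (c \<odot>\<^bsub>B\<^esub> y) = c \<odot>\<^bsub>B\<^esub> (x \<otimes>\<^bsub>B\<^esub> y)"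
      "star B (x \<oplus>\<^bsub>B\<^esub> y) = star B x \<oplus>\<^bsub>B\<^esub> star B y" "star B (x \<otimes>\<^bsub>B\<^esub> y) = star B y \<otimes>\<^bsub>B\<^esub> star B x"
      using a b by (simp_all add: hs(1) A.smult_r_distr A.smult_mult_left A.smult_mult_right A.star_add A.star_mult
          flip: hs(2-5))
    fix w assume "w \<in> carrier B"
    then obtain e where e: "e \<in> carrier A" "w = h e" using ex by blast
    show "x \<otimes>\<^bsub>B\<^esub> y \<otimes>\<^bsub>B\<^esub> w = x \<otimes>\<^bsub>B\<^esub> (y \<otimes>\<^bsub>B\<^esub> w)"
      "(x \<oplus>\<^bsub>B\<^esub> y) \<otimes>\<^bsub>B\<^esub> w = x \<otimes>\<^bsub>B\<^esub> w \<oplus>\<^bsub>B\<^esub> y \<otimes>\<^bsub>B\<^esub> w"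
      "w \<otimes>\<^bsub>B\<^esub> (x \<oplus>\<^bsub>B\<^esub> y) = w \<otimes>\<^bsub>B\<^esub> x \<oplus>\<^bsub>B\<^esub> w \<otimes>\<^bsub>B\<^esub> y"
      using a b e by (simp_all add: A.m_assoc A.l_distr A.r_distr flip: hs(2-3))
  qed
  ultimately show ?thesis by (rule star_algebra.intro)
qed

text \<open>\<open>finsum\<close> refers to the carrier of its structure, so the two sums are
  related through the inclusion, which is an additive map.\<close>

lemma finsum_carrier_cong:
  assumes "abelian_group A" "abelian_group (A\<lparr>carrier := S\<rparr>)" "S \<subseteq> carrier A"
    and "\<And>i. i \<in> I \<Longrightarrow> f i \<in> S"
  shows "finsum (A\<lparr>carrier := S\<rparr>) f I = finsum A f I"
  using additive_map_finsum[of "A\<lparr>carrier := S\<rparr>" A "\<lambda>x. x" I f] assms by auto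

lemma (in star_algebra) star_algebra_carrier_update:
  assumes "additive_subgroup S A" "\<And>c x. x \<in> S \<Longrightarrow> c \<odot> x \<in> S"
    "\<And>x y. \<lbrakk>x \<in> S; y \<in> S\<rbrakk> \<Longrightarrow> x \<otimes> y \<in> S" "\<And>x. x \<in> S \<Longrightarrow> star A x \<in> S"
  shows "star_algebra (A\<lparr>carrier := S\<rparr>)"
proof -
  interpret S: additive_subgroup S A by fact
  note [simp, intro] = subsetD[OF S.a_subset] assms(2-4)
  show ?thesis
  proof (intro star_algebra.intro star_algebra_axioms.intro abelian_groupI)
    fix x assume "x \<in> carrier (A\<lparr>carrier := S\<rparr>)"
    then show "\<exists>y\<in>carrier (A\<lparr>carrier := S\<rparr>). y \<oplus>\<^bsub>A\<lparr>carrier := S\<rparr>\<^esub> x = \<zero>\<^bsub>A\<lparr>carrier := S\<rparr>\<^esub>"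
      by (auto intro!: bexI[of _ "\<ominus> x"] simp: l_neg)
  qed (auto simp: a_ac m_assoc l_distr r_distr smult_l_distr smult_r_distr smult_assoc1 smult_one
      smult_mult_left smult_mult_right star_star star_add star_mult star_smult)
qed

section \<open>Seminormed star algebras\<close>

text \<open>The quotient \<open>A/I\<close> is only needed at this level of generality, so that its C*-identity
  need not be established.\<close>

locale seminormed_star_algebra = star_algebra A for A (structure) +
  assumes seminorm_nonneg: "x \<in> carrier A \<Longrightarrow> 0 \<le> nrm A x"
    and seminorm_zero: "nrm A \<zero> = 0"
    and seminorm_triangle: "\<lbrakk>x \<in> carrier A; y \<in> carrier A\<rbrakk>
      \<Longrightarrow> nrm A (x \<oplus> y) \<le> nrm A x + nrm A y"
    and seminorm_smult: "x \<in> carrier A \<Longrightarrow> nrm A (c \<odot> x) = cmod c * nrm A x"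
    and seminorm_mult: "\<lbrakk>x \<in> carrier A; y \<in> carrier A\<rbrakk>
      \<Longrightarrow> nrm A (x \<otimes> y) \<le> nrm A x * nrm A y"
    and seminorm_star: "x \<in> carrier A \<Longrightarrow> nrm A (star A x) = nrm A x"
begin

lemma seminorm_minus: "x \<in> carrier A \<Longrightarrow> nrm A (\<ominus> x) = nrm A x"
  using seminorm_smult[of x "-1"] by (simp add: smult_minus_left smult_one)

lemma seminorm_finsum:
  assumes "finite S" "\<And>i. i \<in> S \<Longrightarrow> f i \<in> carrier A"
  shows "nrm A (\<Oplus>i\<in>S. f i) \<le> (\<Sum>i\<in>S. nrm A (f i))"
  using assms
proof (induction S rule: finite_induct)
  case (insert x F)
  then show ?case
    using seminorm_triangle[of "f x" "finsum A f F"] by (fastforce simp: Pi_def)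
qed (simp add: seminorm_zero)

text \<open>The coefficient norms are dominated by the Cauchy product of the two real sequences of
  norms.\<close>

lemma cauchy_product_closed:
  assumes "F \<in> power_series A" "G \<in> power_series A"
  shows "(\<lambda>n. \<Oplus>i\<in>{..n}. F i \<otimes> G (n - i)) \<in> power_series A"
proof -
  have c: "F n \<in> carrier A" "G n \<in> carrier A" for n using assms by (auto simp: power_series_def)
  have s: "summable (\<lambda>n. norm (nrm A (F n)))" "summable (\<lambda>n. norm (nrm A (G n)))"
    using assms c by (auto simp: power_series_def seminorm_nonneg)
  have "summable (\<lambda>n. \<Sum>i\<le>n. nrm A (F i) * nrm A (G (n - i)))"
    using summable_Cauchy_product[OF s] .
  then have "summable (\<lambda>n. nrm A (\<Oplus>i\<in>{..n}. F i \<otimes> G (n - i)))"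
  proof (rule summable_comparison_test')
    fix n
    have "nrm A (\<Oplus>i\<in>{..n}. F i \<otimes> G (n - i)) \<le> (\<Sum>i\<le>n. nrm A (F i \<otimes> G (n - i)))"
      by (rule seminorm_finsum) (auto simp: c)
    also have "\<dots> \<le> (\<Sum>i\<le>n. nrm A (F i) * nrm A (G (n - i)))"
      by (intro sum_mono seminorm_mult c)
    finally show "norm (nrm A (\<Oplus>i\<in>{..n}. F i \<otimes> G (n - i))) \<le> (\<Sum>i\<le>n. nrm A (F i) * nrm A (G (n - i)))"
      by (simp add: seminorm_nonneg c Pi_def)
  qed
  then show ?thesis by (auto simp: power_series_def c Pi_def)
qed

lemma cauchy_product_assoc:
  fixes F G H :: "nat \<Rightarrow> 'a"
  assumes "\<And>n. F n \<in> carrier A" "\<And>n. G n \<in> carrier A" "\<And>n. H n \<in> carrier A"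
  shows "(\<Oplus>j\<in>{..n}. (\<Oplus>i\<in>{..j}. F i \<otimes> G (j - i)) \<otimes> H (n - j)) =
    (\<Oplus>j\<in>{..n}. F j \<otimes> (\<Oplus>i\<in>{..n - j}. G i \<otimes> H (n - j - i)))"
proof -
  \<comment> \<open>The bound \<open>k\<close> of the outer sum is separated from the
    \<open>n\<close> in the indices, which stays fixed during the induction.\<close>
  have "k \<le> n \<Longrightarrow> (\<Oplus>j\<in>{..k}. (\<Oplus>i\<in>{..j}. F i \<otimes> G (j - i)) \<otimes> H (n - j)) =
    (\<Oplus>j\<in>{..k}. F j \<otimes> (\<Oplus>i\<in>{..k - j}. G i \<otimes> H (n - j - i)))" for k
  proof (induct k)
    case 0 then show ?case using assms by (simp add: Pi_def m_assoc)
  next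
    case (Suc k)
    then have "k \<le> n" by arith
    with Suc assms show ?case
      by (simp cong: finsum_cong add: Suc_diff_le Pi_def l_distr r_distr m_assoc)
        (simp cong: finsum_cong add: Pi_def a_ac finsum_ldistr m_assoc)
  qed
  then show ?thesis by simp
qed

lemma power_series_add_closed:
  assumes "F \<in> power_series A" "G \<in> power_series A"
  shows "(\<lambda>n. F n \<oplus> G n) \<in> power_series A"
proof -
  have c: "F n \<in> carrier A" "G n \<in> carrier A" for n using assms by (auto simp: power_series_def)
  have "summable (\<lambda>n. nrm A (F n) + nrm A (G n))"
    using assms by (auto simp: power_series_def intro: summable_add)
  then have "summable (\<lambda>n. nrm A (F n \<oplus> G n))"
    by (rule summable_comparison_test') (auto simp: c seminorm_nonneg seminorm_triangle)
  then show ?thesis by (auto simp: power_series_def c)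
qed

lemma power_series_closed:
  "(\<lambda>n. \<zero>) \<in> power_series A"
  "F \<in> power_series A \<Longrightarrow> (\<lambda>n. c \<odot> F n) \<in> power_series A"
  "F \<in> power_series A \<Longrightarrow> (\<lambda>n. \<ominus> F n) \<in> power_series A"
  "F \<in> power_series A \<Longrightarrow> (\<lambda>n. star A (F n)) \<in> power_series A"
  by (simp_all add: power_series_def seminorm_zero seminorm_smult seminorm_star seminorm_minus summable_mult)

lemma star_algebra_power_series: "star_algebra (power_series_algebra K A)"
proof -
  have c: "F n \<in> carrier A" if "F \<in> power_series A" for F n using that by (auto simp: power_series_def)
  have ag: "abelian_group (power_series_algebra K A)"
  proof (rule abelian_groupI)
    fix F assume "F \<in> carrier (power_series_algebra K A)"
    then show "\<exists>G\<in>carrier (power_series_algebra K A).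
        G \<oplus>\<^bsub>power_series_algebra K A\<^esub> F = \<zero>\<^bsub>power_series_algebra K A\<^esub>"
      by (intro bexI[of _ "\<lambda>n. \<ominus> F n"]) (auto simp: power_series_algebra_def power_series_closed l_neg c)
  qed (auto simp: power_series_algebra_def power_series_closed power_series_add_closed c a_ac)
  \<comment> \<open>The involution reverses the factors, so the index i is reflected to n - i to
    recover a Cauchy product.\<close>
  have star_mult: "star A (\<Oplus>i\<in>{..n}. F i \<otimes> G (n - i)) = (\<Oplus>i\<in>{..n}. star A (G i) \<otimes> star A (F (n - i)))"
    if "F \<in> power_series A" "G \<in> power_series A" for F G n
  proof -
    have "star A (\<Oplus>i\<in>{..n}. F i \<otimes> G (n - i)) = (\<Oplus>i\<in>{..n}. star A (G (n - i)) \<otimes> star A (F i))"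
      using that by (simp add: star_finsum c star_mult cong: finsum_cong)
    also have "\<dots> = (\<Oplus>i\<in>(\<lambda>i. n - i) ` {..n}. star A (G (n - i)) \<otimes> star A (F i))"
    proof -
      have "i \<in> (\<lambda>i. n - i) ` {..n}" if "i \<le> n" for i
        using that by (intro image_eqI[of _ _ "n - i"]) auto
      then have "(\<lambda>i. n - i) ` {..n} = {..n}" by auto
      then show ?thesis by simp
    qed
    also have "\<dots> = (\<Oplus>i\<in>{..n}. star A (G (n - (n - i))) \<otimes> star A (F (n - i)))"
      by (rule finsum_reindex) (auto simp: inj_on_def c that)
    also have "\<dots> = (\<Oplus>i\<in>{..n}. star A (G i) \<otimes> star A (F (n - i)))"
      by (rule finsum_cong') (auto simp: c that)
    finally show ?thesis .
  qed
  have distr: "(\<Oplus>i\<in>{..n}. F i \<otimes> G i \<oplus> F' i \<otimes> G' i) = (\<Oplus>i\<in>{..n}. F i \<otimes> G i) \<oplus> (\<Oplus>i\<in>{..n}. F' i \<otimes> G' i)"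
    if "\<And>n. F n \<in> carrier A" "\<And>n. G n \<in> carrier A" "\<And>n. F' n \<in> carrier A" "\<And>n. G' n \<in> carrier A"
    for F G F' G' and n :: nat
    using that by (intro finsum_addf) auto
  note [simp] = power_series_closed power_series_add_closed cauchy_product_closed c
  show ?thesis
    by (intro star_algebra.intro star_algebra_axioms.intro ag; simp add: power_series_algebra_def
        cauchy_product_assoc l_distr r_distr distr smult_l_distr smult_r_distr smult_assoc1 smult_one
        smult_finsum smult_mult_left smult_mult_right star_star star_add star_mult star_smult cong: finsum_cong)
qed

lemma seminormed_star_algebra_carrier_update:
  assumes "additive_subgroup S A" "\<And>c x. x \<in> S \<Longrightarrow> c \<odot> x \<in> S"
    "\<And>x y. \<lbrakk>x \<in> S; y \<in> S\<rbrakk> \<Longrightarrow> x \<otimes> y \<in> S" "\<And>x. x \<in> S \<Longrightarrow> star A x \<in> S"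
  shows "seminormed_star_algebra (A\<lparr>carrier := S\<rparr>)"
proof -
  interpret S: additive_subgroup S A by fact
  note [simp, intro] = subsetD[OF S.a_subset]
  show ?thesis
    by (intro seminormed_star_algebra.intro seminormed_star_algebra_axioms.intro star_algebra_carrier_update assms)
      (auto simp: seminorm_nonneg seminorm_zero seminorm_triangle seminorm_smult seminorm_mult seminorm_star)
qed

end

text \<open>Contractivity keeps the image absolutely summable. The seminormed setting covers
  quotient maps as well as homomorphisms of C*-algebras.\<close>

lemma ps_map_star_hom:
  assumes "seminormed_star_algebra A" "seminormed_star_algebra B" "h \<in> contractive_hom A B"
  shows "ps_map h \<in> star_hom (power_series_algebra K A) (power_series_algebra K B)"
proof -
  interpret A: seminormed_star_algebra A by fact
  interpret B: seminormed_star_algebra B by fact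
  have h: "h \<in> star_hom A B" and le: "\<And>x. x \<in> carrier A \<Longrightarrow> nrm B (h x) \<le> nrm A x"
    using assms(3) by (auto simp: contractive_hom_def)
  note hs = star_hom_simps[OF h]
  have c: "F n \<in> carrier A" if "F \<in> power_series A" for F n using that by (auto simp: power_series_def)
  have closed: "ps_map h F \<in> power_series B" if F: "F \<in> power_series A" for F
  proof -
    have "summable (\<lambda>n. nrm A (F n))" using F by (auto simp: power_series_def)
    then have "summable (\<lambda>n. nrm B (h (F n)))"
      by (rule summable_comparison_test') (simp add: B.seminorm_nonneg le c[OF F] hs(1))
    then show ?thesis by (simp add: power_series_def ps_map_def hs(1) c[OF F])
  qed
  have mult: "h (\<Oplus>\<^bsub>A\<^esub>i\<in>{..n}. F i \<otimes>\<^bsub>A\<^esub> G (n - i)) = (\<Oplus>\<^bsub>B\<^esub>i\<in>{..n}. h (F i) \<otimes>\<^bsub>B\<^esub> h (G (n - i)))"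
    if F: "F \<in> power_series A" and G: "G \<in> power_series A" for F G n
  proof -
    have "h (\<Oplus>\<^bsub>A\<^esub>i\<in>{..n}. F i \<otimes>\<^bsub>A\<^esub> G (n - i)) = (\<Oplus>\<^bsub>B\<^esub>i\<in>{..n}. h (F i \<otimes>\<^bsub>A\<^esub> G (n - i)))"
      using hs(1,2) c[OF F] c[OF G]
      by (intro additive_map_finsum[OF A.abelian_group_axioms B.abelian_group_axioms]) blast+
    also have "\<dots> = (\<Oplus>\<^bsub>B\<^esub>i\<in>{..n}. h (F i) \<otimes>\<^bsub>B\<^esub> h (G (n - i)))"
      using hs(1) c[OF F] c[OF G] by (intro B.finsum_cong') (auto simp: hs(3))
    finally show ?thesis .
  qed
  show ?thesis
  proof (rule star_homI)
    fix F assume "F \<in> carrier (power_series_algebra K A)"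
    then have F: "F \<in> power_series A" by (simp add: power_series_algebra_def)
    show "ps_map h F \<in> carrier (power_series_algebra K B)"
      "ps_map h (d \<odot>\<^bsub>power_series_algebra K A\<^esub> F) = d \<odot>\<^bsub>power_series_algebra K B\<^esub> ps_map h F"
      "ps_map h (star (power_series_algebra K A) F) = star (power_series_algebra K B) (ps_map h F)" for d
      using closed[OF F] c[OF F] by (simp_all add: power_series_algebra_def ps_map_def hs(4,5))
    fix G assume "G \<in> carrier (power_series_algebra K A)"
    then have G: "G \<in> power_series A" by (simp add: power_series_algebra_def)
    show "ps_map h (F \<oplus>\<^bsub>power_series_algebra K A\<^esub> G) =
        ps_map h F \<oplus>\<^bsub>power_series_algebra K B\<^esub> ps_map h G"
      "ps_map h (F \<otimes>\<^bsub>power_series_algebra K A\<^esub> G) =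
        ps_map h F \<otimes>\<^bsub>power_series_algebra K B\<^esub> ps_map h G"
      using c[OF F] c[OF G] by (simp_all add: power_series_algebra_def ps_map_def hs(2) mult[OF F G])
  qed
qed

lemma power_series_carrier_update:
  "S \<subseteq> carrier A \<Longrightarrow> power_series (A\<lparr>carrier := S\<rparr>) = {F \<in> power_series A. \<forall>n. F n \<in> S}"
  by (auto simp: power_series_def)

lemma power_series_carrier [dest]: "F \<in> power_series A \<Longrightarrow> F n \<in> carrier A"
  by (auto simp: power_series_def)

section \<open>Limits in normed star algebras\<close>

text \<open>A sequential form of convergence in \<open>ctop A\<close> that carries the membership
  facts with it.\<close>

definition norm_lim :: "('a, 'm) normed_star_algebra_scheme \<Rightarrow> (nat \<Rightarrow> 'a) \<Rightarrow> 'a \<Rightarrow> bool" where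
  "norm_lim A s L \<longleftrightarrow> (\<forall>n. s n \<in> carrier A) \<and> L \<in> carrier A \<and> (\<lambda>n. nrm A (s n \<ominus>\<^bsub>A\<^esub> L)) \<longlonglongrightarrow> 0"

sublocale pre_cstar_algebra \<subseteq> seminormed_star_algebra A
proof
  show z: "nrm A \<zero> = 0" by (simp add: nrm_eq_0)
  fix x assume x: "x \<in> carrier A"
  \<comment> \<open>The C*-identity gives norm(y)^2 \<le> norm(\<open>star A y\<close>) norm(y), and
    norm(y) cancels. Applied to \<open>star A y\<close> as well, this yields equality.\<close>
  have le: "nrm A y \<le> nrm A (star A y)" if y: "y \<in> carrier A" for y
  proof (cases "y = \<zero>")
    case False
    have "nrm A y * nrm A y \<le> nrm A (star A y) * nrm A y"
      using nrm_mult[of "star A y" y] nrm_cstar[of y] y by (simp add: power2_eq_square)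
    moreover have "0 < nrm A y" using False y nrm_nonneg[of y] nrm_eq_0[of y] by linarith
    ultimately show ?thesis by simp
  qed simp
  show "nrm A (star A x) = nrm A x"
    using le[of x] le[of "star A x"] x by (simp add: star_star)
qed (auto simp: nrm_nonneg nrm_triangle nrm_smult nrm_mult)

context pre_cstar_algebra
begin

sublocale Met: Metric_space "carrier A" "cdist A"
  by (rule Metric_space_cdist)

lemma nrm_minus_commute: "\<lbrakk>x \<in> carrier A; y \<in> carrier A\<rbrakk> \<Longrightarrow> nrm A (x \<ominus> y) = nrm A (y \<ominus> x)"
  using Met.commute[of x y] by (simp add: cdist_def)

lemma nrm_diff_triangle: "\<lbrakk>x \<in> carrier A; y \<in> carrier A\<rbrakk> \<Longrightarrow> nrm A (x \<ominus> y) \<le> nrm A x + nrm A y"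
  using nrm_triangle[of x "\<ominus> y"] by (simp add: minus_eq seminorm_minus)

lemma minus_eq_zero_iff: "\<lbrakk>x \<in> carrier A; y \<in> carrier A\<rbrakk> \<Longrightarrow> x \<ominus> y = \<zero> \<longleftrightarrow> x = y"
  using Met.mdist_zero Met.zero[of x y] nrm_eq_0[of "x \<ominus> y"] by (simp add: cdist_def)

lemma diff_add_cancel: "\<lbrakk>x \<in> carrier A; y \<in> carrier A\<rbrakk> \<Longrightarrow> (x \<ominus> y) \<oplus> y = x"
  by algebra

lemma nrm_triangle_sub: "\<lbrakk>x \<in> carrier A; y \<in> carrier A\<rbrakk> \<Longrightarrow> nrm A x \<le> nrm A (x \<ominus> y) + nrm A y"
  using nrm_triangle[of "x \<ominus> y" y] by (simp add: diff_add_cancel)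

lemma abs_nrm_diff: "\<lbrakk>x \<in> carrier A; y \<in> carrier A\<rbrakk> \<Longrightarrow> \<bar>nrm A x - nrm A y\<bar> \<le> nrm A (x \<ominus> y)"
  using nrm_triangle_sub[of x y] nrm_triangle_sub[of y x] nrm_minus_commute[of x y] by linarith

lemma norm_lim_iff_limitin:
  assumes "\<And>n. s n \<in> carrier A"
  shows "limitin (ctop A) s L sequentially \<longleftrightarrow> norm_lim A s L"
  using assms by (cases "L \<in> carrier A") (auto simp: Met.limitin_metric_dist_null norm_lim_def cdist_def)

lemma MCauchy_iff:
  "Met.MCauchy s \<longleftrightarrow> (\<forall>n. s n \<in> carrier A) \<and>
    (\<forall>e>0. \<exists>N. \<forall>m\<ge>N. \<forall>n\<ge>N. nrm A (s m \<ominus> s n) < e)"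
proof (cases "\<forall>n. s n \<in> carrier A")
  case True
  then have "range s \<subseteq> carrier A" by auto
  then show ?thesis using True unfolding Met.MCauchy_def by (simp add: cdist_def)
qed (auto simp: Met.MCauchy_def)

lemma norm_lim_unique:
  assumes "norm_lim A s L" "norm_lim A s M"
  shows "L = M"
proof -
  have "limitin (ctop A) s L sequentially" "limitin (ctop A) s M sequentially"
    using assms norm_lim_iff_limitin[of s] by (auto simp: norm_lim_def)
  then show ?thesis using Met.limitin_metric_unique trivial_limit_sequentially by blast
qed

lemma norm_limI:
  assumes "\<And>n. s n \<in> carrier A" "L \<in> carrier A" "\<And>n. nrm A (s n \<ominus> L) \<le> e n" "e \<longlonglongrightarrow> 0"
  shows "norm_lim A s L"
  unfolding norm_lim_def
proof (intro conjI allI assms)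
  show "(\<lambda>n. nrm A (s n \<ominus> L)) \<longlonglongrightarrow> 0"
    by (rule Lim_null_comparison[OF _ assms(4)]) (simp add: assms nrm_nonneg)
qed

lemma norm_lim_nrm: "norm_lim A s L \<Longrightarrow> (\<lambda>n. nrm A (s n)) \<longlonglongrightarrow> nrm A L"
proof -
  assume a: "norm_lim A s L"
  have "(\<lambda>n. nrm A (s n) - nrm A L) \<longlonglongrightarrow> 0"
    by (rule Lim_null_comparison[where g="\<lambda>n. nrm A (s n \<ominus> L)"])
      (use a in \<open>auto simp: norm_lim_def abs_nrm_diff\<close>)
  then show ?thesis by (simp add: LIM_zero_iff)
qed

lemma norm_lim_const: "x \<in> carrier A \<Longrightarrow> norm_lim A (\<lambda>_. x) x"
  by (simp add: norm_lim_def minus_eq r_neg seminorm_zero)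

lemma nrm_add_diff_le:
  assumes "a \<in> carrier A" "b \<in> carrier A" "a' \<in> carrier A" "b' \<in> carrier A"
  shows "nrm A ((a \<oplus> b) \<ominus> (a' \<oplus> b')) \<le> nrm A (a \<ominus> a') + nrm A (b \<ominus> b')"
proof -
  have "(a \<oplus> b) \<ominus> (a' \<oplus> b') = (a \<ominus> a') \<oplus> (b \<ominus> b')" using assms by algebra
  then show ?thesis using nrm_triangle[of "a \<ominus> a'" "b \<ominus> b'"] assms by simp
qed

lemma nrm_smult_diff:
  assumes "a \<in> carrier A" "a' \<in> carrier A"
  shows "nrm A (c \<odot> a \<ominus> c \<odot> a') = cmod c * nrm A (a \<ominus> a')"
proof -
  have "c \<odot> a \<ominus> c \<odot> a' = c \<odot> (a \<ominus> a')" using assms by algebra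
  then show ?thesis using assms by (simp add: nrm_smult)
qed

lemma nrm_star_diff:
  assumes "a \<in> carrier A" "a' \<in> carrier A"
  shows "nrm A (star A a \<ominus> star A a') = nrm A (a \<ominus> a')"
proof -
  have "star A a \<ominus> star A a' = star A (a \<ominus> a')" using assms by algebra
  then show ?thesis using assms by (simp add: seminorm_star)
qed

lemma norm_lim_add:
  assumes "norm_lim A s L" "norm_lim A t M"
  shows "norm_lim A (\<lambda>n. s n \<oplus> t n) (L \<oplus> M)"
proof (rule norm_limI)
  fix n
  have c: "s n \<in> carrier A" "t n \<in> carrier A" "L \<in> carrier A" "M \<in> carrier A"
    using assms by (auto simp: norm_lim_def)
  then show "nrm A ((s n \<oplus> t n) \<ominus> (L \<oplus> M)) \<le> nrm A (s n \<ominus> L) + nrm A (t n \<ominus> M)"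
    by (rule nrm_add_diff_le)
next
  show "(\<lambda>n. nrm A (s n \<ominus> L) + nrm A (t n \<ominus> M)) \<longlonglongrightarrow> 0"
    using assms tendsto_add[of _ 0 _ _ 0] by (auto simp: norm_lim_def)
qed (use assms in \<open>auto simp: norm_lim_def\<close>)

lemma norm_lim_smult:
  assumes "norm_lim A s L"
  shows "norm_lim A (\<lambda>n. c \<odot> s n) (c \<odot> L)"
proof (rule norm_limI)
  fix n
  have c: "s n \<in> carrier A" "L \<in> carrier A" using assms by (auto simp: norm_lim_def)
  then show "nrm A (c \<odot> s n \<ominus> c \<odot> L) \<le> cmod c * nrm A (s n \<ominus> L)" by (simp add: nrm_smult_diff)
next
  show "(\<lambda>n. cmod c * nrm A (s n \<ominus> L)) \<longlonglongrightarrow> 0"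
    using assms by (auto simp: norm_lim_def intro: tendsto_mult_right_zero)
qed (use assms in \<open>auto simp: norm_lim_def\<close>)

lemma norm_lim_star:
  assumes "norm_lim A s L"
  shows "norm_lim A (\<lambda>n. star A (s n)) (star A L)"
proof (rule norm_limI)
  fix n
  have c: "s n \<in> carrier A" "L \<in> carrier A" using assms by (auto simp: norm_lim_def)
  then show "nrm A (star A (s n) \<ominus> star A L) \<le> nrm A (s n \<ominus> L)" by (simp add: nrm_star_diff)
qed (use assms in \<open>auto simp: norm_lim_def\<close>)

lemma nrm_mult_diff_le:
  assumes "a \<in> carrier A" "b \<in> carrier A" "a' \<in> carrier A" "b' \<in> carrier A"
  shows "nrm A (a \<otimes> b \<ominus> a' \<otimes> b') \<le> nrm A a * nrm A (b \<ominus> b') + nrm A (a \<ominus> a') * nrm A b'"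
proof -
  have "a \<otimes> b \<ominus> a' \<otimes> b' = a \<otimes> (b \<ominus> b') \<oplus> (a \<ominus> a') \<otimes> b'" using assms by algebra
  then show ?thesis
    using nrm_triangle[of "a \<otimes> (b \<ominus> b')" "(a \<ominus> a') \<otimes> b'"] nrm_mult[of a "b \<ominus> b'"]
      nrm_mult[of "a \<ominus> a'" b'] assms by simp
qed

lemma norm_lim_mult:
  assumes "norm_lim A s L" "norm_lim A t M"
  shows "norm_lim A (\<lambda>n. s n \<otimes> t n) (L \<otimes> M)"
proof (rule norm_limI)
  fix n
  have c: "s n \<in> carrier A" "t n \<in> carrier A" "L \<in> carrier A" "M \<in> carrier A"
    using assms by (auto simp: norm_lim_def)
  then show "nrm A (s n \<otimes> t n \<ominus> L \<otimes> M) \<le> nrm A (s n) * nrm A (t n \<ominus> M) + nrm A (s n \<ominus> L) * nrm A M"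
    by (rule nrm_mult_diff_le)
next
  have "(\<lambda>n. nrm A (s n) * nrm A (t n \<ominus> M) + nrm A (s n \<ominus> L) * nrm A M) \<longlonglongrightarrow> nrm A L * 0 + 0 * nrm A M"
    using assms norm_lim_nrm[OF assms(1)] by (intro tendsto_intros) (auto simp: norm_lim_def)
  then show "(\<lambda>n. nrm A (s n) * nrm A (t n \<ominus> M) + nrm A (s n \<ominus> L) * nrm A M) \<longlonglongrightarrow> 0" by simp
qed (use assms in \<open>auto simp: norm_lim_def\<close>)

lemma norm_lim_minus:
  assumes "norm_lim A s L" "norm_lim A t M"
  shows "norm_lim A (\<lambda>n. s n \<ominus> t n) (L \<ominus> M)"
proof -
  have c: "t n \<in> carrier A" "M \<in> carrier A" for n using assms by (auto simp: norm_lim_def)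
  show ?thesis
    using norm_lim_add[OF assms(1) norm_lim_smult[OF assms(2), of "-1"]] c
    by (simp add: smult_minus_left smult_one minus_eq)
qed

lemma closedin_norm_lim:
  assumes "closedin (ctop A) S" "norm_lim A s L" "\<And>n. s n \<in> S"
  shows "L \<in> S"
proof -
  have "limitin (ctop A) s L sequentially" using assms(2) norm_lim_iff_limitin[of s L] by (auto simp: norm_lim_def)
  then show ?thesis using assms(1,3) unfolding Met.metric_closedin_iff_sequentially_closed by blast
qed

lemma closedinI_norm_lim:
  assumes "S \<subseteq> carrier A" "\<And>s L. \<lbrakk>\<And>n. s n \<in> S; norm_lim A s L\<rbrakk> \<Longrightarrow> L \<in> S"
  shows "closedin (ctop A) S"
  unfolding Met.metric_closedin_iff_sequentially_closed
proof (intro conjI assms(1) allI impI)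
  fix s l assume "range s \<subseteq> S \<and> limitin (ctop A) s l sequentially"
  then show "l \<in> S" using assms norm_lim_iff_limitin[of s l] by (metis range_subsetD subsetD)
qed

end

lemma contractive_hom_norm_lim:
  assumes "pre_cstar_algebra A" "pre_cstar_algebra B" "h \<in> contractive_hom A B" "norm_lim A s L"
  shows "norm_lim B (\<lambda>n. h (s n)) (h L)"
proof -
  interpret A: pre_cstar_algebra A by fact
  interpret B: pre_cstar_algebra B by fact
  have h: "h \<in> star_hom A B" and le: "\<And>x. x \<in> carrier A \<Longrightarrow> nrm B (h x) \<le> nrm A x"
    using assms(3) by (auto simp: contractive_hom_def)
  have c: "s n \<in> carrier A" "L \<in> carrier A" for n using assms(4) by (auto simp: norm_lim_def)
  have "h (s n) \<ominus>\<^bsub>B\<^esub> h L = h (s n \<ominus>\<^bsub>A\<^esub> L)" for n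
  proof -
    have "h (s n \<ominus>\<^bsub>A\<^esub> L) = h (s n \<oplus>\<^bsub>A\<^esub> (-1) \<odot>\<^bsub>A\<^esub> L)" using c by (simp add: A.minus_eq A.smult_minus_one)
    also have "\<dots> = h (s n) \<oplus>\<^bsub>B\<^esub> (-1) \<odot>\<^bsub>B\<^esub> h L" using c by (simp add: star_hom_simps[OF h])
    finally show ?thesis using c by (simp add: B.minus_eq B.smult_minus_one star_hom_simps[OF h])
  qed
  then show ?thesis
    using c assms(4) by (intro B.norm_limI) (auto simp: star_hom_simps[OF h] le norm_lim_def)
qed

lemma (in seminormed_star_algebra) nrm_partial_sums_diff_le:
  fixes F :: "nat \<Rightarrow> 'a"
  assumes c: "\<And>n. F n \<in> carrier A" and "m \<le> n"
  shows "nrm A ((\<Oplus>k\<in>{..<n}. F k) \<ominus> (\<Oplus>k\<in>{..<m}. F k)) \<le> (\<Sum>k=m..<n. nrm A (F k))"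
proof -
  have "(\<Oplus>k\<in>{..<n}. F k) = (\<Oplus>k\<in>{..<m} \<union> {m..<n}. F k)"
    using assms(2) by (simp add: ivl_disj_un_one)
  also have "\<dots> = (\<Oplus>k\<in>{..<m}. F k) \<oplus> (\<Oplus>k\<in>{m..<n}. F k)"
    by (rule finsum_Un_disjoint) (auto simp: c)
  finally have "(\<Oplus>k\<in>{..<n}. F k) \<ominus> (\<Oplus>k\<in>{..<m}. F k) =
      ((\<Oplus>k\<in>{..<m}. F k) \<oplus> (\<Oplus>k\<in>{m..<n}. F k)) \<ominus> (\<Oplus>k\<in>{..<m}. F k)" by simp
  also have "\<dots> = (\<Oplus>k\<in>{m..<n}. F k)"
  proof -
    have "(x \<oplus> y) \<ominus> x = y" if "x \<in> carrier A" "y \<in> carrier A" for x y using that by algebra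
    then show ?thesis by (simp add: c Pi_def)
  qed
  finally show ?thesis using seminorm_finsum[of "{m..<n}" F] c by simp
qed

lemma (in seminormed_star_algebra) nrm_partial_sums_le:
  assumes "F \<in> power_series A"
  shows "nrm A (\<Oplus>n\<in>{..<N}. F n) \<le> (\<Sum>n. nrm A (F n))"
proof -
  have "nrm A (\<Oplus>n\<in>{..<N}. F n) \<le> (\<Sum>n<N. nrm A (F n))"
    using assms by (intro seminorm_finsum) auto
  also have "\<dots> \<le> (\<Sum>n. nrm A (F n))"
    using assms by (intro sum_le_suminf) (auto simp: power_series_def seminorm_nonneg)
  finally show ?thesis .
qed

context cstar_algebra
begin

text \<open>Completeness turns absolute summability into convergence. This serves for evaluation,
  for telescoping iterates and for the corrections in the lifting argument.\<close>

lemma power_series_norm_lim: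
  assumes F: "F \<in> power_series A"
  shows "\<exists>L. norm_lim A (\<lambda>N. \<Oplus>n\<in>{..<N}. F n) L"
proof -
  have c: "F n \<in> carrier A" for n using F by auto
  have c': "(\<Oplus>n\<in>{..<N}. F n) \<in> carrier A" for N :: nat by (simp add: c Pi_def)
  have "Met.MCauchy (\<lambda>N. \<Oplus>n\<in>{..<N}. F n)"
    unfolding MCauchy_iff
  proof (intro conjI allI impI)
    fix e :: real assume "0 < e"
    moreover have "summable (\<lambda>n. nrm A (F n))" using F by (auto simp: power_series_def)
    ultimately obtain N where N: "\<And>m n. m \<ge> N \<Longrightarrow> norm (\<Sum>k=m..<n. nrm A (F k)) < e"
      unfolding summable_Cauchy by blast
    have le: "nrm A ((\<Oplus>k\<in>{..<n}. F k) \<ominus> (\<Oplus>k\<in>{..<m}. F k)) < e" if "m \<ge> N" "m \<le> n" for m n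
      using nrm_partial_sums_diff_le[of F m n, OF c that(2)] N[OF that(1), of n] by simp
    have "nrm A ((\<Oplus>k\<in>{..<m}. F k) \<ominus> (\<Oplus>k\<in>{..<n}. F k)) < e" if "m \<ge> N" "n \<ge> N" for m n
      using le[of m n] le[of n m] nrm_minus_commute[OF c'[of m] c'[of n]] that by (cases "m \<le> n") auto
    then show "\<exists>N. \<forall>m\<ge>N. \<forall>n\<ge>N. nrm A ((\<Oplus>k\<in>{..<m}. F k) \<ominus> (\<Oplus>k\<in>{..<n}. F k)) < e" by blast
  qed (rule c')
  then show ?thesis
    using complete norm_lim_iff_limitin[of "\<lambda>N. \<Oplus>n\<in>{..<N}. F n"] c'
    unfolding Met.mcomplete_def by blast
qed

text \<open>Banach's fixed point theorem on a sequentially closed set. A suitable choice of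
  \<open>S\<close> makes the fixed point selfadjoint and commuting with a given element.\<close>

lemma contraction_fixed_point:
  assumes S: "S \<subseteq> carrier A" "p \<in> S" and T: "\<And>x. x \<in> S \<Longrightarrow> T x \<in> S"
    and closed: "\<And>s L. \<lbrakk>\<And>n. s n \<in> S; norm_lim A s L\<rbrakk> \<Longrightarrow> L \<in> S"
    and r: "0 \<le> r" "r < 1"
    and contr: "\<And>x y. \<lbrakk>x \<in> S; y \<in> S\<rbrakk> \<Longrightarrow> nrm A (T x \<ominus> T y) \<le> r * nrm A (x \<ominus> y)"
  shows "\<exists>x\<in>S. T x = x"
proof -
  define s where "s n = (T ^^ n) p" for n
  have sS: "s n \<in> S" for n by (induction n) (auto simp: s_def S T)
  then have c [simp]: "s n \<in> carrier A" "T (s n) \<in> carrier A" for n using S T by auto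
  have s_Suc: "s (Suc n) = T (s n)" for n by (simp add: s_def)
  \<comment> \<open>The increments of the iteration form an absolutely summable series whose partial
    sums are s N - s 0.\<close>
  define F where "F n = s (Suc n) \<ominus> s n" for n
  have F: "nrm A (F n) \<le> r ^ n * nrm A (F 0)" for n
  proof (induction n)
    case (Suc n)
    have "nrm A (F (Suc n)) \<le> r * nrm A (F n)"
      using contr[OF sS sS, of "Suc n" n] by (simp add: F_def s_Suc)
    also have "\<dots> \<le> r * (r ^ n * nrm A (F 0))" using Suc r by (intro mult_left_mono)
    finally show ?case by simp
  qed simp
  have "F \<in> power_series A"
  proof -
    have "summable (\<lambda>n. r ^ n * nrm A (F 0))" using r by (intro summable_mult2 summable_geometric) simp
    then have "summable (\<lambda>n. nrm A (F n))"
      by (rule summable_comparison_test') (use F in \<open>simp add: nrm_nonneg F_def\<close>)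
    then show ?thesis by (simp add: power_series_def F_def)
  qed
  then obtain L where L: "norm_lim A (\<lambda>N. \<Oplus>n\<in>{..<N}. F n) L" using power_series_norm_lim by blast
  have "s N = (\<Oplus>n\<in>{..<N}. F n) \<oplus> s 0" for N
  proof (induction N)
    case (Suc N)
    have F_c: "F n \<in> carrier A" for n by (simp add: F_def)
    have "(\<Oplus>n\<in>{..<Suc N}. F n) \<oplus> s 0 = F N \<oplus> ((\<Oplus>n\<in>{..<N}. F n) \<oplus> s 0)"
      using F_c by (simp add: lessThan_Suc Pi_def a_assoc)
    also have "\<dots> = s (Suc N)" by (simp only: Suc[symmetric]) (simp add: F_def diff_add_cancel)
    finally show ?case by simp
  qed simp
  then have lim: "norm_lim A s (L \<oplus> s 0)"
    using norm_lim_add[OF L norm_lim_const[of "s 0"]] by (metis (no_types, lifting) c(1) ext)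
  define x where "x = L \<oplus> s 0"
  have xS: "x \<in> S" using closed[OF sS] lim by (simp add: x_def)
  then have x: "x \<in> carrier A" "T x \<in> carrier A" using S T by auto
  have lim: "norm_lim A s x" using lim by (simp add: x_def)
  have "norm_lim A (\<lambda>n. s (Suc n)) x"
    using lim by (auto simp: norm_lim_def intro: LIMSEQ_Suc[where f="\<lambda>n. nrm A (s n \<ominus> x)"])
  moreover have "norm_lim A (\<lambda>n. s (Suc n)) (T x)"
  proof (rule norm_limI)
    show "nrm A (s (Suc n) \<ominus> T x) \<le> r * nrm A (s n \<ominus> x)" for n using contr[OF sS xS] by (simp add: s_Suc)
    show "(\<lambda>n. r * nrm A (s n \<ominus> x)) \<longlonglongrightarrow> 0"
      using lim by (auto simp: norm_lim_def intro: tendsto_mult_right_zero)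
  qed (auto simp: x)
  ultimately show ?thesis using norm_lim_unique xS by blast
qed

end

section \<open>Contractivity, lifting and closed ideals without spectral theory\<close>

context pre_cstar_algebra
begin

text \<open>For c = i or c = -i the cross terms in the C*-identity are c times a difference that
  vanishes by \<open>comm\<close>, while -(c c) = 1 leaves the sum of squares.\<close>

lemma nrm_skew_combination:
  assumes c: "a \<in> carrier A" "b \<in> carrier A" and comm: "star A a \<otimes> b = star A b \<otimes> a"
    and i: "cnj c = - c" "c * c = -1"
  shows "(nrm A (a \<oplus> c \<odot> b))\<^sup>2 = nrm A (star A a \<otimes> a \<oplus> star A b \<otimes> b)"
proof -
  have "star A (a \<oplus> c \<odot> b) \<otimes> (a \<oplus> c \<odot> b) =
      star A a \<otimes> a \<oplus> (c \<odot> (star A a \<otimes> b) \<ominus> c \<odot> (star A b \<otimes> a)) \<oplus> (- (c * c)) \<odot> (star A b \<otimes> b)"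
    using c i(1) by (simp add: star_algebra_simprules)
  also have "\<dots> = star A a \<otimes> a \<oplus> star A b \<otimes> b"
    using c by (simp add: comm i(2) minus_eq r_neg smult_one)
  finally show ?thesis using nrm_cstar[of "a \<oplus> c \<odot> b"] c by simp
qed

text \<open>In the unitization, \<open>h + i(1 - g)\<close> is unitary, so its real and imaginary parts are contractions.\<close>

lemma unitary_parts_contractive:
  assumes c: "g \<in> carrier A" "h \<in> carrier A" "y \<in> carrier A"
    and gh: "g \<otimes> h = h \<otimes> g" "star A h = h" "star A g = g" and hh: "h \<otimes> h = g \<oplus> g \<ominus> g \<otimes> g"
  shows "nrm A (h \<otimes> y) \<le> nrm A y" "nrm A (y \<ominus> g \<otimes> y) \<le> nrm A y"
proof -
  \<comment> \<open>a + ib is the formal unitary h + i(1 - g) applied to y, and a - ib is its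
    adjoint applied to y.\<close>
  define a where "a = h \<otimes> y"
  define b where "b = y \<ominus> g \<otimes> y"
  have ab: "a \<in> carrier A" "b \<in> carrier A" using c by (auto simp: a_def b_def)
  have 1: "g \<otimes> (h \<otimes> y) = h \<otimes> (g \<otimes> y)" using c gh by (metis m_assoc)
  have 2: "h \<otimes> (h \<otimes> y) = g \<otimes> y \<oplus> g \<otimes> y \<ominus> g \<otimes> (g \<otimes> y)"
    using c hh by (simp flip: m_assoc) algebra
  have comm: "star A a \<otimes> b = star A b \<otimes> a" unfolding a_def b_def using c gh 1 by algebra
  \<comment> \<open>\<open>hh\<close> is the relation h^2 + (1 - g)^2 = 1 written without a unit;
    here it is placed between \<open>star A y\<close> and y.\<close>
  have sum: "star A a \<otimes> a \<oplus> star A b \<otimes> b = star A y \<otimes> y"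
    unfolding a_def b_def using c gh(2,3) 2 by algebra
  have nrm: "nrm A (a \<oplus> c \<odot> b) = nrm A y" if "cnj c = - c" "c * c = -1" for c
    using nrm_skew_combination[OF ab comm that] sum nrm_cstar[OF c(3)] nrm_nonneg ab c
    by (simp add: power2_eq_iff_nonneg)
  \<comment> \<open>Both combinations have the norm of y. Since 2a is their sum and 2ib their
    difference, the triangle inequality bounds both parts.\<close>
  have i: "nrm A (a \<oplus> \<i> \<odot> b) = nrm A y" "nrm A (a \<oplus> (-\<i>) \<odot> b) = nrm A y"
    by (rule nrm; simp)+
  have "2 \<odot> a = (1 + 1) \<odot> a" by simp
  also have "\<dots> = (a \<oplus> \<i> \<odot> b) \<oplus> (a \<oplus> (-\<i>) \<odot> b)"
    using ab by (simp only: smult_l_distr smult_one) algebra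
  finally have "2 * nrm A a \<le> nrm A y + nrm A y"
    using nrm_smult[OF ab(1), of 2] nrm_triangle[of "a \<oplus> \<i> \<odot> b" "a \<oplus> (-\<i>) \<odot> b"] i ab by simp
  then show "nrm A (h \<otimes> y) \<le> nrm A y" by (simp add: a_def)
  have "(2 * \<i>) \<odot> b = (\<i> + \<i>) \<odot> b" by simp
  also have "\<dots> = (a \<oplus> \<i> \<odot> b) \<ominus> (a \<oplus> (-\<i>) \<odot> b)"
    using ab by (simp only: smult_l_distr smult_one) algebra
  finally have "2 * nrm A b \<le> nrm A y + nrm A y"
    using nrm_smult[OF ab(2), of "2 * \<i>"] nrm_diff_triangle[of "a \<oplus> \<i> \<odot> b" "a \<oplus> (-\<i>) \<odot> b"] i ab
    by (simp add: norm_mult)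
  then show "nrm A (y \<ominus> g \<otimes> y) \<le> nrm A y" by (simp add: b_def)
qed

text \<open>Testing on y = h gives norm(h)^2 = norm(h h) \<le> norm(h).\<close>

lemma nrm_selfadjoint_le_1:
  assumes "h \<in> carrier A" "star A h = h" "\<And>y. y \<in> carrier A \<Longrightarrow> nrm A (h \<otimes> y) \<le> nrm A y"
  shows "nrm A h \<le> 1"
proof -
  have "nrm A h * nrm A h \<le> 1 * nrm A h"
    using nrm_cstar[OF assms(1)] assms(2) assms(3)[OF assms(1)] by (simp add: power2_eq_square)
  then show ?thesis using nrm_nonneg[OF assms(1)] by (cases "nrm A h = 0") auto
qed

lemma smult_two: "x \<in> carrier A \<Longrightarrow> 2 \<odot> x = x \<oplus> x"
  using smult_l_distr[of x 1 1] by (simp add: smult_one)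

lemma smult_half: "x \<in> carrier A \<Longrightarrow> (1/2) \<odot> x \<oplus> (1/2) \<odot> x = x"
  using smult_l_distr[of x "1/2" "1/2"] by (simp add: smult_one)

text \<open>With \<open>k = a\<^sup>2 / (1 + a\<^sup>2)\<close>, the Cayley transform of \<open>a\<close> has real part \<open>1 - 2k\<close>
  and imaginary part \<open>2a(1 - k)\<close>.\<close>

lemma cayley_contractive:
  assumes c: "a \<in> carrier A" "k \<in> carrier A" and sa: "star A a = a" "star A k = k"
    and ka: "k \<otimes> a = a \<otimes> k" and k: "k = a \<otimes> a \<ominus> a \<otimes> (a \<otimes> k)"
  shows "nrm A (a \<ominus> a \<otimes> k) \<le> 1 / 2"
    and "y \<in> carrier A \<Longrightarrow> nrm A (y \<ominus> k \<otimes> y) \<le> nrm A y"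
proof -
  \<comment> \<open>Formally w = a (1 - k) = a/(1 + a^2). The unitary to which
    \<open>unitary_parts_contractive\<close> is applied has h = 2w and 1 - g = 1 - 2k.\<close>
  define w where "w = a \<ominus> a \<otimes> k"
  define h where "h = w \<oplus> w"
  define g where "g = k \<oplus> k"
  have cw: "w \<in> carrier A" "h \<in> carrier A" "g \<in> carrier A" using c by (auto simp: w_def h_def g_def)
  have 1: "k \<otimes> (a \<otimes> z) = a \<otimes> (k \<otimes> z)" if "z \<in> carrier A" for z using c ka that by (metis m_assoc)
  have "w \<otimes> w = (a \<otimes> a \<ominus> a \<otimes> (a \<otimes> k)) \<ominus> (a \<otimes> a \<ominus> a \<otimes> (a \<otimes> k)) \<otimes> k"
    unfolding w_def using c ka 1[of k] by algebra
  \<comment> \<open>Since k = a^2 (1 - k), the square a^2 (1 - k)^2 equals k (1 - k). Multiplied by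
    4 this becomes h^2 = 2g - g^2, the unitarity relation.\<close>
  then have ww: "w \<otimes> w = k \<ominus> k \<otimes> k" using k by simp
  have "h \<otimes> h = (w \<otimes> w \<oplus> w \<otimes> w) \<oplus> (w \<otimes> w \<oplus> w \<otimes> w)" unfolding h_def using cw(1) by algebra
  also have "\<dots> = g \<oplus> g \<ominus> g \<otimes> g" unfolding ww g_def using c by algebra
  finally have hh: "h \<otimes> h = g \<oplus> g \<ominus> g \<otimes> g" .
  have gh: "g \<otimes> h = h \<otimes> g" unfolding g_def h_def w_def using c ka 1[of k] by algebra
  have sw: "star A w = w" unfolding w_def using c sa ka by algebra
  have sh: "star A h = h" unfolding h_def using cw sw by algebra
  have sg: "star A g = g" unfolding g_def using c sa by algebra
  note contr = unitary_parts_contractive[OF cw(3,2) _ gh sh sg hh]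
  have "nrm A h \<le> 1" using nrm_selfadjoint_le_1[OF cw(2) sh contr(1)] .
  moreover have "nrm A h = 2 * nrm A w"
    using nrm_smult[OF cw(1), of 2] cw(1) by (simp add: h_def smult_two)
  ultimately show "nrm A (a \<ominus> a \<otimes> k) \<le> 1 / 2" by (simp add: w_def)
  assume y: "y \<in> carrier A"
  \<comment> \<open>1 - k is the average of the identity and the contraction 1 - g.\<close>
  have "2 \<odot> (y \<ominus> k \<otimes> y) = y \<oplus> (y \<ominus> g \<otimes> y)"
    unfolding g_def smult_two[OF minus_closed[OF y m_closed[OF c(2) y]]] using c y by algebra
  then have "2 * nrm A (y \<ominus> k \<otimes> y) \<le> nrm A y + nrm A y"
    using nrm_smult[of "y \<ominus> k \<otimes> y" 2] nrm_triangle[of y "y \<ominus> g \<otimes> y"] contr(2)[OF y] c y cw by simp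
  then show "nrm A (y \<ominus> k \<otimes> y) \<le> nrm A y" by simp
qed

end

section \<open>Square roots and quasi-inverses as fixed points\<close>

context cstar_algebra
begin

text \<open>Commutation with a fixed element and selfadjointness are closed conditions, as
  \<open>contraction_fixed_point\<close> demands of the set on which it works.\<close>

lemma norm_lim_commute:
  assumes "norm_lim A s L" "a \<in> carrier A" "\<And>n. s n \<otimes> a = a \<otimes> s n"
  shows "L \<otimes> a = a \<otimes> L"
  using norm_lim_mult[OF assms(1) norm_lim_const[OF assms(2)]]
    norm_lim_mult[OF norm_lim_const[OF assms(2)] assms(1)] assms(3) norm_lim_unique by simp

lemma norm_lim_selfadjoint:
  assumes "norm_lim A s L" "\<And>n. star A (s n) = s n"
  shows "star A L = L"
  using norm_lim_star[OF assms(1)] assms norm_lim_unique by simp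

text \<open>Here \<open>g = 1 - sqrt (1 - h\<^sup>2)\<close>.\<close>

lemma unitary_completion:
  assumes h: "h \<in> carrier A" "star A h = h" "nrm A h < 1"
  shows "\<exists>g\<in>carrier A. star A g = g \<and> g \<otimes> h = h \<otimes> g \<and> h \<otimes> h = g \<oplus> g \<ominus> g \<otimes> g"
proof -
  \<comment> \<open>A fixed point of T satisfies 2g = h^2 + g^2, the required relation. On the ball
    of radius norm(h), T has Lipschitz constant at most norm(h) < 1.\<close>
  define S where "S = {g \<in> carrier A. star A g = g \<and> g \<otimes> h = h \<otimes> g \<and> nrm A g \<le> nrm A h}"
  define T where "T g = (1/2) \<odot> (h \<otimes> h \<oplus> g \<otimes> g)" for g
  have "\<exists>x\<in>S. T x = x"
  proof (rule contraction_fixed_point[where r="nrm A h" and S=S and p=\<zero>])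
    show "S \<subseteq> carrier A" by (auto simp: S_def)
    show "\<zero> \<in> S" using h by (auto simp: S_def seminorm_zero nrm_nonneg)
    show "0 \<le> nrm A h" "nrm A h < 1" using h nrm_nonneg by auto
    fix x assume "x \<in> S"
    then have x: "x \<in> carrier A" "star A x = x" "x \<otimes> h = h \<otimes> x" "nrm A x \<le> nrm A h" by (auto simp: S_def)
    have 1: "x \<otimes> (h \<otimes> x) = h \<otimes> (x \<otimes> x)" using x h by (metis m_assoc)
    have "nrm A (h \<otimes> h \<oplus> x \<otimes> x) \<le> nrm A h * nrm A h + nrm A x * nrm A x"
      using nrm_triangle[of "h \<otimes> h" "x \<otimes> x"] nrm_mult[of h h] nrm_mult[of x x] x h by simp
    also have "nrm A h * nrm A h \<le> 1 * nrm A h" using h nrm_nonneg by (intro mult_right_mono) auto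
    also have "nrm A x * nrm A x \<le> 1 * nrm A h" using h x nrm_nonneg[OF h(1)] nrm_nonneg[OF x(1)] by (intro mult_mono) auto
    finally have "nrm A (T x) \<le> nrm A h" using x h by (simp add: T_def nrm_smult norm_divide)
    moreover have "star A (T x) = T x" using x h by (simp add: T_def star_smult star_add star_mult)
    moreover have "T x \<otimes> h = h \<otimes> T x" unfolding T_def using x(1,3) h(1) 1 by algebra
    ultimately show "T x \<in> S" using x h by (simp add: S_def T_def)
    fix y assume "y \<in> S"
    then have y: "y \<in> carrier A" "nrm A y \<le> nrm A h" by (auto simp: S_def)
    \<comment> \<open>The factorisation x^2 - y^2 = x (x - y) + (x - y) y holds even when x and y do
      not commute.\<close>
    have "T x \<ominus> T y = (1/2) \<odot> (x \<otimes> (x \<ominus> y) \<oplus> (x \<ominus> y) \<otimes> y)"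
      unfolding T_def using x(1) y(1) h(1) by algebra
    then have "nrm A (T x \<ominus> T y) \<le> (nrm A x * nrm A (x \<ominus> y) + nrm A (x \<ominus> y) * nrm A y) / 2"
      using nrm_triangle[of "x \<otimes> (x \<ominus> y)" "(x \<ominus> y) \<otimes> y"] nrm_mult[of x "x \<ominus> y"]
        nrm_mult[of "x \<ominus> y" y] x(1) y(1) by (simp add: nrm_smult norm_divide)
    also have "\<dots> \<le> (nrm A h * nrm A (x \<ominus> y) + nrm A (x \<ominus> y) * nrm A h) / 2"
      using x y h(1) nrm_nonneg by (intro divide_right_mono add_mono mult_mono) auto
    finally show "nrm A (T x \<ominus> T y) \<le> nrm A h * nrm A (x \<ominus> y)" by simp
  next
    fix s L assume s: "\<And>n. s n \<in> S" and L: "norm_lim A s L"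
    have "nrm A L \<le> nrm A h"
      by (rule tendsto_upperbound[OF norm_lim_nrm[OF L]]) (use s in \<open>auto simp: S_def\<close>)
    then show "L \<in> S"
      using norm_lim_commute[OF L h(1)] norm_lim_selfadjoint[OF L] s L by (auto simp: S_def norm_lim_def)
  qed
  then obtain g where g: "g \<in> carrier A" "star A g = g" "g \<otimes> h = h \<otimes> g" and Tg: "T g = g" by (auto simp: S_def)
  have "g \<oplus> g = h \<otimes> h \<oplus> g \<otimes> g"
    using smult_half[of "h \<otimes> h \<oplus> g \<otimes> g"] Tg g h by (simp add: T_def)
  moreover have "h \<otimes> h = (h \<otimes> h \<oplus> g \<otimes> g) \<ominus> g \<otimes> g" using g(1) h(1) by algebra
  ultimately show ?thesis using g by metis
qed

text \<open>For the \<open>g\<close> of \<open>unitary_completion\<close>, 1 - h^2 = (1 - g)^2, and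
  1 - g acts as a contraction.\<close>

lemma nrm_minus_square_le:
  assumes h: "h \<in> carrier A" "star A h = h" "nrm A h < 1" and z: "z \<in> carrier A"
  shows "nrm A (z \<ominus> h \<otimes> (h \<otimes> z)) \<le> nrm A z"
proof -
  obtain g where g: "g \<in> carrier A" "star A g = g" "g \<otimes> h = h \<otimes> g" "h \<otimes> h = g \<oplus> g \<ominus> g \<otimes> g"
    using unitary_completion[OF h] by blast
  have 2: "h \<otimes> (h \<otimes> z) = g \<otimes> z \<oplus> g \<otimes> z \<ominus> g \<otimes> (g \<otimes> z)"
    using h z g by (simp flip: m_assoc) algebra
  have "z \<ominus> h \<otimes> (h \<otimes> z) = (z \<ominus> g \<otimes> z) \<ominus> g \<otimes> (z \<ominus> g \<otimes> z)"
    unfolding 2 using g(1) z by algebra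
  also have "nrm A \<dots> \<le> nrm A (z \<ominus> g \<otimes> z)"
    using g h z by (intro unitary_parts_contractive(2)[of g h]) auto
  also have "\<dots> \<le> nrm A z" using g h z by (intro unitary_parts_contractive(2)[of g h]) auto
  finally show ?thesis .
qed

text \<open>Here \<open>k = a\<^sup>2 / (1 + a\<^sup>2)\<close>, found as a fixed point of
  \<open>x \<mapsto> x - (x + a\<^sup>2 x - a\<^sup>2) / (1 + R\<^sup>2)\<close> for some \<open>R > \<parallel>a\<parallel>\<close>.\<close>

lemma quasi_inverse_exists:
  assumes a: "a \<in> carrier A" "star A a = a"
  shows "\<exists>k\<in>carrier A. star A k = k \<and> k \<otimes> a = a \<otimes> k \<and> k = a \<otimes> a \<ominus> a \<otimes> (a \<otimes> k)"
proof -
  \<comment> \<open>The summand 1 makes R positive and larger than norm(a), so that h = a/R has norm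
    below 1.\<close>
  define R where "R = nrm A a + 1"
  have R: "R > 0" using nrm_nonneg[OF a(1)] by (simp add: R_def)
  define h where "h = complex_of_real (1/R) \<odot> a"
  have h: "h \<in> carrier A" "star A h = h" using a by (auto simp: h_def star_smult)
  have "nrm A h = nrm A a / R" using a R by (simp add: h_def nrm_smult norm_divide)
  then have h1: "nrm A h < 1" using R by (simp add: R_def)
  define c where "c = 1 + R\<^sup>2"
  have c: "c > 0" by (simp add: c_def add_pos_nonneg)
  \<comment> \<open>T rearranges (1 + R^2) x = a^2 + R^2 x - a^2 x. Being affine, it obeys one
    contraction estimate on all of \<open>S\<close>.\<close>
  define T where "T x = complex_of_real (1/c) \<odot> (a \<otimes> a \<oplus> (complex_of_real (R\<^sup>2) \<odot> x \<ominus> a \<otimes> (a \<otimes> x)))" for x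
  define S where "S = {x \<in> carrier A. star A x = x \<and> x \<otimes> a = a \<otimes> x}"
  have "\<exists>x\<in>S. T x = x"
  proof (rule contraction_fixed_point[where r="R\<^sup>2 / c" and S=S and p=\<zero>])
    show "S \<subseteq> carrier A" "\<zero> \<in> S" "0 \<le> R\<^sup>2 / c" "R\<^sup>2 / c < 1"
      using a c by (auto simp: S_def c_def)
    fix x assume "x \<in> S"
    then have x: "x \<in> carrier A" "star A x = x" "x \<otimes> a = a \<otimes> x" by (auto simp: S_def)
    have 1: "x \<otimes> (a \<otimes> z) = a \<otimes> (x \<otimes> z)" if "z \<in> carrier A" for z using x a that by (metis m_assoc)
    have "star A (T x) = T x"
      using x a 1[of a] by (simp add: T_def star_smult star_add star_mult minus_eq star_minus m_assoc)
    moreover have "T x \<otimes> a = a \<otimes> T x" unfolding T_def using x(1,3) a(1) 1[of a] by algebra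
    ultimately show "T x \<in> S" using x a by (simp add: S_def T_def)
    fix y assume "y \<in> S"
    then have y: "y \<in> carrier A" by (simp add: S_def)
    define z where "z = x \<ominus> y"
    have z: "z \<in> carrier A" using x y by (simp add: z_def)
    have "complex_of_real (R\<^sup>2) \<odot> (h \<otimes> (h \<otimes> z)) = a \<otimes> (a \<otimes> z)"
      using R a z by (simp add: h_def smult_mult_left smult_mult_right smult_smult power2_eq_square smult_one)
    moreover have "T x \<ominus> T y = complex_of_real (1/c) \<odot> (complex_of_real (R\<^sup>2) \<odot> z \<ominus> a \<otimes> (a \<otimes> z))"
      unfolding T_def z_def using x(1) y a(1) by algebra
    \<comment> \<open>The difference is (R^2/c) (1 - h^2) z, where R^2/c < 1 and 1 - h^2 is
      contractive by \<open>nrm_minus_square_le\<close>.\<close>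
    ultimately have "T x \<ominus> T y = complex_of_real (1/c) \<odot> (complex_of_real (R\<^sup>2) \<odot> (z \<ominus> h \<otimes> (h \<otimes> z)))"
      using z h(1) by (simp add: minus_eq smult_r_distr smult_minus_right)
    then have "nrm A (T x \<ominus> T y) = R\<^sup>2 / c * nrm A (z \<ominus> h \<otimes> (h \<otimes> z))"
      using z h(1) c by (simp add: nrm_smult norm_divide norm_power)
    also have "\<dots> \<le> R\<^sup>2 / c * nrm A z"
      using nrm_minus_square_le[OF h h1 z] c by (intro mult_left_mono) auto
    finally show "nrm A (T x \<ominus> T y) \<le> R\<^sup>2 / c * nrm A (x \<ominus> y)" by (simp add: z_def)
  next
    fix s L assume s: "\<And>n. s n \<in> S" and L: "norm_lim A s L"
    then show "L \<in> S"
      using norm_lim_commute[OF L a(1)] norm_lim_selfadjoint[OF L] by (auto simp: S_def norm_lim_def)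
  qed
  then obtain k where k: "k \<in> carrier A" "star A k = k" "k \<otimes> a = a \<otimes> k" and Tk: "T k = k" by (auto simp: S_def)
  have "complex_of_real c \<odot> k = a \<otimes> a \<oplus> (complex_of_real (R\<^sup>2) \<odot> k \<ominus> a \<otimes> (a \<otimes> k))"
  proof -
    have "complex_of_real c \<odot> k = complex_of_real c \<odot> T k" by (simp add: Tk)
    then show ?thesis using c a k by (simp add: T_def smult_smult smult_one)
  qed
  moreover have "complex_of_real c \<odot> k = k \<oplus> complex_of_real (R\<^sup>2) \<odot> k"
    using k by (simp add: c_def smult_l_distr smult_one)
  moreover have "k = (k \<oplus> complex_of_real (R\<^sup>2) \<odot> k) \<ominus> complex_of_real (R\<^sup>2) \<odot> k" using k(1) by algebra
  moreover have "(a \<otimes> a \<oplus> (complex_of_real (R\<^sup>2) \<odot> k \<ominus> a \<otimes> (a \<otimes> k))) \<ominus> complex_of_real (R\<^sup>2) \<odot> k =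
      a \<otimes> a \<ominus> a \<otimes> (a \<otimes> k)" using k(1) a(1) by algebra
  ultimately show ?thesis using k by metis
qed

end

section \<open>Homomorphisms: contractivity and bounded lifting\<close>

lemma star_hom_minus:
  assumes "star_algebra A" "star_algebra B" "h \<in> star_hom A B" "x \<in> carrier A" "y \<in> carrier A"
  shows "h (x \<ominus>\<^bsub>A\<^esub> y) = h x \<ominus>\<^bsub>B\<^esub> h y"
proof -
  interpret A: star_algebra A by fact
  interpret B: star_algebra B by fact
  have "h ((-1) \<odot>\<^bsub>A\<^esub> y) = (-1) \<odot>\<^bsub>B\<^esub> h y" using assms by (simp add: star_hom_smult)
  then have "h (\<ominus>\<^bsub>A\<^esub> y) = \<ominus>\<^bsub>B\<^esub> h y"
    using assms by (simp add: A.smult_minus_left B.smult_minus_left A.smult_one B.smult_one star_hom_closed[OF assms(3)])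
  then show ?thesis using assms by (simp add: A.minus_eq B.minus_eq star_hom_add)
qed

lemma star_hom_zero:
  assumes "star_algebra A" "star_algebra B" "h \<in> star_hom A B"
  shows "h \<zero>\<^bsub>A\<^esub> = \<zero>\<^bsub>B\<^esub>"
  using assms by (intro additive_map_zero) (auto simp: star_algebra_def star_hom_def)

text \<open>The auxiliary elements are constructed in \<open>A\<close>, where completeness is
  available, and are carried to \<open>B\<close> by \<open>f\<close>.\<close>

locale cstar_hom = A: cstar_algebra A + B: pre_cstar_algebra B
  for A (structure) and B (structure) +
  fixes f
  assumes hom: "f \<in> star_hom A B"
begin

lemmas hom_simps = star_hom_simps[OF hom]
  star_hom_minus[OF A.star_algebra_axioms B.star_algebra_axioms hom]
  star_hom_zero[OF A.star_algebra_axioms B.star_algebra_axioms hom]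

text \<open>The unitarity relation is algebraic, so it survives in the image and bounds the norm
  there. The slack e > 0 provides the norm strictly below 1 that \<open>unitary_completion\<close>
  requires.\<close>

lemma selfadjoint_contractive:
  assumes h: "h \<in> carrier A" "star A h = h"
  shows "nrm B (f h) \<le> nrm A h"
proof (rule field_le_epsilon)
  fix e :: real assume e: "0 < e"
  define r where "r = nrm A h + e"
  have r: "r > 0" using A.nrm_nonneg[OF h(1)] e by (simp add: r_def)
  define x where "x = complex_of_real (1/r) \<odot> h"
  have x: "x \<in> carrier A" "star A x = x" using h by (auto simp: x_def A.star_smult)
  have "nrm A x = nrm A h / r" using h r by (simp add: x_def A.nrm_smult norm_divide)
  then have "nrm A x < 1" using e r by (simp add: r_def)
  then obtain g where g: "g \<in> carrier A" "star A g = g" "g \<otimes> x = x \<otimes> g"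
    "x \<otimes> x = g \<oplus> g \<ominus> g \<otimes> g"
    using A.unitary_completion[OF x] by blast
  have "nrm B (f x) \<le> 1"
  proof (rule B.nrm_selfadjoint_le_1)
    show "nrm B (f x \<otimes>\<^bsub>B\<^esub> y) \<le> nrm B y" if "y \<in> carrier B" for y
    proof (rule B.unitary_parts_contractive(1)[where g="f g"])
      show "f g \<otimes>\<^bsub>B\<^esub> f x = f x \<otimes>\<^bsub>B\<^esub> f g"
        using arg_cong[OF g(3), of f] g(1) x(1) by (simp add: hom_simps)
      show "f x \<otimes>\<^bsub>B\<^esub> f x = f g \<oplus>\<^bsub>B\<^esub> f g \<ominus>\<^bsub>B\<^esub> f g \<otimes>\<^bsub>B\<^esub> f g"
        using arg_cong[OF g(4), of f] g(1) x(1) by (simp add: hom_simps)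
      show "star B (f x) = f x" "star B (f g) = f g"
        using g x by (simp_all flip: hom_simps(5))
    qed (use g x that in \<open>auto simp: hom_simps\<close>)
    show "star B (f x) = f x" using x by (simp flip: hom_simps(5))
  qed (use x in \<open>auto simp: hom_simps\<close>)
  moreover have "nrm B (f x) = nrm B (f h) / r"
    using h r by (simp add: x_def hom_simps B.nrm_smult norm_divide)
  ultimately show "nrm B (f h) \<le> nrm A h + e" using r by (simp add: r_def)
qed

lemma nrm_hom_le:
  assumes x: "x \<in> carrier A"
  shows "nrm B (f x) \<le> nrm A x"
proof -
  have "(nrm B (f x))\<^sup>2 = nrm B (f (star A x \<otimes> x))"
    using x by (simp add: hom_simps B.nrm_cstar)
  also have "\<dots> \<le> nrm A (star A x \<otimes> x)"
    using x by (intro selfadjoint_contractive) (auto simp: A.star_mult A.star_star)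
  also have "\<dots> = (nrm A x)\<^sup>2" using x by (rule A.nrm_cstar)
  finally show ?thesis using A.nrm_nonneg[OF x] by (rule power2_le_imp_le)
qed

lemma contractive: "f \<in> contractive_hom A B"
  using hom nrm_hom_le by (simp add: contractive_hom_def)

text \<open>For \<open>b = f a\<close> of norm 1, \<open>a' = a / (1 + a\<^sup>2)\<close> has norm at most 1/2, and
  \<open>b - f a' = b\<^sup>2 (b / (1 + b\<^sup>2))\<close>.\<close>

lemma approximate_selfadjoint_lift:
  assumes a: "a \<in> carrier A" and sa: "star B (f a) = f a"
  shows "\<exists>a'\<in>carrier A. star B (f a') = f a' \<and> nrm A a' \<le> nrm B (f a) / 2 \<and>
    nrm B (f a \<ominus>\<^bsub>B\<^esub> f a') \<le> nrm B (f a) / 2"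
proof (cases "f a = \<zero>\<^bsub>B\<^esub>")
  case True
  then show ?thesis
    by (intro bexI[of _ "\<zero>"]) (auto simp: hom_simps A.seminorm_zero B.seminorm_zero B.minus_eq B.r_neg)
next
  case False
  define b where "b = f a"
  define r where "r = nrm B b"
  have b: "b \<in> carrier B" "star B b = b" using a sa by (auto simp: b_def hom_simps)
  have r: "r > 0" using False b B.nrm_nonneg[of b] B.nrm_eq_0[of b] by (simp add: r_def b_def)
  \<comment> \<open>The preimage a may fail to be selfadjoint although f a is; its real part has the
    same image. Division by r normalises the image of c, not c itself.\<close>
  define c where "c = complex_of_real (1/r) \<odot> ((1/2) \<odot> (a \<oplus> star A a))"
  have c: "c \<in> carrier A" "star A c = c"
    using a by (simp_all add: c_def A.star_smult A.star_add A.star_star A.a_comm)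
  have fc: "f c = complex_of_real (1/r) \<odot>\<^bsub>B\<^esub> b"
    using a b sa B.smult_half[of b]
    by (simp add: c_def hom_simps b_def B.smult_r_distr)
  have nfc: "nrm B (f c) = 1" using b r by (simp add: fc B.nrm_smult norm_divide r_def)
  have bfc: "b = complex_of_real r \<odot>\<^bsub>B\<^esub> f c" using b r by (simp add: fc B.smult_smult B.smult_one)
  obtain k where k: "k \<in> carrier A" "star A k = k" "k \<otimes> c = c \<otimes> k"
    "k = c \<otimes> c \<ominus> c \<otimes> (c \<otimes> k)"
    using A.quasi_inverse_exists[OF c] by blast
  define w where "w = c \<ominus> c \<otimes> k"
  \<comment> \<open>The Cayley bound 1/2 holds however large the norm of c is.\<close>
  have w: "w \<in> carrier A" "nrm A w \<le> 1 / 2"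
    using A.cayley_contractive(1)[OF c(1) k(1) c(2) k(2,3,4)] c k by (auto simp: w_def)
  have sw: "star A w = w" using c k by (simp add: w_def A.minus_eq A.star_add A.star_minus A.star_mult)
  have fw: "f c \<in> carrier B" "f w \<in> carrier B" "f k \<in> carrier B" using c k w by (auto simp: hom_simps)
  have "f k = f c \<otimes>\<^bsub>B\<^esub> f c \<ominus>\<^bsub>B\<^esub> f c \<otimes>\<^bsub>B\<^esub> (f c \<otimes>\<^bsub>B\<^esub> f k)"
    using arg_cong[OF k(4), of f] c(1) k(1) by (simp add: hom_simps)
  moreover have "f w = f c \<ominus>\<^bsub>B\<^esub> f c \<otimes>\<^bsub>B\<^esub> f k" using c k by (simp add: w_def hom_simps)
  moreover have "f c \<ominus>\<^bsub>B\<^esub> (f c \<ominus>\<^bsub>B\<^esub> f c \<otimes>\<^bsub>B\<^esub> f k) = f c \<otimes>\<^bsub>B\<^esub> f k" using fw by algebra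
  moreover have "f c \<otimes>\<^bsub>B\<^esub> (f c \<otimes>\<^bsub>B\<^esub> f c \<ominus>\<^bsub>B\<^esub> f c \<otimes>\<^bsub>B\<^esub> (f c \<otimes>\<^bsub>B\<^esub> f k)) =
    f c \<otimes>\<^bsub>B\<^esub> (f c \<otimes>\<^bsub>B\<^esub> (f c \<ominus>\<^bsub>B\<^esub> f c \<otimes>\<^bsub>B\<^esub> f k))" using fw by algebra
  ultimately have diff: "f c \<ominus>\<^bsub>B\<^esub> f w = f c \<otimes>\<^bsub>B\<^esub> (f c \<otimes>\<^bsub>B\<^esub> f w)" by metis
  \<comment> \<open>As f c has norm 1, the two factors in front of f w do not increase the
    norm.\<close>
  have "nrm B (f c \<ominus>\<^bsub>B\<^esub> f w) \<le> nrm B (f w)"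
    using B.nrm_mult[of "f c" "f c \<otimes>\<^bsub>B\<^esub> f w"] B.nrm_mult[of "f c" "f w"] fw nfc by (simp add: diff)
  then have d: "nrm B (f c \<ominus>\<^bsub>B\<^esub> f w) \<le> 1 / 2" using nrm_hom_le[OF w(1)] w(2) by simp
  define a' where "a' = complex_of_real r \<odot> w"
  have a': "a' \<in> carrier A" using w by (simp add: a'_def)
  have "f a \<ominus>\<^bsub>B\<^esub> f a' = complex_of_real r \<odot>\<^bsub>B\<^esub> (f c \<ominus>\<^bsub>B\<^esub> f w)"
    using bfc fw w by (simp add: a'_def hom_simps b_def B.minus_eq B.smult_r_distr B.smult_minus_right)
  then have "nrm B (f a \<ominus>\<^bsub>B\<^esub> f a') \<le> r / 2"
    using d fw r by (simp add: B.nrm_smult)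
  moreover have "nrm A a' \<le> r / 2" using w r by (simp add: a'_def A.nrm_smult)
  moreover have "star B (f a') = f a'" using a' w sw by (simp add: a'_def A.star_smult flip: hom_simps(5))
  ultimately show ?thesis using a' unfolding r_def b_def by blast
qed

text \<open>Each correction costs at most half the current error and leaves at most half of it, so
  the corrections have total norm at most norm(f a) (1/2 + 1/4 + ...) = norm(f a). No constant is
  lost for selfadjoint elements.\<close>

lemma selfadjoint_lift:
  assumes a: "a \<in> carrier A" and sa: "star B (f a) = f a"
  shows "\<exists>a'\<in>carrier A. f a' = f a \<and> nrm A a' \<le> nrm B (f a)"
proof -
  \<comment> \<open>The error stays selfadjoint and in the image of \<open>f\<close>, so the
    approximate lift can be repeated.\<close>
  define P where "P b \<longleftrightarrow> b \<in> f ` carrier A \<and> star B b = b" for b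
  have "\<exists>a'\<in>carrier A. P (b \<ominus>\<^bsub>B\<^esub> f a') \<and> nrm A a' \<le> nrm B b / 2 \<and> nrm B (b \<ominus>\<^bsub>B\<^esub> f a') \<le> nrm B b / 2"
    if b: "P b" for b
  proof -
    obtain c where c: "c \<in> carrier A" "b = f c" using b by (auto simp: P_def)
    then obtain a' where a': "a' \<in> carrier A" "star B (f a') = f a'" "nrm A a' \<le> nrm B b / 2"
      "nrm B (b \<ominus>\<^bsub>B\<^esub> f a') \<le> nrm B b / 2"
      using approximate_selfadjoint_lift[of c] b by (auto simp: P_def)
    have "b \<ominus>\<^bsub>B\<^esub> f a' = f (c \<ominus> a')" using a' c by (simp add: hom_simps)
    moreover have "star B (b \<ominus>\<^bsub>B\<^esub> f a') = b \<ominus>\<^bsub>B\<^esub> f a'"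
      using b a' c by (simp add: P_def B.minus_eq B.star_add B.star_minus hom_simps(1))
    ultimately have "P (b \<ominus>\<^bsub>B\<^esub> f a')" using a' c unfolding P_def by (metis A.minus_closed imageI)
    then show ?thesis using a' by blast
  qed
  then obtain l where l: "\<And>b. P b \<Longrightarrow> l b \<in> carrier A \<and> P (b \<ominus>\<^bsub>B\<^esub> f (l b)) \<and>
      nrm A (l b) \<le> nrm B b / 2 \<and> nrm B (b \<ominus>\<^bsub>B\<^esub> f (l b)) \<le> nrm B b / 2" by metis
  \<comment> \<open>r n is the error left after n corrections.\<close>
  define r where "r n = ((\<lambda>b. b \<ominus>\<^bsub>B\<^esub> f (l b)) ^^ n) (f a)" for n
  have r_Suc: "r (Suc n) = r n \<ominus>\<^bsub>B\<^esub> f (l (r n))" for n by (simp add: r_def)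
  have r0: "r 0 = f a" by (simp add: r_def)
  have Pr: "P (r n)" for n by (induction n) (use a sa l in \<open>auto simp: r0 r_Suc P_def\<close>)
  have nr: "nrm B (r n) \<le> nrm B (f a) * (1/2) ^ n" for n
  proof (induction n)
    case (Suc n)
    then show ?case using l[OF Pr[of n]] by (simp add: r_Suc)
  qed (simp add: r0)
  define F where "F n = l (r n)" for n
  have F: "F n \<in> carrier A" for n using l[OF Pr] by (simp add: F_def)
  have fa: "f a \<in> carrier B" using a by (simp add: hom_simps)
  have rc: "r n \<in> carrier B" for n using Pr[of n] hom_simps(1) by (auto simp: P_def)
  have nF: "nrm A (F n) \<le> nrm B (f a) * (1/2) ^ Suc n" for n
    using l[OF Pr[of n]] nr[of n] by (simp add: F_def)
  have geo: "(\<lambda>n. nrm B (f a) * (1/2) ^ Suc n) sums (nrm B (f a) * 1)"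
    by (rule sums_mult[OF power_half_series])
  have sumF: "summable (\<lambda>n. nrm A (F n))"
    by (rule summable_comparison_test'[OF sums_summable[OF geo]]) (use nF F in \<open>simp add: A.nrm_nonneg\<close>)
  then have FP: "F \<in> power_series A" by (simp add: power_series_def F)
  obtain L where L: "norm_lim A (\<lambda>N. \<Oplus>n\<in>{..<N}. F n) L" using A.power_series_norm_lim[OF FP] by blast
  \<comment> \<open>Telescoping: the images of the corrections sum to f a minus the remaining
    error.\<close>
  have psum: "f (\<Oplus>n\<in>{..<N}. F n) = f a \<ominus>\<^bsub>B\<^esub> r N" for N
  proof (induction N)
    case 0
    then show ?case using fa by (simp add: hom_simps r0 B.minus_eq B.r_neg)
  next
    case (Suc N)
    have "f (\<Oplus>n\<in>{..<Suc N}. F n) = f (F N) \<oplus>\<^bsub>B\<^esub> (f a \<ominus>\<^bsub>B\<^esub> r N)"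
      using F Suc by (simp add: lessThan_Suc Pi_def hom_simps)
    also have "\<dots> = f a \<ominus>\<^bsub>B\<^esub> (r N \<ominus>\<^bsub>B\<^esub> f (F N))"
    proof -
      have "x \<oplus>\<^bsub>B\<^esub> (y \<ominus>\<^bsub>B\<^esub> z) = y \<ominus>\<^bsub>B\<^esub> (z \<ominus>\<^bsub>B\<^esub> x)"
        if "x \<in> carrier B" "y \<in> carrier B" "z \<in> carrier B" for x y z using that by algebra
      then show ?thesis using fa rc F by (simp add: hom_simps)
    qed
    finally show ?case by (simp add: r_Suc F_def)
  qed
  have "norm_lim B (\<lambda>N. f (\<Oplus>n\<in>{..<N}. F n)) (f L)"
    using contractive_hom_norm_lim[OF A.pre_cstar_algebra_axioms B.pre_cstar_algebra_axioms contractive L] .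
  moreover have "norm_lim B (\<lambda>N. f (\<Oplus>n\<in>{..<N}. F n)) (f a)"
    unfolding psum
  proof (rule B.norm_limI)
    fix n
    have "f a \<ominus>\<^bsub>B\<^esub> r n \<ominus>\<^bsub>B\<^esub> f a = \<ominus>\<^bsub>B\<^esub> r n" using fa rc by algebra
    then show "nrm B (f a \<ominus>\<^bsub>B\<^esub> r n \<ominus>\<^bsub>B\<^esub> f a) \<le> nrm B (f a) * (1/2) ^ n"
      using nr[of n] rc by (simp add: B.seminorm_minus)
    show "(\<lambda>n. nrm B (f a) * (1/2) ^ n) \<longlonglongrightarrow> 0"
      by (intro tendsto_mult_right_zero LIMSEQ_power_zero) simp
  qed (use fa rc in auto)
  ultimately have "f L = f a" by (rule B.norm_lim_unique)
  moreover have "nrm A L \<le> nrm B (f a)"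
  proof (rule tendsto_upperbound[OF A.norm_lim_nrm[OF L]])
    have "(\<Sum>n. nrm A (F n)) \<le> nrm B (f a)"
      using suminf_le[OF nF sumF sums_summable[OF geo]] sums_unique[OF geo] by simp
    then have "nrm A (\<Oplus>n\<in>{..<N}. F n) \<le> nrm B (f a)" for N
      using A.nrm_partial_sums_le[OF FP, of N] by simp
    then show "\<forall>\<^sub>F N in sequentially. nrm A (\<Oplus>n\<in>{..<N}. F n) \<le> nrm B (f a)" by simp
  qed simp
  moreover have "L \<in> carrier A" using L by (simp add: norm_lim_def)
  ultimately show ?thesis by blast
qed

text \<open>Real and imaginary part are lifted separately, each with norm at most norm(b). Any
  factor independent of b would keep a coefficientwise lift summable.\<close>

lemma bounded_lift:
  assumes "b \<in> f ` carrier A"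
  shows "\<exists>a\<in>carrier A. f a = b \<and> nrm A a \<le> 2 * nrm B b"
proof -
  obtain a where a: "a \<in> carrier A" "b = f a" using assms by blast
  have b: "b \<in> carrier B" using a by (simp add: hom_simps)
  define x where "x = (1/2) \<odot> (a \<oplus> star A a)"
  define y where "y = (-\<i>/2) \<odot> (a \<ominus> star A a)"
  have xy: "x \<in> carrier A" "y \<in> carrier A" using a by (auto simp: x_def y_def)
  have sx: "star A x = x" using a by (simp add: x_def A.star_smult A.star_add A.star_star A.a_comm)
  have sy: "star A y = y"
    using a by (simp add: y_def A.star_smult A.star_add A.star_star A.minus_eq A.star_minus
        A.smult_r_distr A.smult_minus_right A.smult_minus_left A.a_comm)
  have "a = x \<oplus> \<i> \<odot> y"
  proof -
    have "x \<oplus> \<i> \<odot> y = (1/2) \<odot> (a \<oplus> star A a) \<oplus> (1/2) \<odot> (a \<ominus> star A a)"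
      using a by (simp add: x_def y_def A.smult_smult)
    also have "\<dots> = (1/2) \<odot> a \<oplus> (1/2) \<odot> a" using a(1) by algebra
    finally show ?thesis using a by (simp only: A.smult_half)
  qed
  then have bxy: "b = f x \<oplus>\<^bsub>B\<^esub> \<i> \<odot>\<^bsub>B\<^esub> f y" using a xy by (simp add: hom_simps)
  have "nrm B (f x) \<le> nrm B b"
    using a b B.nrm_triangle[of b "star B b"] by (simp add: x_def hom_simps B.nrm_smult norm_divide B.seminorm_star)
  moreover have "nrm B (f y) \<le> nrm B b"
    using a b B.nrm_diff_triangle[of b "star B b"]
    by (simp add: y_def hom_simps B.nrm_smult norm_divide B.seminorm_star)
  moreover obtain u v where uv: "u \<in> carrier A" "f u = f x" "nrm A u \<le> nrm B (f x)"
    "v \<in> carrier A" "f v = f y" "nrm A v \<le> nrm B (f y)"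
    using selfadjoint_lift[OF xy(1)] selfadjoint_lift[OF xy(2)] sx sy xy by (metis hom_simps(5))
  moreover have "nrm A (u \<oplus> \<i> \<odot> v) \<le> nrm A u + nrm A v"
    using A.nrm_triangle[of u "\<i> \<odot> v"] uv by (simp add: A.nrm_smult)
  moreover have "f (u \<oplus> \<i> \<odot> v) = b" using uv bxy by (simp add: hom_simps)
  ultimately show ?thesis by (intro bexI[of _ "u \<oplus> \<i> \<odot> v"]) auto
qed

end

text \<open>With \<open>h = x\<^sup>* x\<close> and \<open>a = n h\<close>, the elements \<open>k = a\<^sup>2 / (1 + a\<^sup>2)\<close> of \<open>I\<close> are
  selfadjoint and satisfy \<open>x k \<rightarrow> x\<close>, hence \<open>k x\<^sup>* \<rightarrow> x\<^sup>*\<close>.\<close>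

lemma (in cstar_algebra) closed_ideal_star_closed:
  assumes I: "closed_ideal I A" and x: "x \<in> I"
  shows "star A x \<in> I"
proof -
  interpret I: additive_subgroup I A using I by (simp add: closed_ideal_def)
  have mult: "c \<odot> y \<in> I" "z \<otimes> y \<in> I" "y \<otimes> z \<in> I" if "y \<in> I" "z \<in> carrier A" for c y z
    using I that by (auto simp: closed_ideal_def)
  have xc: "x \<in> carrier A" using x I.a_subset by auto
  define h where "h = star A x \<otimes> x"
  have h: "h \<in> carrier A" "star A h = h" "h \<in> I" using xc x mult by (auto simp: h_def star_mult star_star)
  have ex: "\<exists>k\<in>I. star A k = k \<and> nrm A (x \<otimes> k \<ominus> x) \<le> sqrt (1 / real (Suc n))" for n
  proof -
    \<comment> \<open>As the scale n + 1 grows, the formal factor 1 - k = 1/(1 + a^2) suppresses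
      h.\<close>
    define a where "a = of_nat (Suc n) \<odot> h"
    have a: "a \<in> carrier A" "star A a = a" "a \<in> I" using h mult by (auto simp: a_def star_smult)
    obtain k where k: "k \<in> carrier A" "star A k = k" "k \<otimes> a = a \<otimes> k" "k = a \<otimes> a \<ominus> a \<otimes> (a \<otimes> k)"
      using quasi_inverse_exists[OF a(1,2)] by blast
    note cay = cayley_contractive[OF a(1) k(1) a(2) k(2,3,4)]
    \<comment> \<open>k was built in the whole algebra, but both terms of k = a^2 - a^2 k contain a
      factor from \<open>I\<close>.\<close>
    have "a \<otimes> a \<in> I" "\<ominus> (a \<otimes> (a \<otimes> k)) \<in> I" using a k mult by auto
    then have kI: "k \<in> I" using k(4) by (metis I.a_closed minus_eq)
    have d: "x \<ominus> x \<otimes> k \<in> carrier A" "h \<ominus> h \<otimes> k \<in> carrier A" using xc h k by auto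
    have "a \<ominus> a \<otimes> k = of_nat (Suc n) \<odot> (h \<ominus> h \<otimes> k)" unfolding a_def using h(1) k(1) by algebra
    then have "real (Suc n) * nrm A (h \<ominus> h \<otimes> k) = nrm A (a \<ominus> a \<otimes> k)"
      using d by (simp only: nrm_smult norm_of_nat)
    then have hk: "nrm A (h \<ominus> h \<otimes> k) \<le> 1 / real (Suc n)"
      using cay(1) by (simp add: field_simps)
    \<comment> \<open>Formally this is (1 - k) h (1 - k). The left factor is contractive, and h (1 -
      k) has norm at most 1/(n + 1).\<close>
    have "star A (x \<ominus> x \<otimes> k) \<otimes> (x \<ominus> x \<otimes> k) = (h \<ominus> h \<otimes> k) \<ominus> k \<otimes> (h \<ominus> h \<otimes> k)"
      unfolding h_def using xc k(1,2) by algebra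
    then have "(nrm A (x \<ominus> x \<otimes> k))\<^sup>2 \<le> nrm A (h \<ominus> h \<otimes> k)"
      using nrm_cstar[OF d(1)] cay(2)[OF d(2)] by simp
    then have "(nrm A (x \<ominus> x \<otimes> k))\<^sup>2 \<le> 1 / real (Suc n)" using hk by simp
    then have "nrm A (x \<ominus> x \<otimes> k) \<le> sqrt (1 / real (Suc n))" by (rule real_le_rsqrt)
    then show ?thesis using kI k xc nrm_minus_commute[of x "x \<otimes> k"] by auto
  qed
  then obtain k where k: "\<And>n. k n \<in> I" "\<And>n. star A (k n) = k n"
    "\<And>n. nrm A (x \<otimes> k n \<ominus> x) \<le> sqrt (1 / real (Suc n))" by metis
  have kc: "k n \<in> carrier A" for n using k(1)[of n] I.a_subset by auto
  have "norm_lim A (\<lambda>n. x \<otimes> k n) x"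
  proof (rule norm_limI)
    show "(\<lambda>n. sqrt (1 / real (Suc n))) \<longlonglongrightarrow> 0"
      using tendsto_real_sqrt[OF LIMSEQ_inverse_real_of_nat] by (simp add: inverse_eq_divide)
  qed (use k xc kc in auto)
  from norm_lim_star[OF this] have "norm_lim A (\<lambda>n. k n \<otimes> star A x) (star A x)"
    using xc kc k by (simp add: star_mult)
  moreover have "k n \<otimes> star A x \<in> I" for n using mult(3)[OF k(1)] xc by simp
  ultimately show ?thesis using closedin_norm_lim[of I] I unfolding closed_ideal_def by blast
qed

section \<open>Evaluation of power series\<close>

text \<open>The triangle i + j < N is summed along diagonals and along rows. Together with its
  algebra-valued counterpart it compares the two error terms in
  \<open>norm_lim_cauchy_product\<close>.\<close>

lemma convolution_partial_sums:
  fixes a b :: "nat \<Rightarrow> real"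
  shows "(\<Sum>n<N. \<Sum>i\<le>n. a i * b (n - i)) = (\<Sum>i<N. a i * (\<Sum>j<N - i. b j))"
proof (induction N)
  case (Suc N)
  have "(\<Sum>i<Suc N. a i * (\<Sum>j<Suc N - i. b j)) = (\<Sum>i<Suc N. a i * (\<Sum>j<N - i. b j) + a i * b (N - i))"
    by (intro sum.cong refl) (simp add: Suc_diff_le algebra_simps)
  also have "\<dots> = (\<Sum>i<N. a i * (\<Sum>j<N - i. b j)) + (\<Sum>i\<le>N. a i * b (N - i))"
    by (simp only: sum.distrib lessThan_Suc_atMost) (simp flip: lessThan_Suc_atMost)
  finally show ?case using Suc by simp
qed simp

context star_algebra
begin

lemma convolution_partial_finsums:
  fixes F G :: "nat \<Rightarrow> 'a"
  assumes F: "\<And>n. F n \<in> carrier A" and G: "\<And>n. G n \<in> carrier A"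
  shows "(\<Oplus>n\<in>{..<N}. \<Oplus>i\<in>{..n}. F i \<otimes> G (n - i)) = (\<Oplus>i\<in>{..<N}. F i \<otimes> (\<Oplus>j\<in>{..<N - i}. G j))"
proof (induction N)
  case (Suc N)
  have c: "(\<Oplus>j\<in>{..<m}. G j) \<in> carrier A" for m :: nat using G by (simp add: Pi_def)
  have "(\<Oplus>i\<in>{..<Suc N}. F i \<otimes> (\<Oplus>j\<in>{..<Suc N - i}. G j)) =
      (\<Oplus>i\<in>{..<Suc N}. F i \<otimes> (\<Oplus>j\<in>{..<N - i}. G j) \<oplus> F i \<otimes> G (N - i))"
  proof (intro finsum_cong')
    fix i assume "i \<in> {..<Suc N}"
    then have "{..<Suc N - i} = insert (N - i) {..<N - i}" by auto
    then show "F i \<otimes> (\<Oplus>j\<in>{..<Suc N - i}. G j) = F i \<otimes> (\<Oplus>j\<in>{..<N - i}. G j) \<oplus> F i \<otimes> G (N - i)"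
      using F G c by (simp add: Pi_def r_distr a_comm)
  qed (use F G c in auto)
  also have "\<dots> = (\<Oplus>i\<in>{..<Suc N}. F i \<otimes> (\<Oplus>j\<in>{..<N - i}. G j)) \<oplus> (\<Oplus>i\<in>{..<Suc N}. F i \<otimes> G (N - i))"
    using F G c by (intro finsum_addf) auto
  also have "(\<Oplus>i\<in>{..<Suc N}. F i \<otimes> (\<Oplus>j\<in>{..<N - i}. G j)) = (\<Oplus>i\<in>{..<N}. F i \<otimes> (\<Oplus>j\<in>{..<N - i}. G j))"
    using F G c by (simp add: lessThan_Suc Pi_def)
  also have "(\<Oplus>i\<in>{..<Suc N}. F i \<otimes> G (N - i)) = (\<Oplus>i\<in>{..N}. F i \<otimes> G (N - i))"
    by (simp only: lessThan_Suc_atMost)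
  also have "(\<Oplus>i\<in>{..<N}. F i \<otimes> (\<Oplus>j\<in>{..<N - i}. G j)) \<oplus> \<dots> =
      (\<Oplus>n\<in>{..<Suc N}. \<Oplus>i\<in>{..n}. F i \<otimes> G (n - i))"
    unfolding Suc[symmetric] using F G by (simp add: lessThan_Suc Pi_def a_comm)
  finally show ?case by simp
qed simp

lemma finsum_lessThan_Suc_shift:
  assumes "\<And>n. F n \<in> carrier A"
  shows "(\<Oplus>n\<in>{..<Suc N}. F n) = F 0 \<oplus> (\<Oplus>n\<in>{..<N}. F (Suc n))"
proof (induction N)
  case (Suc N)
  have "(\<Oplus>n\<in>{..<Suc (Suc N)}. F n) = F (Suc N) \<oplus> (F 0 \<oplus> (\<Oplus>n\<in>{..<N}. F (Suc n)))"
    using assms Suc by (simp add: lessThan_Suc[of "Suc N"] Pi_def)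
  then show ?case using assms by (simp add: lessThan_Suc Pi_def a_lcomm)
qed (use assms in \<open>simp add: lessThan_Suc\<close>)

end

section \<open>Values of a power series and recovery of its coefficients\<close>

context cstar_algebra
begin

abbreviation ps_partial :: "(nat \<Rightarrow> 'a) \<Rightarrow> real \<Rightarrow> nat \<Rightarrow> 'a" where
  "ps_partial F t N \<equiv> \<Oplus>n\<in>{..<N}. complex_of_real (t ^ n) \<odot> F n"

lemma ps_terms:
  assumes "F \<in> power_series A" "\<bar>t\<bar> \<le> 1"
  shows "(\<lambda>n. complex_of_real (t ^ n) \<odot> F n) \<in> power_series A"
    and "nrm A (complex_of_real (t ^ n) \<odot> F n) \<le> nrm A (F n)"
proof -
  have c: "F n \<in> carrier A" for n using assms by auto
  show le: "nrm A (complex_of_real (t ^ n) \<odot> F n) \<le> nrm A (F n)" for n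
    using assms(2) nrm_nonneg[OF c[of n]]
    by (simp add: nrm_smult c norm_power mult_left_le_one_le power_le_one)
  have "summable (\<lambda>n. nrm A (F n))" using assms by (simp add: power_series_def)
  then have "summable (\<lambda>n. nrm A (complex_of_real (t ^ n) \<odot> F n))"
    by (rule summable_comparison_test') (use le c in \<open>simp add: nrm_nonneg\<close>)
  then show "(\<lambda>n. complex_of_real (t ^ n) \<odot> F n) \<in> power_series A" by (simp add: power_series_def c)
qed

lemma ps_eval_eqI: "norm_lim A (ps_partial F t) L \<Longrightarrow> ps_eval A F t = L"
  unfolding ps_eval_def
  using norm_lim_iff_limitin[of "ps_partial F t" L]
  by (intro the_equality)
    (auto simp: norm_lim_def intro: Met.limitin_metric_unique[OF _ _ trivial_limit_sequentially])

lemma ps_eval_lim: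
  assumes "F \<in> power_series A" "\<bar>t\<bar> \<le> 1"
  shows "norm_lim A (ps_partial F t) (ps_eval A F t)"
  using power_series_norm_lim[OF ps_terms(1)[OF assms]] ps_eval_eqI by metis

lemma ps_eval_closed: "F \<in> power_series A \<Longrightarrow> \<bar>t\<bar> \<le> 1 \<Longrightarrow> ps_eval A F t \<in> carrier A"
  using ps_eval_lim by (auto simp: norm_lim_def)

lemma nrm_ps_eval_le:
  assumes "F \<in> power_series A" "\<bar>t\<bar> \<le> 1"
  shows "nrm A (ps_eval A F t) \<le> (\<Sum>n. nrm A (F n))"
proof (rule tendsto_upperbound[OF norm_lim_nrm[OF ps_eval_lim[OF assms]]])
  have "nrm A (ps_partial F t N) \<le> (\<Sum>n. nrm A (F n))" for N
  proof -
    have "nrm A (ps_partial F t N) \<le> (\<Sum>n. nrm A (complex_of_real (t ^ n) \<odot> F n))"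
      by (rule nrm_partial_sums_le[OF ps_terms(1)[OF assms]])
    also have "\<dots> \<le> (\<Sum>n. nrm A (F n))"
      using ps_terms[OF assms] assms(1) by (intro suminf_le) (auto simp: power_series_def)
    finally show ?thesis .
  qed
  then show "\<forall>\<^sub>F N in sequentially. nrm A (ps_partial F t N) \<le> (\<Sum>n. nrm A (F n))" by simp
qed simp

lemma ps_eval_add:
  assumes "F \<in> power_series A" "G \<in> power_series A" "\<bar>t\<bar> \<le> 1"
  shows "ps_eval A (\<lambda>n. F n \<oplus> G n) t = ps_eval A F t \<oplus> ps_eval A G t"
proof (rule ps_eval_eqI)
  have c: "F n \<in> carrier A" "G n \<in> carrier A" for n using assms by auto
  have "ps_partial (\<lambda>n. F n \<oplus> G n) t N = ps_partial F t N \<oplus> ps_partial G t N" for N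
    using c by (simp add: smult_r_distr finsum_addf Pi_def)
  then show "norm_lim A (ps_partial (\<lambda>n. F n \<oplus> G n) t) (ps_eval A F t \<oplus> ps_eval A G t)"
    using norm_lim_add[OF ps_eval_lim[OF assms(1,3)] ps_eval_lim[OF assms(2,3)]] by simp
qed

lemma ps_eval_smult:
  assumes "F \<in> power_series A" "\<bar>t\<bar> \<le> 1"
  shows "ps_eval A (\<lambda>n. c \<odot> F n) t = c \<odot> ps_eval A F t"
proof (rule ps_eval_eqI)
  have "F n \<in> carrier A" for n using assms by auto
  then have "ps_partial (\<lambda>n. c \<odot> F n) t N = c \<odot> ps_partial F t N" for N
    by (simp add: smult_finsum smult_smult mult.commute)
  then show "norm_lim A (ps_partial (\<lambda>n. c \<odot> F n) t) (c \<odot> ps_eval A F t)"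
    using norm_lim_smult[OF ps_eval_lim[OF assms]] by simp
qed

lemma ps_eval_star:
  assumes "F \<in> power_series A" "\<bar>t\<bar> \<le> 1"
  shows "ps_eval A (\<lambda>n. star A (F n)) t = star A (ps_eval A F t)"
proof (rule ps_eval_eqI)
  have "F n \<in> carrier A" for n using assms by auto
  then have "ps_partial (\<lambda>n. star A (F n)) t N = star A (ps_partial F t N)" for N
    by (simp add: star_finsum star_smult)
  then show "norm_lim A (ps_partial (\<lambda>n. star A (F n)) t) (star A (ps_eval A F t))"
    using norm_lim_star[OF ps_eval_lim[OF assms]] by simp
qed

lemma ps_eval_zero: "ps_eval A (\<lambda>n. \<zero>) t = \<zero>"
  by (rule ps_eval_eqI) (simp add: norm_lim_const)

lemma nrm_tail_le:
  assumes F: "F \<in> power_series A" and L: "norm_lim A (\<lambda>N. \<Oplus>n\<in>{..<N}. F n) L"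
  shows "nrm A (L \<ominus> (\<Oplus>n\<in>{..<m}. F n)) \<le> (\<Sum>n. nrm A (F n)) - (\<Sum>n<m. nrm A (F n))"
proof -
  have c: "F n \<in> carrier A" for n using F by auto
  have s: "(\<Oplus>n\<in>{..<N}. F n) \<in> carrier A" for N :: nat using c by (simp add: Pi_def)
  have sm: "summable (\<lambda>n. nrm A (F n))" using F by (simp add: power_series_def)
  have lim: "norm_lim A (\<lambda>N. (\<Oplus>n\<in>{..<N}. F n) \<ominus> (\<Oplus>n\<in>{..<m}. F n)) (L \<ominus> (\<Oplus>n\<in>{..<m}. F n))"
    by (rule norm_lim_minus[OF L norm_lim_const[OF s]])
  have "nrm A ((\<Oplus>n\<in>{..<N}. F n) \<ominus> (\<Oplus>n\<in>{..<m}. F n)) \<le> (\<Sum>n. nrm A (F n)) - (\<Sum>n<m. nrm A (F n))"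
    if "m \<le> N" for N
  proof -
    have "nrm A ((\<Oplus>n\<in>{..<N}. F n) \<ominus> (\<Oplus>n\<in>{..<m}. F n)) \<le> (\<Sum>k=m..<N. nrm A (F k))"
      by (rule nrm_partial_sums_diff_le[of F m N, OF c that])
    also have "\<dots> = (\<Sum>n<N. nrm A (F n)) - (\<Sum>n<m. nrm A (F n))"
      using that sum.atLeastLessThan_concat[of 0 m N "\<lambda>k. nrm A (F k)"] by (simp add: lessThan_atLeast0)
    also have "(\<Sum>n<N. nrm A (F n)) \<le> (\<Sum>n. nrm A (F n))"
      using sm by (intro sum_le_suminf) (auto simp: c nrm_nonneg)
    finally show ?thesis by simp
  qed
  then have "\<forall>\<^sub>F N in sequentially. nrm A ((\<Oplus>n\<in>{..<N}. F n) \<ominus> (\<Oplus>n\<in>{..<m}. F n))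
      \<le> (\<Sum>n. nrm A (F n)) - (\<Sum>n<m. nrm A (F n))"
    by (rule eventually_sequentiallyI)
  then show ?thesis by (rule tendsto_upperbound[OF norm_lim_nrm[OF lim]]) simp
qed

text \<open>Mertens' argument: the error, a sum of F i times tails of G, is majorised by the same
  error for the real series of norms, which tends to 0 by the Cauchy product theorem for real
  series.\<close>

lemma norm_lim_cauchy_product:
  assumes F: "F \<in> power_series A" and G: "G \<in> power_series A"
    and LF: "norm_lim A (\<lambda>N. \<Oplus>n\<in>{..<N}. F n) L" and LG: "norm_lim A (\<lambda>N. \<Oplus>n\<in>{..<N}. G n) M"
  shows "norm_lim A (\<lambda>N. \<Oplus>n\<in>{..<N}. \<Oplus>i\<in>{..n}. F i \<otimes> G (n - i)) (L \<otimes> M)"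
proof -
  have c: "F n \<in> carrier A" "G n \<in> carrier A" for n using F G by auto
  have LM: "L \<in> carrier A" "M \<in> carrier A" using LF LG by (auto simp: norm_lim_def)
  have s: "(\<Oplus>n\<in>{..<N}. F n) \<in> carrier A" "(\<Oplus>n\<in>{..<N}. G n) \<in> carrier A" for N :: nat
    using c by (simp_all add: Pi_def)
  define C where "C N = (\<Oplus>n\<in>{..<N}. \<Oplus>i\<in>{..n}. F i \<otimes> G (n - i))" for N
  have cC: "C N \<in> carrier A" for N using c by (simp add: C_def Pi_def)
  define D where "D N = (\<Oplus>n\<in>{..<N}. F n) \<otimes> M \<ominus> C N" for N
  let ?a = "\<lambda>n. nrm A (F n)" and ?b = "\<lambda>n. nrm A (G n)"
  \<comment> \<open>By \<open>convolution_partial_sums\<close> this is the sum of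
    \<open>?a i\<close> times the tail of \<open>?b\<close> from N - i on.\<close>
  define e where "e N = (\<Sum>n<N. ?a n) * (\<Sum>n. ?b n) - (\<Sum>n<N. \<Sum>i\<le>n. ?a i * ?b (n - i))" for N
  have sm: "summable (\<lambda>n. norm (?a n))" "summable (\<lambda>n. norm (?b n))"
    using F G c by (simp_all add: power_series_def nrm_nonneg)
  have "D N = (\<Oplus>i\<in>{..<N}. F i \<otimes> (M \<ominus> (\<Oplus>j\<in>{..<N - i}. G j)))" for N
  proof -
    have "(\<Oplus>n\<in>{..<N}. F n) \<otimes> M = (\<Oplus>i\<in>{..<N}. F i \<otimes> (M \<ominus> (\<Oplus>j\<in>{..<N - i}. G j)) \<oplus> F i \<otimes> (\<Oplus>j\<in>{..<N - i}. G j))"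
      using c s LM by (subst finsum_ldistr) (auto intro!: finsum_cong' simp: r_distr[symmetric] diff_add_cancel)
    also have "\<dots> = (\<Oplus>i\<in>{..<N}. F i \<otimes> (M \<ominus> (\<Oplus>j\<in>{..<N - i}. G j))) \<oplus> (\<Oplus>i\<in>{..<N}. F i \<otimes> (\<Oplus>j\<in>{..<N - i}. G j))"
      using c s LM by (intro finsum_addf) auto
    also have "(\<Oplus>i\<in>{..<N}. F i \<otimes> (\<Oplus>j\<in>{..<N - i}. G j)) = C N"
      using c unfolding C_def by (simp only: convolution_partial_finsums)
    finally have "D N = ((\<Oplus>i\<in>{..<N}. F i \<otimes> (M \<ominus> (\<Oplus>j\<in>{..<N - i}. G j))) \<oplus> C N) \<ominus> C N"
      by (simp add: D_def)
    moreover have "(x \<oplus> y) \<ominus> y = x" if "x \<in> carrier A" "y \<in> carrier A" for x y using that by algebra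
    ultimately show ?thesis using c s LM cC by (simp add: Pi_def)
  qed
  then have "nrm A (D N) \<le> (\<Sum>i<N. nrm A (F i \<otimes> (M \<ominus> (\<Oplus>j\<in>{..<N - i}. G j))))" for N
    using c s LM by (simp add: seminorm_finsum)
  also have "\<dots> N \<le> (\<Sum>i<N. ?a i * ((\<Sum>n. ?b n) - (\<Sum>j<N - i. ?b j)))" for N
  proof (rule sum_mono)
    fix i
    have "nrm A (F i \<otimes> (M \<ominus> (\<Oplus>j\<in>{..<N - i}. G j))) \<le> ?a i * nrm A (M \<ominus> (\<Oplus>j\<in>{..<N - i}. G j))"
      using c s LM by (intro nrm_mult) auto
    also have "\<dots> \<le> ?a i * ((\<Sum>n. ?b n) - (\<Sum>j<N - i. ?b j))"
      using nrm_tail_le[OF G LG] c nrm_nonneg by (intro mult_left_mono) auto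
    finally show "nrm A (F i \<otimes> (M \<ominus> (\<Oplus>j\<in>{..<N - i}. G j))) \<le> ?a i * ((\<Sum>n. ?b n) - (\<Sum>j<N - i. ?b j))" .
  qed
  also have "(\<Sum>i<N. ?a i * ((\<Sum>n. ?b n) - (\<Sum>j<N - i. ?b j))) = e N" for N
    using convolution_partial_sums[of ?a ?b N]
    by (simp add: e_def right_diff_distrib sum_subtractf sum_distrib_right)
  finally have D: "nrm A (D N) \<le> e N" for N .
  have "e \<longlonglongrightarrow> (\<Sum>n. ?a n) * (\<Sum>n. ?b n) - (\<Sum>n. ?a n) * (\<Sum>n. ?b n)"
    unfolding e_def using Cauchy_product_sums[OF sm] summable_LIMSEQ[of ?a] sm(1) c
    by (intro tendsto_intros) (auto simp: sums_def nrm_nonneg)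
  then have e: "e \<longlonglongrightarrow> 0" by simp
  have "norm_lim A D \<zero>"
    by (rule norm_limI[OF _ _ _ e]) (use D c s LM cC in \<open>auto simp: D_def minus_eq\<close>)
  then have "norm_lim A (\<lambda>N. (\<Oplus>n\<in>{..<N}. F n) \<otimes> M \<ominus> D N) (L \<otimes> M \<ominus> \<zero>)"
    by (intro norm_lim_minus norm_lim_mult[OF LF norm_lim_const[OF LM(2)]])
  moreover have "(\<Oplus>n\<in>{..<N}. F n) \<otimes> M \<ominus> D N = C N" for N
  proof -
    have "x \<ominus> (x \<ominus> y) = y" if "x \<in> carrier A" "y \<in> carrier A" for x y using that by algebra
    then show ?thesis using s LM cC by (simp add: D_def)
  qed
  ultimately show ?thesis using LM by (simp add: C_def minus_eq)
qed

lemma ps_eval_mult: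
  assumes F: "F \<in> power_series A" and G: "G \<in> power_series A" and t: "\<bar>t\<bar> \<le> 1"
  shows "ps_eval A (\<lambda>n. \<Oplus>i\<in>{..n}. F i \<otimes> G (n - i)) t = ps_eval A F t \<otimes> ps_eval A G t"
proof (rule ps_eval_eqI)
  have c: "F n \<in> carrier A" "G n \<in> carrier A" for n using F G by auto
  \<comment> \<open>The weights t^i and t^(n - i) combine to t^n, so weighting the coefficients
    commutes with the Cauchy product.\<close>
  have eq: "(\<Oplus>i\<in>{..n}. (complex_of_real (t ^ i) \<odot> F i) \<otimes> (complex_of_real (t ^ (n - i)) \<odot> G (n - i))) =
      complex_of_real (t ^ n) \<odot> (\<Oplus>i\<in>{..n}. F i \<otimes> G (n - i))" for n
  proof -
    have "complex_of_real (t ^ i) * complex_of_real (t ^ (n - i)) = complex_of_real (t ^ n)" if "i \<le> n" for i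
      using that by (metis le_add_diff_inverse of_real_mult power_add)
    then show ?thesis
      using c by (subst smult_finsum) (auto intro!: finsum_cong' simp: smult_mult_left smult_mult_right smult_smult
          mult.commute simp del: of_real_power)
  qed
  show "norm_lim A (ps_partial (\<lambda>n. \<Oplus>i\<in>{..n}. F i \<otimes> G (n - i)) t) (ps_eval A F t \<otimes> ps_eval A G t)"
    using norm_lim_cauchy_product[OF ps_terms(1)[OF F t] ps_terms(1)[OF G t] ps_eval_lim[OF F t] ps_eval_lim[OF G t]]
    by (simp only: eq)
qed

lemma power_series_shift: "F \<in> power_series A \<Longrightarrow> (\<lambda>n. F (Suc n)) \<in> power_series A"
  using summable_Suc_iff[of "\<lambda>n. nrm A (F n)"] by (simp add: power_series_def)

text \<open>It supplies both the estimate of F(t) near t = 0 and the passage to the next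
  coefficient.\<close>

lemma ps_eval_shift:
  assumes F: "F \<in> power_series A" and t: "\<bar>t\<bar> \<le> 1"
  shows "ps_eval A F t = F 0 \<oplus> complex_of_real t \<odot> ps_eval A (\<lambda>n. F (Suc n)) t"
proof (rule norm_lim_unique)
  have c: "F n \<in> carrier A" for n using F by auto
  show "norm_lim A (\<lambda>N. ps_partial F t (Suc N)) (ps_eval A F t)"
    using ps_eval_lim[OF F t] LIMSEQ_Suc[of "\<lambda>N. nrm A (ps_partial F t N \<ominus> ps_eval A F t)" 0]
    unfolding norm_lim_def by blast
  have "ps_partial F t (Suc N) = F 0 \<oplus> complex_of_real t \<odot> ps_partial (\<lambda>n. F (Suc n)) t N" for N
    using c by (subst finsum_lessThan_Suc_shift) (auto simp: smult_finsum smult_smult smult_one)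
  then show "norm_lim A (\<lambda>N. ps_partial F t (Suc N)) (F 0 \<oplus> complex_of_real t \<odot> ps_eval A (\<lambda>n. F (Suc n)) t)"
    using norm_lim_add[OF norm_lim_const[OF c] norm_lim_smult[OF ps_eval_lim[OF power_series_shift[OF F] t]]]
    by simp
qed

text \<open>Identity theorem: the constant term is the limit of \<open>F(t)\<close> as \<open>t \<rightarrow> 0\<close> in \<open>K\<close>, and
  \<open>(F(t) - F(0)) / t\<close> has the shifted coefficients.\<close>

lemma coefficients_in_closed_subspace:
  assumes K: "K \<subseteq> {-1..1}" "0 islimpt K" and J: "additive_subgroup J A" "\<And>c x. x \<in> J \<Longrightarrow> c \<odot> x \<in> J"
      "closedin (ctop A) J"
    and F: "F \<in> power_series A" and ev: "\<And>t. t \<in> K \<Longrightarrow> t \<noteq> 0 \<Longrightarrow> ps_eval A F t \<in> J"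
  shows "F n \<in> J"
  using F ev
proof (induction n arbitrary: F)
  interpret J: additive_subgroup J A by fact
  have K1: "\<bar>t\<bar> \<le> 1" if "t \<in> K" for t
    using K(1) that by (auto simp: abs_le_iff dest!: subsetD)
  have F0: "F 0 \<in> J" if F: "F \<in> power_series A" and ev: "\<And>t. t \<in> K \<Longrightarrow> t \<noteq> 0 \<Longrightarrow> ps_eval A F t \<in> J" for F
  proof -
    obtain s where s: "\<And>n. s n \<in> K - {0}" "s \<longlonglongrightarrow> 0" using K(2) unfolding islimpt_sequential by blast
    define G where "G = (\<lambda>n. F (Suc n))"
    have G: "G \<in> power_series A" using power_series_shift[OF F] by (simp add: G_def)
    have c: "F n \<in> carrier A" for n using F by auto
    \<comment> \<open>The difference is s n times a value of the shifted series, and these values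
      are bounded by the sum of its coefficient norms.\<close>
    have "norm_lim A (\<lambda>n. ps_eval A F (s n)) (F 0)"
    proof (rule norm_limI)
      fix n
      have s1: "\<bar>s n\<bar> \<le> 1" using s K1 by auto
      have cG: "ps_eval A G (s n) \<in> carrier A" by (rule ps_eval_closed[OF G s1])
      have "(x \<oplus> y) \<ominus> x = y" if "x \<in> carrier A" "y \<in> carrier A" for x y using that by algebra
      then have "ps_eval A F (s n) \<ominus> F 0 = complex_of_real (s n) \<odot> ps_eval A G (s n)"
        using ps_eval_shift[OF F s1] c cG by (simp add: G_def)
      then show "nrm A (ps_eval A F (s n) \<ominus> F 0) \<le> \<bar>s n\<bar> * (\<Sum>n. nrm A (G n))"
        using nrm_ps_eval_le[OF G s1] cG by (simp add: nrm_smult mult_left_mono)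
      show "ps_eval A F (s n) \<in> carrier A" by (rule ps_eval_closed[OF F s1])
    next
      show "(\<lambda>n. \<bar>s n\<bar> * (\<Sum>n. nrm A (G n))) \<longlonglongrightarrow> 0"
        using s(2) by (intro tendsto_mult_left_zero tendsto_rabs_zero)
    qed (rule c)
    then show ?thesis using closedin_norm_lim[OF J(3)] ev s(1) by blast
  qed
  {
    case 0
    then show ?case using F0 by blast
  next
    case (Suc n)
    have c: "F n \<in> carrier A" for n using Suc.prems by auto
    \<comment> \<open>Division by t explains why the hypothesis concerns nonzero t: in this form the
      shifted series inherits it.\<close>
    have "ps_eval A (\<lambda>n. F (Suc n)) t \<in> J" if t: "t \<in> K" "t \<noteq> 0" for t
    proof -
      define g where "g = ps_eval A (\<lambda>n. F (Suc n)) t"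
      have g: "g \<in> carrier A"
        unfolding g_def by (rule ps_eval_closed[OF power_series_shift[OF Suc.prems(1)] K1[OF t(1)]])
      have "ps_eval A F t \<oplus> (-1) \<odot> F 0 \<in> J" using Suc.prems t J(2) F0 by blast
      moreover have "ps_eval A F t \<oplus> (-1) \<odot> F 0 = complex_of_real t \<odot> g"
      proof -
        have "(x \<oplus> y) \<oplus> \<ominus> x = y" if "x \<in> carrier A" "y \<in> carrier A" for x y using that by algebra
        then show ?thesis
          using ps_eval_shift[OF Suc.prems(1) K1[OF t(1)]] c g by (simp add: g_def smult_minus_left smult_one)
      qed
      ultimately have "complex_of_real (1/t) \<odot> (complex_of_real t \<odot> g) \<in> J" using J(2) by simp
      then show ?thesis using t g by (simp add: smult_smult smult_one flip: g_def)
    qed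
    then show ?case using Suc.IH[OF power_series_shift[OF Suc.prems(1)]] by blast
  }
qed

end

section \<open>The pre-C*-algebra of power series\<close>

lemma power_series_algebra_simps:
  "carrier (power_series_algebra K A) = power_series A"
  "F \<otimes>\<^bsub>power_series_algebra K A\<^esub> G = (\<lambda>n. \<Oplus>\<^bsub>A\<^esub>i\<in>{..n}. F i \<otimes>\<^bsub>A\<^esub> G (n - i))"
  "\<zero>\<^bsub>power_series_algebra K A\<^esub> = (\<lambda>n. \<zero>\<^bsub>A\<^esub>)"
  "F \<oplus>\<^bsub>power_series_algebra K A\<^esub> G = (\<lambda>n. F n \<oplus>\<^bsub>A\<^esub> G n)"
  "c \<odot>\<^bsub>power_series_algebra K A\<^esub> F = (\<lambda>n. c \<odot>\<^bsub>A\<^esub> F n)"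
  "star (power_series_algebra K A) F = (\<lambda>n. star A (F n))"
  "nrm (power_series_algebra K A) F = (SUP t\<in>K. nrm A (ps_eval A F t))"
  by (simp_all add: power_series_algebra_def)

locale evaluation_set =
  fixes K :: "real set"
  assumes K_subset: "K \<subseteq> {-1..1}" and K_limpt: "0 islimpt K"
begin

lemma K_abs: "t \<in> K \<Longrightarrow> \<bar>t\<bar> \<le> 1"
  using K_subset by (auto simp: abs_le_iff dest!: subsetD)

lemma K_nonempty: "K \<noteq> {}"
  using K_limpt by auto

end

locale power_series_cstar = cstar_algebra A + evaluation_set K for A (structure) and K
begin

abbreviation "P \<equiv> power_series_algebra K A"

lemma bdd_eval: "F \<in> power_series A \<Longrightarrow> bdd_above ((\<lambda>t. nrm A (ps_eval A F t)) ` K)"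
  using nrm_ps_eval_le K_abs by (intro bdd_aboveI2) blast

lemma nrm_eval_le: "F \<in> power_series A \<Longrightarrow> t \<in> K \<Longrightarrow> nrm A (ps_eval A F t) \<le> nrm P F"
  unfolding power_series_algebra_simps by (rule cSUP_upper[OF _ bdd_eval])

lemma nrm_power_series_leI:
  "(\<And>t. t \<in> K \<Longrightarrow> nrm A (ps_eval A F t) \<le> r) \<Longrightarrow> nrm P F \<le> r"
  unfolding power_series_algebra_simps by (rule cSUP_least[OF K_nonempty])

lemma eval_closed [simp]: "F \<in> power_series A \<Longrightarrow> t \<in> K \<Longrightarrow> ps_eval A F t \<in> carrier A"
  using ps_eval_closed K_abs by blast

lemma nrm_power_series_nonneg:
  assumes "F \<in> power_series A"
  shows "0 \<le> nrm P F"
proof -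
  obtain t where t: "t \<in> K" using K_nonempty by blast
  have "0 \<le> nrm A (ps_eval A F t)" using t assms by (simp add: nrm_nonneg)
  then show ?thesis using nrm_eval_le[OF assms t] by linarith
qed

text \<open>The case \<open>J = {\<zero>}\<close> of the preceding result; it makes the supremum
  over \<open>K\<close> definite.\<close>

lemma identity_theorem:
  assumes F: "F \<in> power_series A" and z: "\<And>t. t \<in> K \<Longrightarrow> ps_eval A F t = \<zero>"
  shows "F = (\<lambda>n. \<zero>)"
proof
  fix n
  have "F n \<in> {\<zero>}"
  proof (rule coefficients_in_closed_subspace[OF K_subset K_limpt])
    have "subgroup {\<zero>} (add_monoid A)" by (rule add.triv_subgroup)
    then show "additive_subgroup {\<zero>} A" by (rule additive_subgroupI)
    show "closedin (ctop A) {\<zero>}"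
    proof (rule closedinI_norm_lim)
      fix s L assume "\<And>n :: nat. s n \<in> {\<zero>}" and L: "norm_lim A s L"
      then have "s = (\<lambda>_. \<zero>)" by auto
      then show "L \<in> {\<zero>}" using norm_lim_unique[OF L] norm_lim_const[of \<zero>] by simp
    qed simp
  qed (use F z in auto)
  then show "F n = \<zero>" by simp
qed

text \<open>Evaluation at each t in \<open>K\<close> respects the operations, so the estimates in
  \<open>A\<close> pass to the supremum. Definiteness is the identity theorem.\<close>

sublocale P: pre_cstar_algebra P
proof (intro pre_cstar_algebra.intro pre_cstar_algebra_axioms.intro star_algebra_power_series)
  interpret P: star_algebra P by (rule star_algebra_power_series)
  fix F assume "F \<in> carrier P"
  then have F: "F \<in> power_series A" by (simp add: power_series_algebra_simps)
  show "0 \<le> nrm P F" by (rule nrm_power_series_nonneg[OF F])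
  show "nrm P F = 0 \<longleftrightarrow> F = \<zero>\<^bsub>P\<^esub>"
  proof
    assume "nrm P F = 0"
    then have "nrm A (ps_eval A F t) = 0" if "t \<in> K" for t
      using nrm_eval_le[OF F that] nrm_nonneg[OF eval_closed[OF F that]] by simp
    then show "F = \<zero>\<^bsub>P\<^esub>"
      using identity_theorem[OF F] F nrm_eq_0 by (simp add: power_series_algebra_simps)
  next
    assume "F = \<zero>\<^bsub>P\<^esub>"
    then show "nrm P F = 0" using K_nonempty by (simp add: power_series_algebra_simps ps_eval_zero seminorm_zero)
  qed
  show "nrm P (star P F \<otimes>\<^bsub>P\<^esub> F) = (nrm P F)\<^sup>2"
  proof -
    have ev: "ps_eval A (star P F \<otimes>\<^bsub>P\<^esub> F) t = star A (ps_eval A F t) \<otimes> ps_eval A F t" if "t \<in> K" for t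
      using ps_eval_mult[OF power_series_closed(4)[OF F] F K_abs[OF that]] ps_eval_star[OF F K_abs[OF that]]
      by (simp add: power_series_algebra_simps)
    have sq: "nrm A (ps_eval A (star P F \<otimes>\<^bsub>P\<^esub> F) t) = (nrm A (ps_eval A F t))\<^sup>2" if "t \<in> K" for t
      using that F by (simp add: ev nrm_cstar)
    have FF: "star P F \<otimes>\<^bsub>P\<^esub> F \<in> power_series A"
      using F P.m_closed[of "star P F" F] P.star_closed[of F] by (simp add: power_series_algebra_simps)
    show ?thesis
    proof (rule antisym)
      show "nrm P (star P F \<otimes>\<^bsub>P\<^esub> F) \<le> (nrm P F)\<^sup>2"
        using nrm_eval_le[OF F] nrm_nonneg F by (intro nrm_power_series_leI) (simp add: sq power_mono)
      \<comment> \<open>Taking roots first turns a bound on the squares into one to which the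
        supremum over t applies.\<close>
      have "nrm A (ps_eval A F t) \<le> sqrt (nrm P (star P F \<otimes>\<^bsub>P\<^esub> F))" if "t \<in> K" for t
        using nrm_eval_le[OF FF that] by (intro real_le_rsqrt) (simp add: sq that)
      then have "nrm P F \<le> sqrt (nrm P (star P F \<otimes>\<^bsub>P\<^esub> F))" by (rule nrm_power_series_leI)
      then have "(nrm P F)\<^sup>2 \<le> (sqrt (nrm P (star P F \<otimes>\<^bsub>P\<^esub> F)))\<^sup>2"
        using nrm_power_series_nonneg[OF F] by (intro power_mono)
      then show "(nrm P F)\<^sup>2 \<le> nrm P (star P F \<otimes>\<^bsub>P\<^esub> F)" using nrm_power_series_nonneg[OF FF] by simp
    qed
  qed
  fix c
  \<comment> \<open>One inequality suffices: applied to the inverse scalar it gives the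
    other.\<close>
  have sm: "nrm P (c \<odot>\<^bsub>P\<^esub> F) \<le> cmod c * nrm P F" if F: "F \<in> power_series A" for F c
    using F by (intro nrm_power_series_leI)
      (simp add: power_series_algebra_simps(5) ps_eval_smult K_abs nrm_smult mult_left_mono nrm_eval_le)
  show "nrm P (c \<odot>\<^bsub>P\<^esub> F) = cmod c * nrm P F"
  proof (cases "c = 0")
    case True
    then show ?thesis
      using sm[OF F, of 0] nrm_power_series_nonneg[of "c \<odot>\<^bsub>P\<^esub> F"] P.smult_closed[of F 0] F
      by (simp add: power_series_algebra_simps(1))
  next
    case False
    have cF: "c \<odot>\<^bsub>P\<^esub> F \<in> power_series A" using P.smult_closed[of F c] F by (simp add: power_series_algebra_simps(1))
    have "nrm P F = nrm P (inverse c \<odot>\<^bsub>P\<^esub> (c \<odot>\<^bsub>P\<^esub> F))"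
      using False F P.smult_smult[of F "inverse c" c] P.smult_one[of F] by (simp add: power_series_algebra_simps(1))
    also have "\<dots> \<le> cmod (inverse c) * nrm P (c \<odot>\<^bsub>P\<^esub> F)" by (rule sm[OF cF])
    finally have "cmod c * nrm P F \<le> nrm P (c \<odot>\<^bsub>P\<^esub> F)" using False by (simp add: norm_inverse norm_divide field_simps)
    then show ?thesis using sm[OF F, of c] by simp
  qed
  fix G assume "G \<in> carrier P"
  then have G: "G \<in> power_series A" by (simp add: power_series_algebra_simps)
  show "nrm P (F \<oplus>\<^bsub>P\<^esub> G) \<le> nrm P F + nrm P G"
  proof (rule nrm_power_series_leI)
    fix t assume t: "t \<in> K"
    have "nrm A (ps_eval A (F \<oplus>\<^bsub>P\<^esub> G) t) \<le> nrm A (ps_eval A F t) + nrm A (ps_eval A G t)"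
      using F G t by (simp add: power_series_algebra_simps(4) ps_eval_add K_abs nrm_triangle)
    also have "\<dots> \<le> nrm P F + nrm P G" using F G t by (intro add_mono nrm_eval_le)
    finally show "nrm A (ps_eval A (F \<oplus>\<^bsub>P\<^esub> G) t) \<le> nrm P F + nrm P G" .
  qed
  show "nrm P (F \<otimes>\<^bsub>P\<^esub> G) \<le> nrm P F * nrm P G"
  proof (rule nrm_power_series_leI)
    fix t assume t: "t \<in> K"
    have "nrm A (ps_eval A (F \<otimes>\<^bsub>P\<^esub> G) t) \<le> nrm A (ps_eval A F t) * nrm A (ps_eval A G t)"
      using F G t by (simp add: power_series_algebra_simps(2) ps_eval_mult K_abs nrm_mult)
    also have "\<dots> \<le> nrm P F * nrm P G"
      using F G t by (intro mult_mono nrm_eval_le nrm_power_series_nonneg nrm_nonneg) auto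
    finally show "nrm A (ps_eval A (F \<otimes>\<^bsub>P\<^esub> G) t) \<le> nrm P F * nrm P G" .
  qed
qed

end

section \<open>Homomorphisms induced on power series\<close>

locale power_series_hom = A: cstar_algebra A + B: cstar_algebra B + evaluation_set K
  for A (structure) and B (structure) and K +
  fixes f
  assumes star_hom: "f \<in> star_hom A B"
begin

sublocale cstar_hom A B f by unfold_locales (rule star_hom)
sublocale PA: power_series_cstar A K ..
sublocale PB: power_series_cstar B K ..

lemma ps_map_hom: "ps_map f \<in> star_hom PA.P PB.P"
  by (rule ps_map_star_hom[OF A.seminormed_star_algebra_axioms B.seminormed_star_algebra_axioms contractive])

lemma ps_map_closed: "F \<in> power_series A \<Longrightarrow> ps_map f F \<in> power_series B"
  using star_hom_closed[OF ps_map_hom, of F] by (simp add: power_series_algebra_simps)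

text \<open>\<open>f\<close> passes through the finite partial sums by additivity and through their
  limit by contractivity. It reduces norm comparisons for \<open>ps_map f\<close> to single values
  of t.\<close>

lemma ps_eval_map:
  assumes F: "F \<in> power_series A" and t: "\<bar>t\<bar> \<le> 1"
  shows "ps_eval B (ps_map f F) t = f (ps_eval A F t)"
proof (rule B.ps_eval_eqI)
  have c: "F n \<in> carrier A" for n using F by auto
  have "f (A.ps_partial F t N) = B.ps_partial (ps_map f F) t N" for N
    by (subst additive_map_finsum[OF A.abelian_group_axioms B.abelian_group_axioms, where h=f])
      (auto simp: hom_simps c ps_map_def simp del: of_real_power)
  then show "norm_lim B (B.ps_partial (ps_map f F) t) (f (ps_eval A F t))"
    using contractive_hom_norm_lim[OF A.pre_cstar_algebra_axioms B.pre_cstar_algebra_axioms contractive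
        A.ps_eval_lim[OF F t]] by simp
qed

lemma ps_map_contractive: "ps_map f \<in> contractive_hom PA.P PB.P"
proof -
  have "nrm PB.P (ps_map f F) \<le> nrm PA.P F" if F: "F \<in> power_series A" for F
  proof (rule PB.nrm_power_series_leI)
    fix t assume t: "t \<in> K"
    have "nrm B (ps_eval B (ps_map f F) t) \<le> nrm A (ps_eval A F t)"
      using F t by (simp add: ps_eval_map K_abs nrm_hom_le)
    then show "nrm B (ps_eval B (ps_map f F) t) \<le> nrm PA.P F" using PA.nrm_eval_le[OF F t] by simp
  qed
  then show ?thesis using ps_map_hom by (simp add: contractive_hom_def power_series_algebra_simps(1))
qed

lemma ps_map_isometric:
  assumes "f \<in> isometric_hom A B"
  shows "ps_map f \<in> isometric_hom PA.P PB.P"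
proof -
  have "nrm PB.P (ps_map f F) = nrm PA.P F" if F: "F \<in> power_series A" for F
    unfolding power_series_algebra_simps
    by (rule SUP_cong) (use assms F in \<open>auto simp: ps_eval_map K_abs isometric_hom_def\<close>)
  then show ?thesis using ps_map_hom by (simp add: isometric_hom_def power_series_algebra_simps(1))
qed

lemma ps_map_image: "ps_map f ` power_series A = power_series (B\<lparr>carrier := f ` carrier A\<rparr>)"
proof (intro equalityI subsetI)
  fix G assume "G \<in> ps_map f ` power_series A"
  then show "G \<in> power_series (B\<lparr>carrier := f ` carrier A\<rparr>)"
    using ps_map_closed by (auto simp: power_series_def ps_map_def)
next
  fix G assume "G \<in> power_series (B\<lparr>carrier := f ` carrier A\<rparr>)"
  then have G: "\<And>n. G n \<in> f ` carrier A" "summable (\<lambda>n. nrm B (G n))" by (auto simp: power_series_def)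
  obtain F where F: "\<And>n. F n \<in> carrier A" "\<And>n. f (F n) = G n" "\<And>n. nrm A (F n) \<le> 2 * nrm B (G n)"
    using bounded_lift[OF G(1)] by metis
  have "summable (\<lambda>n. 2 * nrm B (G n))" using G by (intro summable_mult)
  then have "summable (\<lambda>n. nrm A (F n))"
    by (rule summable_comparison_test') (use F in \<open>simp add: A.nrm_nonneg\<close>)
  then have "F \<in> power_series A" by (simp add: power_series_def F)
  moreover have "G = ps_map f F" by (simp add: ps_map_def F)
  ultimately show "G \<in> ps_map f ` power_series A" by blast
qed

lemma ps_map_kernel: "a_kernel PA.P PB.P (ps_map f) = power_series (A\<lparr>carrier := a_kernel A B f\<rparr>)"
  by (auto simp: a_kernel_def kernel_def power_series_algebra_simps power_series_def ps_map_def fun_eq_iff)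

lemma ps_map_iso:
  assumes "f \<in> star_iso A B"
  shows "ps_map f \<in> star_iso PA.P PB.P"
proof -
  have f: "inj_on f (carrier A)" "f ` carrier A = carrier B"
    using assms by (auto simp: star_iso_def bij_betw_def)
  have "inj_on (ps_map f) (power_series A)"
  proof (rule inj_onI)
    fix F G assume F: "F \<in> power_series A" and G: "G \<in> power_series A" and "ps_map f F = ps_map f G"
    then have "f (F n) = f (G n)" for n by (metis ps_map_def)
    then show "F = G" using inj_onD[OF f(1)] power_series_carrier[OF F] power_series_carrier[OF G] by blast
  qed
  moreover have "ps_map f ` power_series A = power_series B"
    using ps_map_image f(2) by (simp add: power_series_def)
  ultimately show ?thesis
    using ps_map_hom by (simp add: star_iso_def bij_betw_def power_series_algebra_simps(1))
qed

end

lemma star_iso_inverse: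
  assumes "star_algebra A" "f \<in> star_iso A B"
  shows "inv_into (carrier A) f \<in> star_iso B A"
proof -
  interpret A: star_algebra A by fact
  let ?g = "inv_into (carrier A) f"
  have f: "f \<in> star_hom A B" and bij: "bij_betw f (carrier A) (carrier B)"
    using assms(2) by (auto simp: star_iso_def)
  note hs = star_hom_simps[OF f]
  have g: "?g x \<in> carrier A" "f (?g x) = x" if "x \<in> carrier B" for x
    using bij that bij_betw_inv_into_right[OF bij that]
    by (auto simp: bij_betw_def inv_into_into)
  have eq: "?g y = x" if "x \<in> carrier A" "f x = y" for x y
    using bij_betw_inv_into_left[OF bij] that by auto
  have "?g \<in> star_hom B A"
    by (rule star_homI) (auto intro!: eq simp: hs g)
  then show ?thesis using bij_betw_inv_into[OF bij] by (simp add: star_iso_def)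
qed

text \<open>The map and its inverse are both contractive. The isometry is what lets an isomorphism
  extend to an isomorphism of the completions.\<close>

lemma star_iso_isometric:
  assumes "cstar_algebra A" "cstar_algebra B" "f \<in> star_iso A B"
  shows "f \<in> isometric_hom A B"
proof -
  interpret A: cstar_algebra A by fact
  interpret B: cstar_algebra B by fact
  interpret f: cstar_hom A B f
    by unfold_locales (use assms(3) in \<open>simp add: star_iso_def\<close>)
  have g: "inv_into (carrier A) f \<in> star_iso B A"
    using star_iso_inverse[OF A.star_algebra_axioms assms(3)] .
  interpret g: cstar_hom B A "inv_into (carrier A) f"
    by unfold_locales (use g in \<open>simp add: star_iso_def\<close>)
  have "nrm B (f x) = nrm A x" if x: "x \<in> carrier A" for x
  proof -
    have "inv_into (carrier A) f (f x) = x"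
      using x assms(3) by (auto simp: star_iso_def bij_betw_def)
    then show ?thesis
      using f.nrm_hom_le[OF x] g.nrm_hom_le[of "f x"] x by (simp add: f.hom_simps)
  qed
  then show ?thesis using f.hom by (simp add: isometric_hom_def)
qed

section \<open>Quotients by ideals\<close>

lemma a_kernel_iff: "x \<in> a_kernel A B h \<longleftrightarrow> x \<in> carrier A \<and> h x = \<zero>\<^bsub>B\<^esub>"
  by (simp add: a_kernel_def kernel_def)

text \<open>Invariance under the involution is listed separately; closed ideals acquire it from
  \<open>closed_ideal_star_closed\<close>.\<close>

locale star_ideal = star_algebra A for A (structure) + fixes I
  assumes subgroup: "additive_subgroup I A"
    and smult_I: "x \<in> I \<Longrightarrow> c \<odot> x \<in> I"
    and mult_I_left: "\<lbrakk>a \<in> carrier A; x \<in> I\<rbrakk> \<Longrightarrow> a \<otimes> x \<in> I"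
    and mult_I_right: "\<lbrakk>a \<in> carrier A; x \<in> I\<rbrakk> \<Longrightarrow> x \<otimes> a \<in> I"
    and star_I: "x \<in> I \<Longrightarrow> star A x \<in> I"
begin

sublocale I: abelian_subgroup I A
  by (rule abelian_subgroupI3[OF subgroup abelian_group_axioms])

abbreviation "Q \<equiv> quotient_algebra A I"

abbreviation proj :: "'a \<Rightarrow> 'a set" where
  "proj x \<equiv> I +> x"

lemma I_carrier: "x \<in> I \<Longrightarrow> x \<in> carrier A"
  using I.a_subset by auto

lemma mem_proj_iff:
  assumes "x \<in> carrier A"
  shows "y \<in> proj x \<longleftrightarrow> y \<in> carrier A \<and> y \<ominus> x \<in> I"
proof
  assume "y \<in> proj x"
  then obtain h where h: "h \<in> I" "y = h \<oplus> x" by (auto simp: a_r_coset_def')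
  then have "y \<ominus> x = h" using assms I_carrier[OF h(1)] by algebra
  then show "y \<in> carrier A \<and> y \<ominus> x \<in> I" using h assms I_carrier by simp
next
  assume y: "y \<in> carrier A \<and> y \<ominus> x \<in> I"
  then have "y = (y \<ominus> x) \<oplus> x" using assms by algebra
  then show "y \<in> proj x" using y by (auto simp: a_r_coset_def')
qed

lemma proj_eq_iff:
  assumes "x \<in> carrier A" "y \<in> carrier A"
  shows "proj x = proj y \<longleftrightarrow> x \<ominus> y \<in> I"
proof
  assume "proj x = proj y"
  moreover have "x \<in> proj x" using assms by (simp add: mem_proj_iff minus_eq r_neg)
  ultimately show "x \<ominus> y \<in> I" using assms mem_proj_iff by blast
next
  assume "x \<ominus> y \<in> I"
  then have "x \<in> proj y" using assms by (simp add: mem_proj_iff)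
  then show "proj x = proj y"
    using assms a_repr_independence[OF _ assms(2) additive_subgroup.a_subgroup[OF subgroup]] by metis
qed

lemma proj_refl: "x \<in> carrier A \<Longrightarrow> x \<in> proj x"
  by (simp add: mem_proj_iff minus_eq r_neg)

lemma mem_proj: "x \<in> carrier A \<Longrightarrow> y \<in> proj x \<Longrightarrow> y \<in> carrier A \<and> proj y = proj x"
  using mem_proj_iff proj_eq_iff by blast

text \<open>\<open>quotient_algebra\<close> takes a union over representatives. It collapses because
  its members are equal and \<open>proj x\<close> is nonempty; the involution and the product are
  treated alike.\<close>

lemma proj_smult: 
  assumes x: "x \<in> carrier A" shows "c \<odot>\<^bsub>Q\<^esub> proj x = proj (c \<odot> x)"
proof -
  have "proj (c \<odot> y) = proj (c \<odot> x)" if "y \<in> proj x" for y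
  proof -
    have y: "y \<in> carrier A" "y \<ominus> x \<in> I" using that x mem_proj_iff by auto
    have "c \<odot> y \<ominus> c \<odot> x = c \<odot> (y \<ominus> x)" using x y(1) by algebra
    then show ?thesis using x y smult_I by (simp add: proj_eq_iff)
  qed
  then have "(\<Union>y\<in>proj x. proj (c \<odot> y)) = (\<Union>y\<in>proj x. proj (c \<odot> x))" by (intro SUP_cong refl)
  then show ?thesis using proj_refl[OF x] by (simp add: quotient_algebra_def) blast
qed

lemma proj_star: 
  assumes x: "x \<in> carrier A" shows "star Q (proj x) = proj (star A x)"
proof -
  have "proj (star A y) = proj (star A x)" if "y \<in> proj x" for y
  proof -
    have y: "y \<in> carrier A" "y \<ominus> x \<in> I" using that x mem_proj_iff by auto
    have "star A y \<ominus> star A x = star A (y \<ominus> x)" using x y(1) by algebra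
    then show ?thesis using x y star_I by (simp add: proj_eq_iff)
  qed
  then have "(\<Union>y\<in>proj x. proj (star A y)) = (\<Union>y\<in>proj x. proj (star A x))" by (intro SUP_cong refl)
  then show ?thesis using proj_refl[OF x] by (simp add: quotient_algebra_def) blast
qed

lemma proj_mult:
  assumes x: "x \<in> carrier A" and y: "y \<in> carrier A" shows "proj x \<otimes>\<^bsub>Q\<^esub> proj y = proj (x \<otimes> y)"
proof -
  have "proj (x' \<otimes> y') = proj (x \<otimes> y)" if "x' \<in> proj x" "y' \<in> proj y" for x' y'
  proof -
    have x': "x' \<in> carrier A" "x' \<ominus> x \<in> I" and y': "y' \<in> carrier A" "y' \<ominus> y \<in> I"
      using that x y mem_proj_iff by auto
    have "x' \<otimes> y' \<ominus> x \<otimes> y = x' \<otimes> (y' \<ominus> y) \<oplus> (x' \<ominus> x) \<otimes> y" using x y x'(1) y'(1) by algebra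
    then show ?thesis using x y x' y' mult_I_left mult_I_right by (simp add: proj_eq_iff)
  qed
  then have "(\<Union>x'\<in>proj x. \<Union>y'\<in>proj y. proj (x' \<otimes> y')) = (\<Union>x'\<in>proj x. \<Union>y'\<in>proj y. proj (x \<otimes> y))"
    by (intro SUP_cong refl)
  then show ?thesis
    using proj_refl[OF x] proj_refl[OF y] by (simp add: quotient_algebra_def rcoset_mult_def) blast
qed

lemma proj_add: "\<lbrakk>x \<in> carrier A; y \<in> carrier A\<rbrakk> \<Longrightarrow> proj x \<oplus>\<^bsub>Q\<^esub> proj y = proj (x \<oplus> y)"
  by (simp add: quotient_algebra_def I.a_rcos_sum)

lemma carrier_quotient: "carrier Q = proj ` carrier A"
  by (auto simp: quotient_algebra_def A_RCOSETS_def')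

lemma zero_quotient: "\<zero>\<^bsub>Q\<^esub> = I"
  by (simp add: quotient_algebra_def)

lemma proj_hom: "proj \<in> star_hom A Q"
  by (rule star_homI) (auto simp: proj_smult proj_star proj_mult proj_add carrier_quotient)

lemma proj_eq_zero_iff: "x \<in> carrier A \<Longrightarrow> proj x = I \<longleftrightarrow> x \<in> I"
  by (metis a_coset_join1 a_coset_join2 additive_subgroup.a_subgroup subgroup)

lemma star_algebra_quotient: "star_algebra Q"
  by (rule star_algebra_image[OF star_algebra_axioms proj_hom])
    (simp_all add: carrier_quotient zero_quotient proj_eq_zero_iff)

lemma kernel_proj: "a_kernel A Q proj = I"
  using I_carrier proj_eq_zero_iff by (auto simp: a_kernel_iff zero_quotient)

end

text \<open>Let e tend to 0 from the right. This serves submultiplicativity of the quotient norm,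
  where two infima are approximated at once.\<close>

lemma le_mult_epsilon:
  fixes a b x :: real
  assumes "\<And>e. e > 0 \<Longrightarrow> x \<le> (a + e) * (b + e)"
  shows "x \<le> a * b"
proof -
  have "((\<lambda>e. (a + e) * (b + e)) \<longlongrightarrow> (a + 0) * (b + 0)) (at_right 0)" by (intro tendsto_intros)
  moreover have "\<forall>\<^sub>F e in at_right 0. x \<le> (a + e) * (b + e)"
    using eventually_at_right_less by eventually_elim (use assms in auto)
  ultimately have "x \<le> (a + 0) * (b + 0)" by (rule tendsto_lowerbound) simp
  then show ?thesis by simp
qed

locale seminormed_star_ideal = seminormed_star_algebra A + star_ideal A I for A (structure) and I
begin

lemma bdd_below_proj: "x \<in> carrier A \<Longrightarrow> bdd_below (nrm A ` proj x)"
  using mem_proj by (intro bdd_belowI2[of _ 0] seminorm_nonneg) blast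

lemma nrm_quotient_le: "x \<in> carrier A \<Longrightarrow> nrm Q (proj x) \<le> nrm A x"
  using cINF_lower[OF bdd_below_proj proj_refl] by (simp add: quotient_algebra_def)

lemma nrm_quotient_approx:
  assumes "x \<in> carrier A" "0 < e"
  shows "\<exists>y\<in>carrier A. proj y = proj x \<and> nrm A y < nrm Q (proj x) + e"
proof -
  have "\<exists>y\<in>proj x. nrm A y < nrm Q (proj x) + e"
    using assms proj_refl cINF_less_iff[OF _ bdd_below_proj[OF assms(1)], of "nrm Q (proj x) + e"]
    by (auto simp: quotient_algebra_def)
  then show ?thesis using mem_proj[OF assms(1)] by blast
qed

lemma nrm_quotient_leI:
  assumes "x \<in> carrier A" "\<And>y. y \<in> carrier A \<Longrightarrow> proj y = proj x \<Longrightarrow> r \<le> nrm A y"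
  shows "r \<le> nrm Q (proj x)"
proof -
  have "r \<le> (INF y\<in>proj x. nrm A y)"
  proof (rule cINF_greatest)
    show "proj x \<noteq> {}" using proj_refl[OF assms(1)] by blast
    show "r \<le> nrm A y" if "y \<in> proj x" for y using assms(2) mem_proj[OF assms(1) that] by blast
  qed
  then show ?thesis by (simp add: quotient_algebra_def)
qed

lemma seminormed_quotient: "seminormed_star_algebra Q"
proof (intro seminormed_star_algebra.intro seminormed_star_algebra_axioms.intro star_algebra_quotient)
  fix X c assume "X \<in> carrier Q"
  then obtain x where x: "x \<in> carrier A" "X = proj x" by (auto simp: carrier_quotient)
  show nonneg: "0 \<le> nrm Q X" using nrm_quotient_leI[OF x(1), of 0] seminorm_nonneg x(2) by auto
  have sm: "nrm Q (proj (c \<odot> y)) \<le> cmod c * nrm Q (proj y)" if y: "y \<in> carrier A" for c y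
  proof (cases "c = 0")
    case True
    then show ?thesis using y nrm_quotient_le[of \<zero>] by (simp add: seminorm_zero)
  next
    case False
    have "nrm Q (proj (c \<odot> y)) / cmod c \<le> nrm Q (proj y)"
    proof (rule nrm_quotient_leI[OF y])
      fix z assume z: "z \<in> carrier A" "proj z = proj y"
      then have "proj (c \<odot> y) = proj (c \<odot> z)" using y by (metis proj_smult)
      then show "nrm Q (proj (c \<odot> y)) / cmod c \<le> nrm A z"
        using nrm_quotient_le[of "c \<odot> z"] z False by (simp add: seminorm_smult field_simps)
    qed
    then show ?thesis using False by (simp add: field_simps)
  qed
  show "nrm Q (c \<odot>\<^bsub>Q\<^esub> X) = cmod c * nrm Q X"
  proof (cases "c = 0")
    case True
    have "0 \<le> nrm Q (proj \<zero>)" using nrm_quotient_leI[of \<zero> 0] seminorm_nonneg by auto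
    then show ?thesis using True x nrm_quotient_le[of \<zero>] by (simp add: proj_smult seminorm_zero)
  next
    case False
    have "nrm Q (proj (inverse c \<odot> (c \<odot> x))) \<le> cmod (inverse c) * nrm Q (proj (c \<odot> x))"
      by (rule sm) (simp add: x)
    then have "cmod c * nrm Q (proj x) \<le> nrm Q (proj (c \<odot> x))"
      using False x by (simp add: smult_smult smult_one norm_inverse norm_divide field_simps)
    then show ?thesis using sm[OF x(1), of c] x by (simp add: proj_smult)
  qed
  \<comment> \<open>One inequality suffices, since the involution is its own inverse.\<close>
  have st: "nrm Q (proj y) \<le> nrm Q (proj (star A y))" if y: "y \<in> carrier A" for y
  proof (rule nrm_quotient_leI)
    fix z assume z: "z \<in> carrier A" "proj z = proj (star A y)"
    then have "proj (star A z) = proj (star A (star A y))" using y by (metis proj_star star_closed)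
    then show "nrm Q (proj y) \<le> nrm A z"
      using nrm_quotient_le[of "star A z"] y z by (simp add: star_star seminorm_star)
  qed (use y in simp)
  show "nrm Q (star Q X) = nrm Q X"
    using st[of x] st[of "star A x"] x by (simp add: proj_star star_star)
  fix Y assume "Y \<in> carrier Q"
  then obtain y where y: "y \<in> carrier A" "Y = proj y" by (auto simp: carrier_quotient)
  show "nrm Q (X \<oplus>\<^bsub>Q\<^esub> Y) \<le> nrm Q X + nrm Q Y"
  proof (rule field_le_epsilon)
    fix e :: real assume e: "0 < e"
    obtain x' where x': "x' \<in> carrier A" "proj x' = X" "nrm A x' < nrm Q X + e / 2"
      using nrm_quotient_approx[OF x(1), of "e/2"] x e by auto
    obtain y' where y': "y' \<in> carrier A" "proj y' = Y" "nrm A y' < nrm Q Y + e / 2"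
      using nrm_quotient_approx[OF y(1), of "e/2"] y e by auto
    have "X \<oplus>\<^bsub>Q\<^esub> Y = proj (x' \<oplus> y')" using x' y' proj_add by auto
    then show "nrm Q (X \<oplus>\<^bsub>Q\<^esub> Y) \<le> nrm Q X + nrm Q Y + e"
      using nrm_quotient_le[of "x' \<oplus> y'"] seminorm_triangle[of x' y'] x' y' by simp
  qed
  show "nrm Q (X \<otimes>\<^bsub>Q\<^esub> Y) \<le> nrm Q X * nrm Q Y"
  proof (rule le_mult_epsilon)
    fix e :: real assume e: "0 < e"
    obtain x' where x': "x' \<in> carrier A" "proj x' = X" "nrm A x' < nrm Q X + e"
      using nrm_quotient_approx[OF x(1) e] x by auto
    obtain y' where y': "y' \<in> carrier A" "proj y' = Y" "nrm A y' < nrm Q Y + e"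
      using nrm_quotient_approx[OF y(1) e] y by auto
    have "X \<otimes>\<^bsub>Q\<^esub> Y = proj (x' \<otimes> y')" using x' y' proj_mult by auto
    then have "nrm Q (X \<otimes>\<^bsub>Q\<^esub> Y) \<le> nrm A x' * nrm A y'"
      using nrm_quotient_le[of "x' \<otimes> y'"] seminorm_mult[of x' y'] x' y' by simp
    also have "\<dots> \<le> (nrm Q X + e) * (nrm Q Y + e)"
      using x' y' seminorm_nonneg[OF x'(1)] seminorm_nonneg[OF y'(1)] by (intro mult_mono) auto
    finally show "nrm Q (X \<otimes>\<^bsub>Q\<^esub> Y) \<le> (nrm Q X + e) * (nrm Q Y + e)" .
  qed
next
  have "0 \<le> nrm Q (proj \<zero>)" using nrm_quotient_leI[of \<zero> 0] seminorm_nonneg by auto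
  moreover have "nrm Q (proj \<zero>) \<le> 0" using nrm_quotient_le[of \<zero>] by (simp add: seminorm_zero)
  moreover have "proj \<zero> = \<zero>\<^bsub>Q\<^esub>" by (simp add: zero_quotient proj_eq_zero_iff)
  ultimately show "nrm Q \<zero>\<^bsub>Q\<^esub> = 0" by simp
qed

lemma proj_contractive: "proj \<in> contractive_hom A Q"
  using proj_hom nrm_quotient_le by (simp add: contractive_hom_def)

lemma seminormed_ideal: "seminormed_star_algebra (A\<lparr>carrier := I\<rparr>)"
  by (rule seminormed_star_algebra_carrier_update[OF subgroup]) (auto simp: smult_I mult_I_left I_carrier star_I)

text \<open>The infimum in the quotient norm gives lifts with excess at most 2^(-n), and these
  excesses are summable. This takes the place of \<open>bounded_lift\<close>, as the quotient is
  treated only as a seminormed algebra.\<close>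

lemma ps_map_proj_image: "ps_map proj ` power_series A = power_series Q"
proof (intro equalityI subsetI)
  fix G assume "G \<in> ps_map proj ` power_series A"
  then show "G \<in> power_series Q"
    using star_hom_closed[OF ps_map_star_hom[OF seminormed_star_algebra_axioms seminormed_quotient proj_contractive]]
    by (auto simp: power_series_algebra_simps)
next
  fix G assume G: "G \<in> power_series Q"
  have "\<exists>x\<in>carrier A. proj x = G n \<and> nrm A x \<le> nrm Q (G n) + (1/2) ^ n" for n
  proof -
    have "G n \<in> carrier Q" using G by auto
    then obtain x where x: "x \<in> carrier A" "G n = proj x" by (auto simp: carrier_quotient)
    obtain y where "y \<in> carrier A" "proj y = proj x" "nrm A y < nrm Q (proj x) + (1/2) ^ n"
      using nrm_quotient_approx[OF x(1), of "(1/2) ^ n"] by auto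
    then show ?thesis using x(2) by (intro bexI[of _ y]) auto
  qed
  then obtain F where F: "\<And>n. F n \<in> carrier A" "\<And>n. proj (F n) = G n"
    "\<And>n. nrm A (F n) \<le> nrm Q (G n) + (1/2) ^ n" by metis
  have "summable (\<lambda>n. nrm Q (G n) + (1/2::real) ^ n)"
    using G by (intro summable_add summable_geometric) (auto simp: power_series_def)
  then have "summable (\<lambda>n. nrm A (F n))"
    by (rule summable_comparison_test') (use F in \<open>simp add: seminorm_nonneg\<close>)
  then have "F \<in> power_series A" by (simp add: power_series_def F)
  moreover have "G = ps_map proj F" by (simp add: ps_map_def F)
  ultimately show "G \<in> ps_map proj ` power_series A" by blast
qed

abbreviation "IZ \<equiv> power_series (A\<lparr>carrier := I\<rparr>)"

lemma IZ_iff: "F \<in> IZ \<longleftrightarrow> F \<in> power_series A \<and> (\<forall>n. F n \<in> I)"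
  using I.a_subset by (simp add: power_series_carrier_update)

lemma finsum_in_I: "(\<And>i. i \<in> S \<Longrightarrow> f i \<in> I) \<Longrightarrow> (\<Oplus>i\<in>S. f i) \<in> I"
  by (induction S rule: infinite_finite_induct) (auto simp: Pi_def I_carrier)

lemma star_ideal_power_series: "star_ideal (power_series_algebra K A) IZ"
proof (intro star_ideal.intro star_ideal_axioms.intro star_algebra_power_series additive_subgroupI)
  interpret P: star_algebra "power_series_algebra K A" by (rule star_algebra_power_series)
  have closed: "F \<otimes>\<^bsub>power_series_algebra K A\<^esub> G \<in> power_series A" "F \<oplus>\<^bsub>power_series_algebra K A\<^esub> G \<in> power_series A"
    "c \<odot>\<^bsub>power_series_algebra K A\<^esub> F \<in> power_series A" "star (power_series_algebra K A) F \<in> power_series A"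
    if "F \<in> power_series A" "G \<in> power_series A" for F G c
    using that P.m_closed P.a_closed P.smult_closed P.star_closed by (auto simp: power_series_algebra_simps(1))
  have smult: "c \<odot>\<^bsub>power_series_algebra K A\<^esub> F \<in> IZ" if "F \<in> IZ" for F c
    using that closed[of F F] smult_I unfolding IZ_iff power_series_algebra_simps by auto
  show "subgroup IZ (add_monoid (power_series_algebra K A))"
  proof (rule P.add.subgroupI)
    show "IZ \<subseteq> carrier (power_series_algebra K A)" by (auto simp: power_series_algebra_simps IZ_iff)
    have "(\<lambda>n. \<zero>) \<in> IZ" by (auto simp: IZ_iff power_series_closed)
    then show "IZ \<noteq> {}" by blast
    fix F assume F: "F \<in> IZ"
    then have "\<ominus>\<^bsub>power_series_algebra K A\<^esub> F = (-1) \<odot>\<^bsub>power_series_algebra K A\<^esub> F"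
      using P.smult_minus_left[of F 1] P.smult_one[of F] by (simp add: power_series_algebra_simps(1) IZ_iff)
    then show "\<ominus>\<^bsub>power_series_algebra K A\<^esub> F \<in> IZ" using smult[OF F] by simp
    fix G assume "G \<in> IZ"
    then show "F \<oplus>\<^bsub>power_series_algebra K A\<^esub> G \<in> IZ"
      using F closed[of F G] unfolding IZ_iff power_series_algebra_simps by auto
  qed
  fix F c assume F: "F \<in> IZ"
  show "c \<odot>\<^bsub>power_series_algebra K A\<^esub> F \<in> IZ" by (rule smult[OF F])
  show "star (power_series_algebra K A) F \<in> IZ"
    using F closed[of F F] star_I unfolding IZ_iff power_series_algebra_simps by auto
  fix G assume "G \<in> carrier (power_series_algebra K A)"
  then have G: "G \<in> power_series A" by (simp add: power_series_algebra_simps)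
  show "G \<otimes>\<^bsub>power_series_algebra K A\<^esub> F \<in> IZ"
    using F G closed(1)[of G F] unfolding IZ_iff power_series_algebra_simps
    by (auto intro!: finsum_in_I mult_I_left)
  show "F \<otimes>\<^bsub>power_series_algebra K A\<^esub> G \<in> IZ"
    using F G closed(1)[of F G] unfolding IZ_iff power_series_algebra_simps
    by (auto intro!: finsum_in_I mult_I_right)
qed

lemma inclusion_hom: "(\<lambda>F. F) \<in> star_hom (power_series_algebra K (A\<lparr>carrier := I\<rparr>)) (power_series_algebra K A)"
proof -
  interpret J: seminormed_star_algebra "A\<lparr>carrier := I\<rparr>" by (rule seminormed_ideal)
  have "finsum (A\<lparr>carrier := I\<rparr>) (\<lambda>i. F i \<otimes> G (n - i)) {..n} = (\<Oplus>i\<in>{..n}. F i \<otimes> G (n - i))"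
    if "F \<in> IZ" "G \<in> IZ" for F G n
    using that I.a_subset
    by (intro finsum_carrier_cong[OF abelian_group_axioms J.abelian_group_axioms]) (auto simp: IZ_iff mult_I_left)
  then show ?thesis
    by (intro star_homI) (auto simp: power_series_algebra_simps IZ_iff)
qed

lemma short_exact_quotient:
  "short_exact (power_series_algebra K (A\<lparr>carrier := I\<rparr>)) (power_series_algebra K A)
    (quotient_algebra (power_series_algebra K A) IZ) (\<lambda>F. F) (\<lambda>F. IZ +>\<^bsub>power_series_algebra K A\<^esub> F)"
proof -
  interpret PI: star_ideal "power_series_algebra K A" IZ by (rule star_ideal_power_series)
  show ?thesis
    unfolding short_exact_def
    using seminormed_star_algebra.star_algebra_power_series[OF seminormed_ideal] star_algebra_power_series
      PI.star_algebra_quotient inclusion_hom PI.proj_hom PI.kernel_proj PI.carrier_quotient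
    by (auto simp: power_series_algebra_simps(1) intro: inj_onI)
qed

lemma short_exact_power_series_quotient:
  "short_exact (power_series_algebra K (A\<lparr>carrier := I\<rparr>)) (power_series_algebra K A)
    (power_series_algebra K Q) (\<lambda>F. F) (ps_map proj)"
proof -
  have "a_kernel (power_series_algebra K A) (power_series_algebra K Q) (ps_map proj) = IZ"
    using proj_eq_zero_iff power_series_carrier[of _ A]
    by (auto simp: a_kernel_iff power_series_algebra_simps zero_quotient ps_map_def IZ_iff fun_eq_iff)
  then show ?thesis
    unfolding short_exact_def
    using seminormed_star_algebra.star_algebra_power_series[OF seminormed_ideal] star_algebra_power_series
      seminormed_star_algebra.star_algebra_power_series[OF seminormed_quotient] inclusion_hom
      ps_map_star_hom[OF seminormed_star_algebra_axioms seminormed_quotient proj_contractive] ps_map_proj_image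
    by (auto simp: power_series_algebra_simps(1) intro: inj_onI)
qed

end

lemma (in cstar_algebra) closed_ideal_seminormed_star_ideal:
  assumes "closed_ideal I A"
  shows "seminormed_star_ideal A I"
proof -
  have "star_ideal_axioms A I"
    by (intro star_ideal_axioms.intro) (use assms closed_ideal_star_closed[OF assms] in \<open>auto simp: closed_ideal_def\<close>)
  then show ?thesis
    by (intro seminormed_star_ideal.intro star_ideal.intro star_algebra_axioms seminormed_star_algebra_axioms)
qed

text \<open>Closedness of \<open>I\<close> enters three times: a series with coefficients in
  \<open>I\<close> has values in \<open>I\<close>, limits of such values lie in \<open>I\<close>,
  and values in \<open>I\<close> force the coefficients into \<open>I\<close>.\<close>

lemma (in power_series_cstar) closed_ideal_power_series:
  assumes I: "closed_ideal I A"
  shows "closed_ideal (power_series (A\<lparr>carrier := I\<rparr>)) P"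
proof -
  interpret I: seminormed_star_ideal A I by (rule closed_ideal_seminormed_star_ideal[OF I])
  interpret PI: star_ideal P I.IZ by (rule I.star_ideal_power_series)
  have clI: "closedin (ctop A) I" using I by (simp add: closed_ideal_def)
  have "closedin (ctop P) I.IZ"
  proof (rule P.closedinI_norm_lim)
    show "I.IZ \<subseteq> carrier P" using PI.I_carrier by blast
    fix s F assume s: "\<And>n. s n \<in> I.IZ" and lim: "norm_lim P s F"
    have F: "F \<in> power_series A" using lim by (simp add: norm_lim_def power_series_algebra_simps(1))
    have sA: "s n \<in> power_series A" for n using s[of n] by (simp add: I.IZ_iff)
    have "ps_eval A F t \<in> I" if t: "t \<in> K" for t
    proof (rule closedin_norm_lim[OF clI])
      show "ps_eval A (s n) t \<in> I" for n
      proof (rule closedin_norm_lim[OF clI ps_eval_lim[OF sA K_abs[OF t]]])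
        show "ps_partial (s n) t N \<in> I" for N
          using s[of n] by (intro I.finsum_in_I I.smult_I) (simp add: I.IZ_iff)
      qed
      show "norm_lim A (\<lambda>n. ps_eval A (s n) t) (ps_eval A F t)"
      proof (rule norm_limI)
        fix n
        have m1: "(-1) \<odot>\<^bsub>P\<^esub> F \<in> power_series A"
          using P.smult_closed[of F "-1"] F by (simp add: power_series_algebra_simps(1))
        have "s n \<ominus>\<^bsub>P\<^esub> F = s n \<oplus>\<^bsub>P\<^esub> (-1) \<odot>\<^bsub>P\<^esub> F"
          using F by (simp add: P.minus_eq P.smult_minus_one power_series_algebra_simps(1))
        then have "ps_eval A (s n \<ominus>\<^bsub>P\<^esub> F) t = ps_eval A (s n) t \<oplus> (-1) \<odot> ps_eval A F t"
          using ps_eval_add[OF sA m1 K_abs[OF t]] ps_eval_smult[OF F K_abs[OF t]]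
          by (simp add: power_series_algebra_simps(4,5))
        then have ev: "ps_eval A (s n \<ominus>\<^bsub>P\<^esub> F) t = ps_eval A (s n) t \<ominus> ps_eval A F t"
          using F t by (simp add: minus_eq smult_minus_one)
        have "s n \<ominus>\<^bsub>P\<^esub> F \<in> power_series A"
          using sA F P.minus_closed[of "s n" F] by (simp add: power_series_algebra_simps(1))
        then show "nrm A (ps_eval A (s n) t \<ominus> ps_eval A F t) \<le> nrm P (s n \<ominus>\<^bsub>P\<^esub> F)"
          using nrm_eval_le[OF _ t] ev by metis
      next
        show "(\<lambda>n. nrm P (s n \<ominus>\<^bsub>P\<^esub> F)) \<longlonglongrightarrow> 0" using lim by (simp add: norm_lim_def)
      qed (use sA F t in auto)
    qed
    then have "F n \<in> I" for n
      using coefficients_in_closed_subspace[OF K_subset K_limpt I.subgroup I.smult_I clI F] by blast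
    then show "F \<in> I.IZ" using F by (simp add: I.IZ_iff)
  qed
  then show ?thesis
    using PI.subgroup PI.smult_I PI.mult_I_left PI.mult_I_right by (simp add: closed_ideal_def)
qed

section \<open>Completions\<close>

definition cauchy_class :: "('a, 'm) normed_star_algebra_scheme \<Rightarrow> (nat \<Rightarrow> 'a) \<Rightarrow> (nat \<Rightarrow> 'a) set" where
  "cauchy_class A s = cauchy_rel A `` {s}"

text \<open>Cauchy sequences before identification: the algebra laws hold termwise and descend to
  the completion along \<open>cauchy_class\<close>.\<close>

definition cauchy_algebra :: "('a, 'm) normed_star_algebra_scheme \<Rightarrow> (nat \<Rightarrow> 'a) normed_star_algebra" where
  "cauchy_algebra A =
    \<lparr>carrier = cauchy_seqs A, mult = (\<lambda>s t n. s n \<otimes>\<^bsub>A\<^esub> t n), one = (\<lambda>n. \<one>\<^bsub>A\<^esub>), zero = (\<lambda>n. \<zero>\<^bsub>A\<^esub>),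
     add = (\<lambda>s t n. s n \<oplus>\<^bsub>A\<^esub> t n), smult = (\<lambda>c s n. c \<odot>\<^bsub>A\<^esub> s n), star = (\<lambda>s n. star A (s n)),
     nrm = (\<lambda>s. lim (\<lambda>n. nrm A (s n)))\<rparr>"

context pre_cstar_algebra
begin

lemma cauchy_seqs_iff:
  "s \<in> cauchy_seqs A \<longleftrightarrow> (\<forall>n. s n \<in> carrier A) \<and>
    (\<forall>e>0. \<exists>N. \<forall>m\<ge>N. \<forall>n\<ge>N. nrm A (s m \<ominus> s n) < e)"
  by (simp add: cauchy_seqs_def MCauchy_iff)

lemma cauchy_seqs_carrier: "s \<in> cauchy_seqs A \<Longrightarrow> s n \<in> carrier A"
  by (simp add: cauchy_seqs_iff)

text \<open>One criterion covers all termwise operations: the oscillation of \<open>u\<close> is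
  controlled linearly by those of \<open>s\<close> and \<open>t\<close>.\<close>

lemma cauchy_seqsI:
  assumes "s \<in> cauchy_seqs A" "t \<in> cauchy_seqs A" "\<And>n. u n \<in> carrier A" "0 \<le> c"
    and le: "\<And>m n. nrm A (u m \<ominus> u n) \<le> c * (nrm A (s m \<ominus> s n) + nrm A (t m \<ominus> t n))"
  shows "u \<in> cauchy_seqs A"
  unfolding cauchy_seqs_iff
proof (intro conjI allI impI assms(3))
  fix e :: real assume e: "0 < e"
  \<comment> \<open>Then c (d + d) = e c/(c + 1) < e; the summand 1 also covers c = 0.\<close>
  define d where "d = e / (c + 1) / 2"
  have d: "d > 0" using e assms(4) by (simp add: d_def)
  obtain N1 where N1: "\<And>m n. m \<ge> N1 \<Longrightarrow> n \<ge> N1 \<Longrightarrow> nrm A (s m \<ominus> s n) < d"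
    using assms(1) d unfolding cauchy_seqs_iff by blast
  obtain N2 where N2: "\<And>m n. m \<ge> N2 \<Longrightarrow> n \<ge> N2 \<Longrightarrow> nrm A (t m \<ominus> t n) < d"
    using assms(2) d unfolding cauchy_seqs_iff by blast
  have "nrm A (u m \<ominus> u n) < e" if "m \<ge> max N1 N2" "n \<ge> max N1 N2" for m n
  proof -
    have "nrm A (u m \<ominus> u n) \<le> c * (nrm A (s m \<ominus> s n) + nrm A (t m \<ominus> t n))" by (rule le)
    also have "\<dots> \<le> c * (d + d)" using N1[of m n] N2[of m n] that assms(4) by (intro mult_left_mono) auto
    also have "\<dots> < e"
    proof -
      have "c * (d + d) + (d + d) = (c + 1) * (e / (c + 1))"
        unfolding d_def by (simp only: field_sum_of_halves distrib_right mult_1_left)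
      also have "\<dots> = e" using assms(4) by simp
      finally show ?thesis using d by linarith
    qed
    finally show ?thesis .
  qed
  then show "\<exists>N. \<forall>m\<ge>N. \<forall>n\<ge>N. nrm A (u m \<ominus> u n) < e" by blast
qed

lemma convergent_nrm_cauchy:
  assumes s: "s \<in> cauchy_seqs A"
  shows "convergent (\<lambda>n. nrm A (s n))"
proof (rule Cauchy_convergent)
  show "Cauchy (\<lambda>n. nrm A (s n))"
  proof (rule metric_CauchyI)
    fix e :: real assume "0 < e"
    then obtain N where N: "\<And>m n. m \<ge> N \<Longrightarrow> n \<ge> N \<Longrightarrow> nrm A (s m \<ominus> s n) < e"
      using s unfolding cauchy_seqs_iff by blast
    have "dist (nrm A (s m)) (nrm A (s n)) < e" if "m \<ge> N" "n \<ge> N" for m n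
      using N[OF that] abs_nrm_diff[of "s m" "s n"] cauchy_seqs_carrier[OF s] by (simp add: dist_real_def)
    then show "\<exists>M. \<forall>m\<ge>M. \<forall>n\<ge>M. dist (nrm A (s m)) (nrm A (s n)) < e" by blast
  qed
qed

lemma cauchy_bounded:
  assumes "s \<in> cauchy_seqs A"
  shows "\<exists>M\<ge>0. \<forall>n. nrm A (s n) \<le> M"
proof -
  obtain M where "\<And>n. norm (nrm A (s n)) \<le> M"
    using convergent_imp_Bseq[OF convergent_nrm_cauchy[OF assms]] unfolding Bseq_def by blast
  then have "nrm A (s n) \<le> max 0 M" for n by (smt (verit) real_norm_def)
  then show ?thesis by (intro exI[of _ "max 0 M"]) auto
qed

lemma nrm_mult_diff_le_bound:
  assumes "a \<in> carrier A" "b \<in> carrier A" "a' \<in> carrier A" "b' \<in> carrier A" "nrm A a \<le> M" "nrm A b' \<le> M"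
  shows "nrm A (a \<otimes> b \<ominus> a' \<otimes> b') \<le> M * (nrm A (a \<ominus> a') + nrm A (b \<ominus> b'))"
proof -
  have "nrm A (a \<otimes> b \<ominus> a' \<otimes> b') \<le> nrm A a * nrm A (b \<ominus> b') + nrm A (a \<ominus> a') * nrm A b'"
    by (rule nrm_mult_diff_le[OF assms(1-4)])
  also have "\<dots> \<le> M * nrm A (b \<ominus> b') + nrm A (a \<ominus> a') * M"
    using assms nrm_nonneg[of a] by (intro add_mono mult_mono nrm_nonneg minus_closed) linarith+
  finally show ?thesis by (simp add: algebra_simps)
qed

lemma cauchy_seqs_closed:
  assumes s: "s \<in> cauchy_seqs A"
  shows "(\<lambda>n. c \<odot> s n) \<in> cauchy_seqs A" "(\<lambda>n. star A (s n)) \<in> cauchy_seqs A"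
    "t \<in> cauchy_seqs A \<Longrightarrow> (\<lambda>n. s n \<oplus> t n) \<in> cauchy_seqs A"
    "t \<in> cauchy_seqs A \<Longrightarrow> (\<lambda>n. s n \<otimes> t n) \<in> cauchy_seqs A"
proof -
  note c = cauchy_seqs_carrier
  show "(\<lambda>n. c \<odot> s n) \<in> cauchy_seqs A"
    by (rule cauchy_seqsI[OF s s, where c="cmod c"])
      (use c[OF s] in \<open>auto simp: nrm_smult_diff nrm_nonneg intro!: mult_left_mono\<close>)
  show "(\<lambda>n. star A (s n)) \<in> cauchy_seqs A"
    by (rule cauchy_seqsI[OF s s, where c=1]) (use c[OF s] in \<open>auto simp: nrm_star_diff nrm_nonneg\<close>)
  assume t: "t \<in> cauchy_seqs A"
  show "(\<lambda>n. s n \<oplus> t n) \<in> cauchy_seqs A"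
    by (rule cauchy_seqsI[OF s t, where c=1]) (use c[OF s] c[OF t] in \<open>auto simp: nrm_add_diff_le\<close>)
  obtain M N where M: "M \<ge> 0" "\<And>n. nrm A (s n) \<le> M" and N: "N \<ge> 0" "\<And>n. nrm A (t n) \<le> N"
    using cauchy_bounded[OF s] cauchy_bounded[OF t] by blast
  show "(\<lambda>n. s n \<otimes> t n) \<in> cauchy_seqs A"
  proof (rule cauchy_seqsI[OF s t, where c="max M N"])
    show "nrm A (s m \<otimes> t m \<ominus> s n \<otimes> t n) \<le> max M N * (nrm A (s m \<ominus> s n) + nrm A (t m \<ominus> t n))" for m n
      using M(2)[of m] N(2)[of n] by (intro nrm_mult_diff_le_bound c s t) auto
  qed (use M c[OF s] c[OF t] in auto)
qed

lemma cauchy_seqs_const: "x \<in> carrier A \<Longrightarrow> (\<lambda>_. x) \<in> cauchy_seqs A"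
  by (simp add: cauchy_seqs_iff minus_eq r_neg seminorm_zero)

lemma star_algebra_cauchy: "star_algebra (cauchy_algebra A)"
proof -
  note [simp] = cauchy_seqs_carrier cauchy_seqs_closed
  have m: "(\<lambda>n. \<ominus> s n) \<in> cauchy_seqs A" if "s \<in> cauchy_seqs A" for s
    using cauchy_seqs_closed(1)[OF that, of "-1"] that by (simp add: smult_minus_one)
  have "abelian_group (cauchy_algebra A)"
  proof (rule abelian_groupI)
    fix s assume "s \<in> carrier (cauchy_algebra A)"
    then show "\<exists>t\<in>carrier (cauchy_algebra A). t \<oplus>\<^bsub>cauchy_algebra A\<^esub> s = \<zero>\<^bsub>cauchy_algebra A\<^esub>"
      by (intro bexI[of _ "\<lambda>n. \<ominus> s n"]) (auto simp: cauchy_algebra_def m l_neg)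
  qed (auto simp: cauchy_algebra_def cauchy_seqs_const a_ac)
  then show ?thesis
    by (intro star_algebra.intro star_algebra_axioms.intro)
      (auto simp: cauchy_algebra_def m_assoc l_distr r_distr smult_l_distr smult_r_distr smult_assoc1 smult_one
        smult_mult_left smult_mult_right star_star star_add star_mult star_smult)
qed

lemma cauchy_rel_iff:
  "(s, t) \<in> cauchy_rel A \<longleftrightarrow> s \<in> cauchy_seqs A \<and> t \<in> cauchy_seqs A \<and> (\<lambda>n. nrm A (s n \<ominus> t n)) \<longlonglongrightarrow> 0"
  unfolding cauchy_rel_def by (auto simp: cdist_def cauchy_seqs_carrier)

text \<open>The counterpart of \<open>cauchy_seqsI\<close> for null differences, from which the
  operations on classes are well defined.\<close>

lemma cauchy_relI:
  assumes "u \<in> cauchy_seqs A" "u' \<in> cauchy_seqs A" "(s, s') \<in> cauchy_rel A" "(t, t') \<in> cauchy_rel A"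
    and le: "\<And>n. nrm A (u n \<ominus> u' n) \<le> c * (nrm A (s n \<ominus> s' n) + nrm A (t n \<ominus> t' n))"
  shows "(u, u') \<in> cauchy_rel A"
proof -
  have "(\<lambda>n. c * (nrm A (s n \<ominus> s' n) + nrm A (t n \<ominus> t' n))) \<longlonglongrightarrow> c * (0 + 0)"
    using assms(3,4) by (intro tendsto_intros) (auto simp: cauchy_rel_iff)
  then have lim: "(\<lambda>n. c * (nrm A (s n \<ominus> s' n) + nrm A (t n \<ominus> t' n))) \<longlonglongrightarrow> 0" by simp
  have "norm (nrm A (u n \<ominus> u' n)) \<le> c * (nrm A (s n \<ominus> s' n) + nrm A (t n \<ominus> t' n))" for n
    using le[of n] nrm_nonneg[OF minus_closed[OF cauchy_seqs_carrier[OF assms(1)] cauchy_seqs_carrier[OF assms(2)]]]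
    by simp
  then have "(\<lambda>n. nrm A (u n \<ominus> u' n)) \<longlonglongrightarrow> 0"
    by (intro Lim_null_comparison[OF always_eventually lim]) blast
  then show ?thesis using assms(1,2) by (simp add: cauchy_rel_iff)
qed

lemma equiv_cauchy_rel: "equiv (cauchy_seqs A) (cauchy_rel A)"
proof (rule equivI)
  show "cauchy_rel A \<subseteq> cauchy_seqs A \<times> cauchy_seqs A" by (auto simp: cauchy_rel_def)
  show "refl_on (cauchy_seqs A) (cauchy_rel A)"
    by (rule refl_onI) (simp add: cauchy_rel_iff cauchy_seqs_carrier minus_eq r_neg seminorm_zero)
  show "sym (cauchy_rel A)"
  proof (rule symI)
    fix s t assume st: "(s, t) \<in> cauchy_rel A"
    then have "nrm A (t n \<ominus> s n) = nrm A (s n \<ominus> t n)" for n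
      by (intro nrm_minus_commute) (auto simp: cauchy_rel_iff cauchy_seqs_carrier)
    then show "(t, s) \<in> cauchy_rel A" using st by (simp add: cauchy_rel_iff)
  qed
  show "trans (cauchy_rel A)"
  proof (rule transI)
    fix s t u assume st: "(s, t) \<in> cauchy_rel A" and tu: "(t, u) \<in> cauchy_rel A"
    have c: "s n \<in> carrier A" "t n \<in> carrier A" "u n \<in> carrier A" for n
      using st tu by (auto simp: cauchy_rel_iff cauchy_seqs_carrier)
    have "nrm A (s n \<ominus> u n) \<le> 1 * (nrm A (s n \<ominus> t n) + nrm A (t n \<ominus> u n))" for n
    proof -
      have "s n \<ominus> u n = (s n \<ominus> t n) \<oplus> (t n \<ominus> u n)" using c[of n] by algebra
      then show ?thesis using c[of n] nrm_triangle[of "s n \<ominus> t n" "t n \<ominus> u n"] by simp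
    qed
    then show "(s, u) \<in> cauchy_rel A"
      using st tu by (intro cauchy_relI[OF _ _ st tu, where c=1]) (simp_all add: cauchy_rel_iff)
  qed
qed

abbreviation "cls \<equiv> cauchy_class A"

lemma mem_cls: "t \<in> cls s \<longleftrightarrow> (s, t) \<in> cauchy_rel A"
  by (simp add: cauchy_class_def)

lemma cls_refl: "s \<in> cauchy_seqs A \<Longrightarrow> s \<in> cls s"
  using equiv_class_self[OF equiv_cauchy_rel] by (simp add: cauchy_class_def)

lemma cls_eqI: "(s, t) \<in> cauchy_rel A \<Longrightarrow> cls s = cls t"
  using equiv_class_eq[OF equiv_cauchy_rel] by (simp add: cauchy_class_def)

lemma cls_eq_iff: "s \<in> cauchy_seqs A \<Longrightarrow> t \<in> cauchy_seqs A \<Longrightarrow> cls s = cls t \<longleftrightarrow> (s, t) \<in> cauchy_rel A"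
  using eq_equiv_class_iff[OF equiv_cauchy_rel] by (simp add: cauchy_class_def)

abbreviation "C \<equiv> completion A"

lemma carrier_completion: "carrier C = cls ` cauchy_seqs A"
  by (auto simp: completion_def quotient_def cauchy_class_def)

lemma to_completion_eq: "to_completion A x = cls (\<lambda>_. x)"
  by (simp add: to_completion_def cauchy_class_def)

text \<open>The operations of \<open>completion\<close> are unions over representatives; this
  reduces each of them to independence of the representative.\<close>

lemma UN_const_class: "s \<in> cauchy_seqs A \<Longrightarrow> (\<And>s'. (s, s') \<in> cauchy_rel A \<Longrightarrow> f s' = X) \<Longrightarrow> (\<Union>s'\<in>cls s. f s') = X"
  using cls_refl[of s] by (subst SUP_cong[where D="\<lambda>_. X"]) (auto simp: mem_cls)

lemma cls_smult: 
  assumes s: "s \<in> cauchy_seqs A" shows "c \<odot>\<^bsub>C\<^esub> cls s = cls (\<lambda>n. c \<odot> s n)"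
proof -
  have "cls (\<lambda>n. c \<odot> s' n) = cls (\<lambda>n. c \<odot> s n)" if r: "(s, s') \<in> cauchy_rel A" for s'
  proof -
    have s': "s' \<in> cauchy_seqs A" using r by (simp add: cauchy_rel_iff)
    have "(\<lambda>n. c \<odot> s n, \<lambda>n. c \<odot> s' n) \<in> cauchy_rel A"
      by (rule cauchy_relI[OF _ _ r r, where c="cmod c"])
        (use s s' in \<open>auto simp: cauchy_seqs_closed cauchy_seqs_carrier nrm_smult_diff nrm_nonneg intro!: mult_left_mono\<close>)
    then show ?thesis by (rule cls_eqI[symmetric])
  qed
  then show ?thesis using UN_const_class[OF s, of "\<lambda>s. cls (\<lambda>n. c \<odot> s n)"]
    by (simp add: completion_def cauchy_class_def)
qed

lemma cls_star: 
  assumes s: "s \<in> cauchy_seqs A" shows "star C (cls s) = cls (\<lambda>n. star A (s n))"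
proof -
  have "cls (\<lambda>n. star A (s' n)) = cls (\<lambda>n. star A (s n))" if r: "(s, s') \<in> cauchy_rel A" for s'
  proof -
    have s': "s' \<in> cauchy_seqs A" using r by (simp add: cauchy_rel_iff)
    have "(\<lambda>n. star A (s n), \<lambda>n. star A (s' n)) \<in> cauchy_rel A"
      by (rule cauchy_relI[OF _ _ r r, where c=1])
        (use s s' in \<open>auto simp: cauchy_seqs_closed cauchy_seqs_carrier nrm_star_diff nrm_nonneg\<close>)
    then show ?thesis by (rule cls_eqI[symmetric])
  qed
  then show ?thesis using UN_const_class[OF s, of "\<lambda>s. cls (\<lambda>n. star A (s n))"]
    by (simp add: completion_def cauchy_class_def)
qed

lemma cls_add: 
  assumes s: "s \<in> cauchy_seqs A" and t: "t \<in> cauchy_seqs A"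
  shows "cls s \<oplus>\<^bsub>C\<^esub> cls t = cls (\<lambda>n. s n \<oplus> t n)"
proof -
  have "cls (\<lambda>n. s' n \<oplus> t' n) = cls (\<lambda>n. s n \<oplus> t n)"
    if r: "(s, s') \<in> cauchy_rel A" "(t, t') \<in> cauchy_rel A" for s' t'
  proof -
    have s': "s' \<in> cauchy_seqs A" "t' \<in> cauchy_seqs A" using r by (simp_all add: cauchy_rel_iff)
    have "(\<lambda>n. s n \<oplus> t n, \<lambda>n. s' n \<oplus> t' n) \<in> cauchy_rel A"
      by (rule cauchy_relI[OF _ _ r, where c=1])
        (use s t s' in \<open>auto simp: cauchy_seqs_closed cauchy_seqs_carrier nrm_add_diff_le\<close>)
    then show ?thesis by (rule cls_eqI[symmetric])
  qed
  then have "(\<Union>s'\<in>cls s. \<Union>t'\<in>cls t. cls (\<lambda>n. s' n \<oplus> t' n)) = cls (\<lambda>n. s n \<oplus> t n)"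
    by (intro UN_const_class s t)
  then show ?thesis by (simp add: completion_def cauchy_class_def)
qed

lemma cls_mult: 
  assumes s: "s \<in> cauchy_seqs A" and t: "t \<in> cauchy_seqs A"
  shows "cls s \<otimes>\<^bsub>C\<^esub> cls t = cls (\<lambda>n. s n \<otimes> t n)"
proof -
  have "cls (\<lambda>n. s' n \<otimes> t' n) = cls (\<lambda>n. s n \<otimes> t n)"
    if r: "(s, s') \<in> cauchy_rel A" "(t, t') \<in> cauchy_rel A" for s' t'
  proof -
    have s': "s' \<in> cauchy_seqs A" "t' \<in> cauchy_seqs A" using r by (simp_all add: cauchy_rel_iff)
    \<comment> \<open>The estimate for a difference of products keeps the left factor of the first
      and the right factor of the second, hence bounds for \<open>s\<close> and
      \<open>t'\<close>.\<close>
    obtain M N where M: "M \<ge> 0" "\<And>n. nrm A (s n) \<le> M" and N: "N \<ge> 0" "\<And>n. nrm A (t' n) \<le> N"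
      using cauchy_bounded[OF s] cauchy_bounded[OF s'(2)] by blast
    have "(\<lambda>n. s n \<otimes> t n, \<lambda>n. s' n \<otimes> t' n) \<in> cauchy_rel A"
    proof (rule cauchy_relI[OF _ _ r, where c="max M N"])
      show "nrm A (s n \<otimes> t n \<ominus> s' n \<otimes> t' n) \<le> max M N * (nrm A (s n \<ominus> s' n) + nrm A (t n \<ominus> t' n))" for n
        using M(2)[of n] N(2)[of n] by (intro nrm_mult_diff_le_bound cauchy_seqs_carrier s t s') auto
    qed (use s t s' in \<open>auto simp: cauchy_seqs_closed\<close>)
    then show ?thesis by (rule cls_eqI[symmetric])
  qed
  then have "(\<Union>s'\<in>cls s. \<Union>t'\<in>cls t. cls (\<lambda>n. s' n \<otimes> t' n)) = cls (\<lambda>n. s n \<otimes> t n)"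
    by (intro UN_const_class s t)
  then show ?thesis by (simp add: completion_def cauchy_class_def)
qed

text \<open>Equivalent sequences have the same limit of norms, so \<open>the_elem\<close> in the
  norm of \<open>completion\<close> is applied to a singleton.\<close>

lemma nrm_cls_lim: 
  assumes s: "s \<in> cauchy_seqs A"
  shows "(\<lambda>n. nrm A (s n)) \<longlonglongrightarrow> nrm C (cls s)"
proof -
  have "lim (\<lambda>n. nrm A (s' n)) = lim (\<lambda>n. nrm A (s n))" if "s' \<in> cls s" for s'
  proof -
    have s': "s' \<in> cauchy_seqs A" "(\<lambda>n. nrm A (s n \<ominus> s' n)) \<longlonglongrightarrow> 0"
      using that by (auto simp: mem_cls cauchy_rel_iff)
    have "(\<lambda>n. nrm A (s n) - nrm A (s' n)) \<longlonglongrightarrow> 0"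
      by (rule Lim_null_comparison[OF _ s'(2)]) (use s s'(1) in \<open>simp add: abs_nrm_diff cauchy_seqs_carrier\<close>)
    from tendsto_diff[OF convergent_LIMSEQ_iff[THEN iffD1, OF convergent_nrm_cauchy[OF s]] this]
    have "(\<lambda>n. nrm A (s' n)) \<longlonglongrightarrow> lim (\<lambda>n. nrm A (s n))" by simp
    then show ?thesis by (rule limI)
  qed
  then have "(\<lambda>s. lim (\<lambda>n. nrm A (s n))) ` cls s = {lim (\<lambda>n. nrm A (s n))}"
    using cls_refl[OF s] by blast
  then have "nrm C (cls s) = lim (\<lambda>n. nrm A (s n))" by (simp add: completion_def)
  then show ?thesis using convergent_nrm_cauchy[OF s] by (simp add: convergent_LIMSEQ_iff)
qed

lemma cls_hom: "cls \<in> star_hom (cauchy_algebra A) C"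
  by (rule star_homI) (simp_all add: cauchy_algebra_def carrier_completion cls_add cls_mult cls_smult cls_star)

lemma cls_zero: "cls (\<lambda>_. \<zero>) = \<zero>\<^bsub>C\<^esub>"
  by (simp add: completion_def to_completion_eq)

lemma star_algebra_completion: "star_algebra C"
  by (rule star_algebra_image[OF star_algebra_cauchy cls_hom])
    (simp_all add: carrier_completion cauchy_algebra_def cls_zero)

text \<open>Each norm law is the limit of the same law for the terms of representatives.
  Definiteness holds because null sequences have been divided out.\<close>

lemma pre_cstar_completion: "pre_cstar_algebra C"
proof (intro pre_cstar_algebra.intro pre_cstar_algebra_axioms.intro star_algebra_completion)
  note c = cauchy_seqs_carrier
  fix X assume "X \<in> carrier C"
  then obtain s where s: "s \<in> cauchy_seqs A" "X = cls s" by (auto simp: carrier_completion)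
  show "0 \<le> nrm C X"
    using tendsto_lowerbound[OF nrm_cls_lim[OF s(1)]] c[OF s(1)] s(2) by (simp add: nrm_nonneg)
  show "nrm C X = 0 \<longleftrightarrow> X = \<zero>\<^bsub>C\<^esub>"
  proof -
    have z: "(\<lambda>_. \<zero>) \<in> cauchy_seqs A" by (simp add: cauchy_seqs_const)
    have "nrm C X = 0 \<longleftrightarrow> (\<lambda>n. nrm A (s n)) \<longlonglongrightarrow> 0"
      using nrm_cls_lim[OF s(1)] LIMSEQ_unique s(2) by auto
    also have "\<dots> \<longleftrightarrow> (s, \<lambda>_. \<zero>) \<in> cauchy_rel A"
      using s z c[OF s(1)] by (simp add: cauchy_rel_iff minus_eq)
    also have "\<dots> \<longleftrightarrow> X = cls (\<lambda>_. \<zero>)" using cls_eq_iff[OF s(1) z] s(2) by simp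
    finally show ?thesis by (simp add: cls_zero)
  qed
  fix d
  show "nrm C (d \<odot>\<^bsub>C\<^esub> X) = cmod d * nrm C X"
  proof (rule LIMSEQ_unique)
    show "(\<lambda>n. nrm A (d \<odot> s n)) \<longlonglongrightarrow> nrm C (d \<odot>\<^bsub>C\<^esub> X)"
      using nrm_cls_lim[OF cauchy_seqs_closed(1)[OF s(1)]] s by (simp add: cls_smult)
    show "(\<lambda>n. nrm A (d \<odot> s n)) \<longlonglongrightarrow> cmod d * nrm C X"
      using tendsto_mult_left[OF nrm_cls_lim[OF s(1)], of "cmod d"] s c[OF s(1)] by (simp add: nrm_smult)
  qed
  show "nrm C (star C X \<otimes>\<^bsub>C\<^esub> X) = (nrm C X)\<^sup>2"
  proof (rule LIMSEQ_unique)
    show "(\<lambda>n. nrm A (star A (s n) \<otimes> s n)) \<longlonglongrightarrow> nrm C (star C X \<otimes>\<^bsub>C\<^esub> X)"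
      using nrm_cls_lim[OF cauchy_seqs_closed(4)[OF cauchy_seqs_closed(2)[OF s(1)] s(1)]] s
      by (simp add: cls_star cls_mult cauchy_seqs_closed)
    show "(\<lambda>n. nrm A (star A (s n) \<otimes> s n)) \<longlonglongrightarrow> (nrm C X)\<^sup>2"
      using tendsto_power[OF nrm_cls_lim[OF s(1)], of 2] s c[OF s(1)] by (simp add: nrm_cstar)
  qed
  fix Y assume "Y \<in> carrier C"
  then obtain t where t: "t \<in> cauchy_seqs A" "Y = cls t" by (auto simp: carrier_completion)
  show "nrm C (X \<oplus>\<^bsub>C\<^esub> Y) \<le> nrm C X + nrm C Y"
  proof (rule LIMSEQ_le)
    show "(\<lambda>n. nrm A (s n \<oplus> t n)) \<longlonglongrightarrow> nrm C (X \<oplus>\<^bsub>C\<^esub> Y)"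
      using nrm_cls_lim[OF cauchy_seqs_closed(3)[OF s(1) t(1)]] s t by (simp add: cls_add)
    show "(\<lambda>n. nrm A (s n) + nrm A (t n)) \<longlonglongrightarrow> nrm C X + nrm C Y"
      using tendsto_add[OF nrm_cls_lim[OF s(1)] nrm_cls_lim[OF t(1)]] s t by simp
  qed (use c[OF s(1)] c[OF t(1)] in \<open>auto simp: nrm_triangle\<close>)
  show "nrm C (X \<otimes>\<^bsub>C\<^esub> Y) \<le> nrm C X * nrm C Y"
  proof (rule LIMSEQ_le)
    show "(\<lambda>n. nrm A (s n \<otimes> t n)) \<longlonglongrightarrow> nrm C (X \<otimes>\<^bsub>C\<^esub> Y)"
      using nrm_cls_lim[OF cauchy_seqs_closed(4)[OF s(1) t(1)]] s t by (simp add: cls_mult)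
    show "(\<lambda>n. nrm A (s n) * nrm A (t n)) \<longlonglongrightarrow> nrm C X * nrm C Y"
      using tendsto_mult[OF nrm_cls_lim[OF s(1)] nrm_cls_lim[OF t(1)]] s t by simp
  qed (use c[OF s(1)] c[OF t(1)] in \<open>auto simp: nrm_mult\<close>)
qed

text \<open>Not a sublocale: that would iterate the completion forever.\<close>

interpretation Cp: pre_cstar_algebra C
  by (rule pre_cstar_completion)

lemma cls_closed: "s \<in> cauchy_seqs A \<Longrightarrow> cls s \<in> carrier C"
  by (simp add: carrier_completion)

lemma nrm_cls_diff_lim:
  assumes s: "s \<in> cauchy_seqs A" and t: "t \<in> cauchy_seqs A"
  shows "(\<lambda>n. nrm A (s n \<ominus> t n)) \<longlonglongrightarrow> nrm C (cls s \<ominus>\<^bsub>C\<^esub> cls t)"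
proof -
  define u where "u = (\<lambda>n. s n \<oplus> (-1) \<odot> t n)"
  have u: "u \<in> cauchy_seqs A" unfolding u_def by (intro cauchy_seqs_closed s t)
  have "cls u = cls s \<oplus>\<^bsub>C\<^esub> (-1) \<odot>\<^bsub>C\<^esub> cls t"
    unfolding u_def cls_smult[OF t] cls_add[OF s cauchy_seqs_closed(1)[OF t]] ..
  then have "cls u = cls s \<ominus>\<^bsub>C\<^esub> cls t"
    by (simp only: Cp.minus_eq Cp.smult_minus_one[OF cls_closed[OF t]])
  moreover have "u n = s n \<ominus> t n" for n
    using s t by (simp add: u_def minus_eq smult_minus_one cauchy_seqs_carrier)
  ultimately show ?thesis using nrm_cls_lim[OF u] by simp
qed

lemma nrm_to_completion_diff:
  assumes "x \<in> carrier A" "y \<in> carrier A"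
  shows "nrm C (to_completion A x \<ominus>\<^bsub>C\<^esub> to_completion A y) = nrm A (x \<ominus> y)"
  using nrm_cls_diff_lim[OF cauchy_seqs_const[OF assms(1)] cauchy_seqs_const[OF assms(2)]]
  by (simp add: to_completion_eq LIMSEQ_const_iff)

lemma to_completion_dense:
  assumes s: "s \<in> cauchy_seqs A"
  shows "norm_lim C (\<lambda>k. to_completion A (s k)) (cls s)"
  unfolding norm_lim_def
proof (intro conjI allI LIMSEQ_I)
  have k: "(\<lambda>_. s k) \<in> cauchy_seqs A" for k by (intro cauchy_seqs_const cauchy_seqs_carrier s)
  then show "to_completion A (s k) \<in> carrier C" for k by (simp add: to_completion_eq cls_closed)
  show "cls s \<in> carrier C" by (rule cls_closed[OF s])
  fix r :: real assume r: "0 < r"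
  \<comment> \<open>Passing to the limit weakens < to \<le>, so half of r is used to end strictly
    below r.\<close>
  then have "0 < r / 2" by simp
  then obtain N where N: "\<And>m n. m \<ge> N \<Longrightarrow> n \<ge> N \<Longrightarrow> nrm A (s m \<ominus> s n) < r / 2"
    using s unfolding cauchy_seqs_iff by blast
  have upper: "nrm C (cls (\<lambda>_. s k) \<ominus>\<^bsub>C\<^esub> cls s) \<le> r / 2" if "k \<ge> N" for k
    by (rule tendsto_upperbound[OF nrm_cls_diff_lim[OF k s]])
      (use N that in \<open>auto simp: eventually_sequentially less_imp_le intro!: exI[of _ N]\<close>)
  have lower: "0 \<le> nrm C (cls (\<lambda>_. s k) \<ominus>\<^bsub>C\<^esub> cls s)" for k
    by (intro Cp.nrm_nonneg Cp.minus_closed cls_closed \<open>\<And>k. (\<lambda>_. s k) \<in> cauchy_seqs A\<close> s)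
  have "\<bar>nrm C (cls (\<lambda>_. s k) \<ominus>\<^bsub>C\<^esub> cls s)\<bar> < r" if "k \<ge> N" for k
    using upper[OF that] lower[of k] \<open>0 < r / 2\<close> by linarith
  then show "\<exists>N. \<forall>k\<ge>N. norm (nrm C (to_completion A (s k) \<ominus>\<^bsub>C\<^esub> cls s) - 0) < r"
    by (auto simp: to_completion_eq)
qed

text \<open>A point of the closure is represented by any sequence in \<open>S\<close> whose \<open>k\<close>-th term
  is within \<open>1/(k+1)\<close> of it.\<close>

lemma closure_to_completion:
  assumes S: "S \<subseteq> carrier A"
  shows "ctop C closure_of (to_completion A ` S) = {cls s |s. s \<in> cauchy_seqs A \<and> (\<forall>n. s n \<in> S)}"
proof (intro equalityI subsetI)
  fix X assume X: "X \<in> ctop C closure_of (to_completion A ` S)"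
  then have XC: "X \<in> carrier C"
    and appr: "\<And>r. r > 0 \<Longrightarrow> \<exists>x\<in>S. cdist C X (to_completion A x) < r"
    unfolding Cp.Met.metric_closure_of by auto
  have "\<exists>x\<in>S. nrm C (to_completion A x \<ominus>\<^bsub>C\<^esub> X) < 1 / real (Suc k)" for k
  proof -
    obtain x where x: "x \<in> S" "cdist C X (to_completion A x) < 1 / real (Suc k)"
      using appr[of "1 / real (Suc k)"] by auto
    have "to_completion A x \<in> carrier C"
      using x(1) S by (auto simp: to_completion_eq intro!: cls_closed cauchy_seqs_const)
    then show ?thesis using x XC Cp.nrm_minus_commute[of X "to_completion A x"] by (auto simp: cdist_def)
  qed
  then obtain x where x: "\<And>k. x k \<in> S"
    "\<And>k. nrm C (to_completion A (x k) \<ominus>\<^bsub>C\<^esub> X) < 1 / real (Suc k)" by metis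
  have xc: "x k \<in> carrier A" for k using x(1) S by auto
  have tc: "to_completion A (x k) \<in> carrier C" for k
    using xc by (simp add: to_completion_eq cls_closed cauchy_seqs_const)
  have lim: "norm_lim C (\<lambda>k. to_completion A (x k)) X"
    by (rule Cp.norm_limI[OF tc XC less_imp_le[OF x(2)]])
      (use LIMSEQ_inverse_real_of_nat in \<open>simp add: inverse_eq_divide\<close>)
  \<comment> \<open>The embedding into the completion is isometric, so convergence of the images
    makes the sequence itself Cauchy.\<close>
  have "x \<in> cauchy_seqs A"
    unfolding cauchy_seqs_iff
  proof (intro conjI allI impI xc)
    fix e :: real assume e: "e > 0"
    obtain N where N: "\<And>k. k \<ge> N \<Longrightarrow> nrm C (to_completion A (x k) \<ominus>\<^bsub>C\<^esub> X) < e / 2"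
      using LIMSEQ_D[of _ 0 "e / 2"] e lim Cp.nrm_nonneg tc XC unfolding norm_lim_def
      by (metis Cp.minus_closed abs_of_nonneg diff_zero half_gt_zero real_norm_def)
    have "nrm A (x m \<ominus> x n) < e" if "m \<ge> N" "n \<ge> N" for m n
    proof -
      have "to_completion A (x m) \<ominus>\<^bsub>C\<^esub> to_completion A (x n) =
          (to_completion A (x m) \<ominus>\<^bsub>C\<^esub> X) \<ominus>\<^bsub>C\<^esub> (to_completion A (x n) \<ominus>\<^bsub>C\<^esub> X)"
        using tc[of m] tc[of n] XC by algebra
      then show ?thesis
        using N[OF that(1)] N[OF that(2)] nrm_to_completion_diff[OF xc xc, of m n] tc XC
          Cp.nrm_diff_triangle[of "to_completion A (x m) \<ominus>\<^bsub>C\<^esub> X" "to_completion A (x n) \<ominus>\<^bsub>C\<^esub> X"]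
        by simp
    qed
    then show "\<exists>N. \<forall>m\<ge>N. \<forall>n\<ge>N. nrm A (x m \<ominus> x n) < e" by blast
  qed
  moreover from this have "X = cls x" using Cp.norm_lim_unique[OF lim to_completion_dense] by simp
  ultimately show "X \<in> {cls s |s. s \<in> cauchy_seqs A \<and> (\<forall>n. s n \<in> S)}" using x(1) by blast
next
  fix X assume "X \<in> {cls s |s. s \<in> cauchy_seqs A \<and> (\<forall>n. s n \<in> S)}"
  then obtain s where s: "s \<in> cauchy_seqs A" "X = cls s" "\<And>n. s n \<in> S" by blast
  have "limitin (ctop C) (\<lambda>k. to_completion A (s k)) X sequentially"
    using to_completion_dense[OF s(1)] Cp.norm_lim_iff_limitin[of "\<lambda>k. to_completion A (s k)"] s(2)
    by (simp add: norm_lim_def)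
  then show "X \<in> ctop C closure_of (to_completion A ` S)"
    unfolding Cp.Met.limitin_metric Cp.Met.metric_closure_of
    by (auto simp: Cp.Met.commute eventually_sequentially) (meson s(3) order_refl)
qed

end

section \<open>Extension of contractive homomorphisms to the completions\<close>

lemma contractive_hom_continuous:
  assumes "pre_cstar_algebra A" "pre_cstar_algebra B" "h \<in> contractive_hom A B"
  shows "continuous_map (ctop A) (ctop B) h"
proof -
  interpret A: pre_cstar_algebra A by fact
  interpret B: pre_cstar_algebra B by fact
  have h: "h \<in> star_hom A B" and le: "\<And>x. x \<in> carrier A \<Longrightarrow> nrm B (h x) \<le> nrm A x"
    using assms(3) by (auto simp: contractive_hom_def)
  have d: "cdist B (h x) (h y) \<le> cdist A x y" if "x \<in> carrier A" "y \<in> carrier A" for x y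
    using that le[of "x \<ominus>\<^bsub>A\<^esub> y"] star_hom_minus[OF A.star_algebra_axioms B.star_algebra_axioms h that]
    by (simp add: cdist_def star_hom_closed[OF h])
  show ?thesis
    unfolding A.Met.metric_continuous_map[OF B.Metric_space_cdist]
  proof (intro conjI ballI allI impI)
    show "h ` carrier A \<subseteq> carrier B" using star_hom_closed[OF h] by auto
    fix a and e :: real assume "a \<in> carrier A" "0 < e"
    then show "\<exists>\<delta>>0. \<forall>x. x \<in> carrier A \<and> cdist A a x < \<delta> \<longrightarrow> cdist B (h a) (h x) < e"
      using d by (intro exI[of _ e]) (auto intro: le_less_trans)
  qed
qed

locale completion_hom = A: pre_cstar_algebra A + B: pre_cstar_algebra B
  for A (structure) and B (structure) +
  fixes h
  assumes contr: "h \<in> contractive_hom A B"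
begin

interpretation CA: pre_cstar_algebra "completion A"
  by (rule A.pre_cstar_completion)

interpretation CB: pre_cstar_algebra "completion B"
  by (rule B.pre_cstar_completion)

lemma hom: "h \<in> star_hom A B" and nrm_le: "x \<in> carrier A \<Longrightarrow> nrm B (h x) \<le> nrm A x"
  using contr by (auto simp: contractive_hom_def)

lemmas hom_simps = star_hom_simps[OF hom]

lemma nrm_diff_le:
  assumes "x \<in> carrier A" "y \<in> carrier A"
  shows "nrm B (h x \<ominus>\<^bsub>B\<^esub> h y) \<le> nrm A (x \<ominus> y)"
  using assms nrm_le[of "x \<ominus> y"] star_hom_minus[OF A.star_algebra_axioms B.star_algebra_axioms hom assms] by simp

lemma cauchy_image:
  assumes s: "s \<in> cauchy_seqs A"
  shows "(\<lambda>n. h (s n)) \<in> cauchy_seqs B"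
  unfolding B.cauchy_seqs_iff
proof (intro conjI allI impI)
  note c = A.cauchy_seqs_carrier[OF s]
  show "h (s n) \<in> carrier B" for n using c by (simp add: hom_simps)
  fix e :: real assume "0 < e"
  then obtain N where "\<And>m n. m \<ge> N \<Longrightarrow> n \<ge> N \<Longrightarrow> nrm A (s m \<ominus> s n) < e"
    using s unfolding A.cauchy_seqs_iff by blast
  then show "\<exists>N. \<forall>m\<ge>N. \<forall>n\<ge>N. nrm B (h (s m) \<ominus>\<^bsub>B\<^esub> h (s n)) < e"
    using le_less_trans[OF nrm_diff_le[OF c c]] by blast
qed

lemma cauchy_rel_image:
  assumes st: "(s, t) \<in> cauchy_rel A"
  shows "(\<lambda>n. h (s n), \<lambda>n. h (t n)) \<in> cauchy_rel B"
proof -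
  have s: "s \<in> cauchy_seqs A" "t \<in> cauchy_seqs A" and lim: "(\<lambda>n. nrm A (s n \<ominus> t n)) \<longlonglongrightarrow> 0"
    using st by (auto simp: A.cauchy_rel_iff)
  note c = A.cauchy_seqs_carrier[OF s(1)] A.cauchy_seqs_carrier[OF s(2)]
  have "norm (nrm B (h (s n) \<ominus>\<^bsub>B\<^esub> h (t n))) \<le> nrm A (s n \<ominus> t n)" for n
    using nrm_diff_le[OF c] c by (simp add: B.nrm_nonneg hom_simps)
  then have "(\<lambda>n. nrm B (h (s n) \<ominus>\<^bsub>B\<^esub> h (t n))) \<longlonglongrightarrow> 0"
    by (intro Lim_null_comparison[OF always_eventually lim]) blast
  then show ?thesis using cauchy_image s by (simp add: B.cauchy_rel_iff)
qed

text \<open>A representative is chosen in each class; the restriction to the carrier meets the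
  extensionality condition in \<open>completion_map\<close>.\<close>

definition extension :: "(nat \<Rightarrow> 'a) set \<Rightarrow> (nat \<Rightarrow> 'c) set" where
  "extension = (\<lambda>X\<in>carrier (completion A). cauchy_class B (\<lambda>n. h ((SOME s. s \<in> X) n)))"

lemma extension_cls:
  assumes s: "s \<in> cauchy_seqs A"
  shows "extension (cauchy_class A s) = cauchy_class B (\<lambda>n. h (s n))"
proof -
  have "(SOME t. t \<in> cauchy_class A s) \<in> cauchy_class A s"
    using someI[of "\<lambda>t. t \<in> cauchy_class A s", OF A.cls_refl[OF s]] .
  then have "(s, SOME t. t \<in> cauchy_class A s) \<in> cauchy_rel A" by (simp add: A.mem_cls)
  then show ?thesis
    using B.cls_eqI[OF cauchy_rel_image] A.cls_closed[OF s] by (simp add: extension_def)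
qed

lemma extension_contractive: "extension \<in> contractive_hom (completion A) (completion B)"
proof -
  have "extension \<in> star_hom (completion A) (completion B)"
  proof (rule star_homI)
    fix X assume "X \<in> carrier (completion A)"
    then obtain s where s: "s \<in> cauchy_seqs A" "X = cauchy_class A s" by (auto simp: A.carrier_completion)
    note c = A.cauchy_seqs_carrier[OF s(1)]
    show "extension X \<in> carrier (completion B)"
      using s cauchy_image by (simp add: extension_cls B.cls_closed)
    show "extension (c \<odot>\<^bsub>completion A\<^esub> X) = c \<odot>\<^bsub>completion B\<^esub> extension X" for c
      using s c cauchy_image by (simp add: extension_cls A.cls_smult B.cls_smult A.cauchy_seqs_closed hom_simps)
    show "extension (star (completion A) X) = star (completion B) (extension X)"
      using s c cauchy_image by (simp add: extension_cls A.cls_star B.cls_star A.cauchy_seqs_closed hom_simps)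
    fix Y assume "Y \<in> carrier (completion A)"
    then obtain t where t: "t \<in> cauchy_seqs A" "Y = cauchy_class A t" by (auto simp: A.carrier_completion)
    note d = A.cauchy_seqs_carrier[OF t(1)]
    show "extension (X \<oplus>\<^bsub>completion A\<^esub> Y) = extension X \<oplus>\<^bsub>completion B\<^esub> extension Y"
      using s t c d cauchy_image by (simp add: extension_cls A.cls_add B.cls_add A.cauchy_seqs_closed hom_simps)
    show "extension (X \<otimes>\<^bsub>completion A\<^esub> Y) = extension X \<otimes>\<^bsub>completion B\<^esub> extension Y"
      using s t c d cauchy_image by (simp add: extension_cls A.cls_mult B.cls_mult A.cauchy_seqs_closed hom_simps)
  qed
  moreover have "nrm (completion B) (extension X) \<le> nrm (completion A) X" if X: "X \<in> carrier (completion A)" for X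
  proof -
    obtain s where s: "s \<in> cauchy_seqs A" "X = cauchy_class A s" using X by (auto simp: A.carrier_completion)
    show ?thesis
      unfolding s(2) extension_cls[OF s(1)]
      by (rule LIMSEQ_le[OF B.nrm_cls_lim[OF cauchy_image[OF s(1)]] A.nrm_cls_lim[OF s(1)]])
        (use A.cauchy_seqs_carrier[OF s(1)] nrm_le in blast)
  qed
  ultimately show ?thesis by (simp add: contractive_hom_def)
qed

text \<open>A continuous map is determined by its values on embedded elements, because the class of
  s is the limit of the embedded terms s k.\<close>

lemma completion_map_eq: "completion_map A B h = extension"
  unfolding completion_map_def
proof (rule the_equality)
  have to: "to_completion A x \<in> carrier (completion A)" if "x \<in> carrier A" for x
    using that by (simp add: A.to_completion_eq A.cls_closed A.cauchy_seqs_const)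
  have cont: "continuous_map (ctop (completion A)) (ctop (completion B)) extension"
    by (rule contractive_hom_continuous[OF CA.pre_cstar_algebra_axioms CB.pre_cstar_algebra_axioms extension_contractive])
  have ext: "extension (to_completion A x) = to_completion B (h x)" if "x \<in> carrier A" for x
    using that by (simp add: A.to_completion_eq B.to_completion_eq extension_cls A.cauchy_seqs_const)
  show "extension \<in> extensional (carrier (completion A)) \<and>
    continuous_map (ctop (completion A)) (ctop (completion B)) extension \<and>
    (\<forall>x\<in>carrier A. extension (to_completion A x) = to_completion B (h x))"
    using cont ext by (simp add: extension_def)
  fix g assume g: "g \<in> extensional (carrier (completion A)) \<and>
    continuous_map (ctop (completion A)) (ctop (completion B)) g \<and>
    (\<forall>x\<in>carrier A. g (to_completion A x) = to_completion B (h x))"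
  show "g = extension"
  proof (rule extensionalityI)
    show "g \<in> extensional (carrier (completion A))" "extension \<in> extensional (carrier (completion A))"
      using g by (simp_all add: extension_def)
    fix X assume "X \<in> carrier (completion A)"
    then obtain s where s: "s \<in> cauchy_seqs A" "X = cauchy_class A s" by (auto simp: A.carrier_completion)
    note c = A.cauchy_seqs_carrier[OF s(1)]
    have lim: "limitin (ctop (completion A)) (\<lambda>k. to_completion A (s k)) X sequentially"
      using A.to_completion_dense[OF s(1)] CA.norm_lim_iff_limitin[of "\<lambda>k. to_completion A (s k)"] s(2) to[OF c]
      by simp
    have "g \<circ> (\<lambda>k. to_completion A (s k)) = extension \<circ> (\<lambda>k. to_completion A (s k))"
      using g ext c by auto
    then have "limitin (ctop (completion B)) (extension \<circ> (\<lambda>k. to_completion A (s k))) (g X) sequentially"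
      using continuous_map_limit[OF _ lim, of "ctop (completion B)" g] g by simp
    then show "g X = extension X"
      using CB.Met.limitin_metric_unique[OF _ continuous_map_limit[OF cont lim] trivial_limit_sequentially] by blast
  qed
qed

lemma completion_map_contractive: "completion_map A B h \<in> contractive_hom (completion A) (completion B)"
  unfolding completion_map_eq by (rule extension_contractive)

lemma completion_map_cls: "s \<in> cauchy_seqs A \<Longrightarrow> completion_map A B h (cauchy_class A s) = cauchy_class B (\<lambda>n. h (s n))"
  unfolding completion_map_eq by (rule extension_cls)

lemma completion_map_isometric:
  assumes "h \<in> isometric_hom A B"
  shows "completion_map A B h \<in> isometric_hom (completion A) (completion B)"
proof -
  have "nrm (completion B) (completion_map A B h X) = nrm (completion A) X" if X: "X \<in> carrier (completion A)" for X
  proof -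
    obtain s where s: "s \<in> cauchy_seqs A" "X = cauchy_class A s" using X by (auto simp: A.carrier_completion)
    have "(\<lambda>n. nrm B (h (s n))) = (\<lambda>n. nrm A (s n))"
      using assms A.cauchy_seqs_carrier[OF s(1)] by (auto simp: isometric_hom_def)
    then show ?thesis
      using B.nrm_cls_lim[OF cauchy_image[OF s(1)]] A.nrm_cls_lim[OF s(1)] LIMSEQ_unique
      by (simp add: s(2) completion_map_cls[OF s(1)])
  qed
  then show ?thesis using completion_map_contractive by (simp add: isometric_hom_def contractive_hom_def)
qed

text \<open>For surjectivity a Cauchy sequence is lifted term by term, and the isometry makes the
  lift Cauchy.\<close>

lemma completion_map_iso:
  assumes iso: "h \<in> isometric_hom A B" and onto: "h ` carrier A = carrier B"
  shows "completion_map A B h \<in> star_iso (completion A) (completion B)"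
proof -
  have f: "completion_map A B h \<in> isometric_hom (completion A) (completion B)"
    by (rule completion_map_isometric[OF iso])
  then have fh: "completion_map A B h \<in> star_hom (completion A) (completion B)" by (simp add: isometric_hom_def)
  have "inj_on (completion_map A B h) (carrier (completion A))"
  proof (rule inj_onI)
    fix X Y assume X: "X \<in> carrier (completion A)" and Y: "Y \<in> carrier (completion A)"
      and eq: "completion_map A B h X = completion_map A B h Y"
    have "completion_map A B h (X \<ominus>\<^bsub>completion A\<^esub> Y) = \<zero>\<^bsub>completion B\<^esub>"
      using star_hom_minus[OF CA.star_algebra_axioms CB.star_algebra_axioms fh X Y] eq star_hom_closed[OF fh Y]
      by (simp add: CB.minus_eq CB.r_neg)
    moreover have "nrm (completion B) (completion_map A B h (X \<ominus>\<^bsub>completion A\<^esub> Y)) =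
        nrm (completion A) (X \<ominus>\<^bsub>completion A\<^esub> Y)" using f X Y by (simp add: isometric_hom_def)
    ultimately show "X = Y"
      using X Y CA.nrm_eq_0[of "X \<ominus>\<^bsub>completion A\<^esub> Y"] CA.minus_eq_zero_iff by (simp add: CB.seminorm_zero)
  qed
  moreover have "Y \<in> completion_map A B h ` carrier (completion A)" if Y: "Y \<in> carrier (completion B)" for Y
  proof -
    obtain t where t: "t \<in> cauchy_seqs B" "Y = cauchy_class B t" using Y by (auto simp: B.carrier_completion)
    have "\<forall>n. \<exists>x\<in>carrier A. h x = t n" using onto B.cauchy_seqs_carrier[OF t(1)] by (metis imageE)
    then obtain s where s: "\<And>n. s n \<in> carrier A" "\<And>n. h (s n) = t n" by metis
    have "nrm A (s m \<ominus> s n) = nrm B (t m \<ominus>\<^bsub>B\<^esub> t n)" for m n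
    proof -
      have "nrm B (h (s m \<ominus> s n)) = nrm A (s m \<ominus> s n)"
        using iso s(1) by (simp add: isometric_hom_def)
      then show ?thesis
        using star_hom_minus[OF A.star_algebra_axioms B.star_algebra_axioms hom, of "s m" "s n"] s by simp
    qed
    then have sc: "s \<in> cauchy_seqs A" using t(1) s(1) by (simp add: A.cauchy_seqs_iff B.cauchy_seqs_iff)
    have "completion_map A B h (cauchy_class A s) = Y"
      using completion_map_cls[OF sc] by (simp add: s(2) t(2))
    then show ?thesis using A.cls_closed[OF sc] by blast
  qed
  ultimately show ?thesis
    using fh star_hom_closed[OF fh] by (auto simp: star_iso_def bij_betw_def)
qed

end

section \<open>Direct sums\<close>

lemma direct_sum_simps:
  "carrier (A \<oplus>\<^sub>* B) = carrier A \<times> carrier B"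
  "(x, y) \<otimes>\<^bsub>A \<oplus>\<^sub>* B\<^esub> (x', y') = (x \<otimes>\<^bsub>A\<^esub> x', y \<otimes>\<^bsub>B\<^esub> y')"
  "\<zero>\<^bsub>A \<oplus>\<^sub>* B\<^esub> = (\<zero>\<^bsub>A\<^esub>, \<zero>\<^bsub>B\<^esub>)"
  "(x, y) \<oplus>\<^bsub>A \<oplus>\<^sub>* B\<^esub> (x', y') = (x \<oplus>\<^bsub>A\<^esub> x', y \<oplus>\<^bsub>B\<^esub> y')"
  "c \<odot>\<^bsub>A \<oplus>\<^sub>* B\<^esub> (x, y) = (c \<odot>\<^bsub>A\<^esub> x, c \<odot>\<^bsub>B\<^esub> y)"
  "star (A \<oplus>\<^sub>* B) (x, y) = (star A x, star B y)"
  "nrm (A \<oplus>\<^sub>* B) (x, y) = max (nrm A x) (nrm B y)"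
  by (simp_all add: direct_sum_def)

lemma direct_sum_projections:
  "fst \<in> star_hom (A \<oplus>\<^sub>* B) A" "snd \<in> star_hom (A \<oplus>\<^sub>* B) B"
  by (rule star_homI; auto simp: direct_sum_simps)+

lemma star_algebra_direct_sum:
  assumes "star_algebra A" "star_algebra B"
  shows "star_algebra (A \<oplus>\<^sub>* B)"
proof -
  interpret A: star_algebra A by fact
  interpret B: star_algebra B by fact
  have "abelian_group (A \<oplus>\<^sub>* B)"
  proof (rule abelian_groupI)
    fix p assume "p \<in> carrier (A \<oplus>\<^sub>* B)"
    then show "\<exists>q\<in>carrier (A \<oplus>\<^sub>* B). q \<oplus>\<^bsub>A \<oplus>\<^sub>* B\<^esub> p = \<zero>\<^bsub>A \<oplus>\<^sub>* B\<^esub>"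
      by (intro bexI[of _ "(\<ominus>\<^bsub>A\<^esub> fst p, \<ominus>\<^bsub>B\<^esub> snd p)"]) (auto simp: direct_sum_simps A.l_neg B.l_neg)
  qed (auto simp: direct_sum_simps A.a_ac B.a_ac)
  then show ?thesis
    by (intro star_algebra.intro star_algebra_axioms.intro)
      (auto simp: direct_sum_simps A.m_assoc A.l_distr A.r_distr A.smult_l_distr A.smult_r_distr A.smult_assoc1
        A.smult_one A.smult_mult_left A.smult_mult_right A.star_star A.star_add A.star_mult A.star_smult
        B.m_assoc B.l_distr B.r_distr B.smult_l_distr B.smult_r_distr B.smult_assoc1
        B.smult_one B.smult_mult_left B.smult_mult_right B.star_star B.star_add B.star_mult B.star_smult)
qed

text \<open>Subtraction is derived from addition and negatives and is not a record field, so it is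
  computed through the two projections.\<close>

lemma direct_sum_minus:
  assumes "star_algebra A" "star_algebra B" "p \<in> carrier (A \<oplus>\<^sub>* B)" "q \<in> carrier (A \<oplus>\<^sub>* B)"
  shows "p \<ominus>\<^bsub>A \<oplus>\<^sub>* B\<^esub> q = (fst p \<ominus>\<^bsub>A\<^esub> fst q, snd p \<ominus>\<^bsub>B\<^esub> snd q)"
  using star_hom_minus[OF star_algebra_direct_sum[OF assms(1,2)] assms(1) direct_sum_projections(1) assms(3,4)]
    star_hom_minus[OF star_algebra_direct_sum[OF assms(1,2)] assms(2) direct_sum_projections(2) assms(3,4)]
  by (metis prod.collapse)

lemma pre_cstar_direct_sum:
  assumes "pre_cstar_algebra A" "pre_cstar_algebra B"
  shows "pre_cstar_algebra (A \<oplus>\<^sub>* B)"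
proof -
  interpret A: pre_cstar_algebra A by fact
  interpret B: pre_cstar_algebra B by fact
  have sq: "max (r\<^sup>2) (q\<^sup>2) = (max r q)\<^sup>2" if "0 \<le> r" "0 \<le> q" for r q :: real
    using that by (auto simp: max_def power2_le_iff_abs_le)
  show ?thesis
  proof (intro pre_cstar_algebra.intro pre_cstar_algebra_axioms.intro
      star_algebra_direct_sum[OF A.star_algebra_axioms B.star_algebra_axioms])
    fix p assume "p \<in> carrier (A \<oplus>\<^sub>* B)"
    then obtain x y where p: "p = (x, y)" and x: "x \<in> carrier A" and y: "y \<in> carrier B"
      by (auto simp: direct_sum_simps)
    note nn = A.nrm_nonneg[OF x] B.nrm_nonneg[OF y]
    show "0 \<le> nrm (A \<oplus>\<^sub>* B) p" using nn by (simp add: p direct_sum_simps)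
    show "nrm (A \<oplus>\<^sub>* B) p = 0 \<longleftrightarrow> p = \<zero>\<^bsub>A \<oplus>\<^sub>* B\<^esub>"
      using nn A.nrm_eq_0[OF x] B.nrm_eq_0[OF y] by (auto simp: p direct_sum_simps max_def)
    show "nrm (A \<oplus>\<^sub>* B) (c \<odot>\<^bsub>A \<oplus>\<^sub>* B\<^esub> p) = cmod c * nrm (A \<oplus>\<^sub>* B) p" for c
      using x y by (simp add: p direct_sum_simps A.nrm_smult B.nrm_smult max_mult_distrib_left)
    show "nrm (A \<oplus>\<^sub>* B) (star (A \<oplus>\<^sub>* B) p \<otimes>\<^bsub>A \<oplus>\<^sub>* B\<^esub> p) = (nrm (A \<oplus>\<^sub>* B) p)\<^sup>2"
      using x y nn by (simp add: p direct_sum_simps A.nrm_cstar B.nrm_cstar sq)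
    fix q assume "q \<in> carrier (A \<oplus>\<^sub>* B)"
    then obtain x' y' where q: "q = (x', y')" and x': "x' \<in> carrier A" and y': "y' \<in> carrier B"
      by (auto simp: direct_sum_simps)
    note nn' = A.nrm_nonneg[OF x'] B.nrm_nonneg[OF y']
    show "nrm (A \<oplus>\<^sub>* B) (p \<oplus>\<^bsub>A \<oplus>\<^sub>* B\<^esub> q) \<le> nrm (A \<oplus>\<^sub>* B) p + nrm (A \<oplus>\<^sub>* B) q"
      using A.nrm_triangle[OF x x'] B.nrm_triangle[OF y y'] by (simp add: p q direct_sum_simps max_def)
    have "nrm A x * nrm A x' \<le> max (nrm A x) (nrm B y) * max (nrm A x') (nrm B y')"
      "nrm B y * nrm B y' \<le> max (nrm A x) (nrm B y) * max (nrm A x') (nrm B y')"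
      using nn nn' by (intro mult_mono; simp add: le_max_iff_disj)+
    then show "nrm (A \<oplus>\<^sub>* B) (p \<otimes>\<^bsub>A \<oplus>\<^sub>* B\<^esub> q) \<le> nrm (A \<oplus>\<^sub>* B) p * nrm (A \<oplus>\<^sub>* B) q"
      using A.nrm_mult[OF x x'] B.nrm_mult[OF y y'] by (simp add: p q direct_sum_simps)
  qed
qed

lemma cstar_direct_sum:
  assumes "cstar_algebra A" "cstar_algebra B"
  shows "cstar_algebra (A \<oplus>\<^sub>* B)"
proof -
  interpret A: cstar_algebra A by fact
  interpret B: cstar_algebra B by fact
  interpret S: pre_cstar_algebra "A \<oplus>\<^sub>* B"
    by (rule pre_cstar_direct_sum[OF A.pre_cstar_algebra_axioms B.pre_cstar_algebra_axioms])
  note minus = direct_sum_minus[OF A.star_algebra_axioms B.star_algebra_axioms]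
  have "\<exists>L. limitin (ctop (A \<oplus>\<^sub>* B)) s L sequentially" if s: "S.Met.MCauchy s" for s
  proof -
    have c: "s n \<in> carrier (A \<oplus>\<^sub>* B)" for n using s by (simp add: S.MCauchy_iff)
    have c': "fst (s n) \<in> carrier A" "snd (s n) \<in> carrier B" for n
      using c[of n] by (simp_all add: direct_sum_simps(1) mem_Times_iff)
    have nrm: "nrm (A \<oplus>\<^sub>* B) (s m \<ominus>\<^bsub>A \<oplus>\<^sub>* B\<^esub> s n) =
        max (nrm A (fst (s m) \<ominus>\<^bsub>A\<^esub> fst (s n))) (nrm B (snd (s m) \<ominus>\<^bsub>B\<^esub> snd (s n)))" for m n
      by (simp add: minus[OF c c] direct_sum_simps)
    have "A.Met.MCauchy (\<lambda>n. fst (s n))" "B.Met.MCauchy (\<lambda>n. snd (s n))"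
    proof -
      have *: "\<forall>e>0. \<exists>N. \<forall>m\<ge>N. \<forall>n\<ge>N. nrm A (fst (s m) \<ominus>\<^bsub>A\<^esub> fst (s n)) < e \<and>
          nrm B (snd (s m) \<ominus>\<^bsub>B\<^esub> snd (s n)) < e"
        using s unfolding S.MCauchy_iff nrm max_less_iff_conj by (rule conjunct2)
      show "A.Met.MCauchy (\<lambda>n. fst (s n))" unfolding A.MCauchy_iff using * c' by meson
      show "B.Met.MCauchy (\<lambda>n. snd (s n))" unfolding B.MCauchy_iff using * c' by meson
    qed
    then obtain x y where xy: "norm_lim A (\<lambda>n. fst (s n)) x" "norm_lim B (\<lambda>n. snd (s n)) y"
      using A.complete B.complete c' A.norm_lim_iff_limitin[of "\<lambda>n. fst (s n)"]
        B.norm_lim_iff_limitin[of "\<lambda>n. snd (s n)"]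
      unfolding A.Met.mcomplete_def B.Met.mcomplete_def by blast
    have L: "(x, y) \<in> carrier (A \<oplus>\<^sub>* B)" using xy by (simp add: direct_sum_simps norm_lim_def)
    have "norm_lim (A \<oplus>\<^sub>* B) s (x, y)"
    proof (rule S.norm_limI[OF c L])
      show "nrm (A \<oplus>\<^sub>* B) (s n \<ominus>\<^bsub>A \<oplus>\<^sub>* B\<^esub> (x, y)) \<le> nrm A (fst (s n) \<ominus>\<^bsub>A\<^esub> x) + nrm B (snd (s n) \<ominus>\<^bsub>B\<^esub> y)" for n
        using xy c' A.nrm_nonneg[of "fst (s n) \<ominus>\<^bsub>A\<^esub> x"] B.nrm_nonneg[of "snd (s n) \<ominus>\<^bsub>B\<^esub> y"]
        by (simp add: minus[OF c L] direct_sum_simps norm_lim_def)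
      show "(\<lambda>n. nrm A (fst (s n) \<ominus>\<^bsub>A\<^esub> x) + nrm B (snd (s n) \<ominus>\<^bsub>B\<^esub> y)) \<longlonglongrightarrow> 0"
        using xy tendsto_add[of _ 0 _ _ 0] by (auto simp: norm_lim_def)
    qed
    then show ?thesis using S.norm_lim_iff_limitin[of s] c by blast
  qed
  then have "S.Met.mcomplete" by (simp add: S.Met.mcomplete_def)
  then show ?thesis by (intro cstar_algebra.intro cstar_algebra_axioms.intro S.pre_cstar_algebra_axioms)
qed

text \<open>\<open>P\<close> is, up to isomorphism, the direct sum of \<open>A\<close> and \<open>B\<close>, with projections \<open>f\<close> and \<open>g\<close>.\<close>

locale direct_sum_decomposition = P: pre_cstar_algebra P + A: pre_cstar_algebra A + B: pre_cstar_algebra B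
  for P and A and B +
  fixes f g
  assumes f: "f \<in> contractive_hom P A" and g: "g \<in> contractive_hom P B"
    and nrm_le_max: "x \<in> carrier P \<Longrightarrow> nrm P x \<le> max (nrm A (f x)) (nrm B (g x))"
    and onto: "\<lbrakk>y \<in> carrier A; z \<in> carrier B\<rbrakk> \<Longrightarrow> \<exists>x\<in>carrier P. f x = y \<and> g x = z"
begin

sublocale F: completion_hom P A f
  by unfold_locales (rule f)

sublocale G: completion_hom P B g
  by unfold_locales (rule g)

interpretation CP: pre_cstar_algebra "completion P"
  by (rule P.pre_cstar_completion)

interpretation CA: pre_cstar_algebra "completion A"
  by (rule A.pre_cstar_completion)

interpretation CB: pre_cstar_algebra "completion B"
  by (rule B.pre_cstar_completion)

definition split_completion :: "(nat \<Rightarrow> 'a) set \<Rightarrow> (nat \<Rightarrow> 'c) set \<times> (nat \<Rightarrow> 'e) set" where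
  "split_completion X = (completion_map P A f X, completion_map P B g X)"

lemma split_completion_cls:
  "s \<in> cauchy_seqs P \<Longrightarrow>
    split_completion (cauchy_class P s) = (cauchy_class A (\<lambda>n. f (s n)), cauchy_class B (\<lambda>n. g (s n)))"
  by (simp add: split_completion_def F.completion_map_cls G.completion_map_cls)

text \<open>Any termwise lift is Cauchy, because a difference in \<open>P\<close> is bounded by the
  larger of its two projections.\<close>

lemma cauchy_seq_lift:
  assumes s: "s \<in> cauchy_seqs A" and t: "t \<in> cauchy_seqs B"
  shows "\<exists>u\<in>cauchy_seqs P. (\<forall>n. f (u n) = s n) \<and> (\<forall>n. g (u n) = t n)"
proof -
  have "\<forall>n. \<exists>x\<in>carrier P. f x = s n \<and> g x = t n"
    using onto[OF A.cauchy_seqs_carrier[OF s] B.cauchy_seqs_carrier[OF t]] by blast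
  then obtain u where u: "\<And>n. u n \<in> carrier P" "\<And>n. f (u n) = s n" "\<And>n. g (u n) = t n" by metis
  have "u \<in> cauchy_seqs P"
    unfolding P.cauchy_seqs_iff
  proof (intro conjI allI impI u)
    fix e :: real assume e: "0 < e"
    obtain M where M: "\<And>m n. m \<ge> M \<Longrightarrow> n \<ge> M \<Longrightarrow> nrm A (s m \<ominus>\<^bsub>A\<^esub> s n) < e"
      using s e unfolding A.cauchy_seqs_iff by blast
    obtain N where N: "\<And>m n. m \<ge> N \<Longrightarrow> n \<ge> N \<Longrightarrow> nrm B (t m \<ominus>\<^bsub>B\<^esub> t n) < e"
      using t e unfolding B.cauchy_seqs_iff by blast
    have "nrm P (u m \<ominus>\<^bsub>P\<^esub> u n) < e" if "m \<ge> max M N" "n \<ge> max M N" for m n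
    proof -
      have "f (u m \<ominus>\<^bsub>P\<^esub> u n) = s m \<ominus>\<^bsub>A\<^esub> s n" "g (u m \<ominus>\<^bsub>P\<^esub> u n) = t m \<ominus>\<^bsub>B\<^esub> t n"
        using star_hom_minus[OF P.star_algebra_axioms A.star_algebra_axioms F.hom, of "u m" "u n"]
          star_hom_minus[OF P.star_algebra_axioms B.star_algebra_axioms G.hom, of "u m" "u n"] u by simp_all
      then show ?thesis using nrm_le_max[of "u m \<ominus>\<^bsub>P\<^esub> u n"] u(1) M[of m n] N[of m n] that by simp
    qed
    then show "\<exists>N. \<forall>m\<ge>N. \<forall>n\<ge>N. nrm P (u m \<ominus>\<^bsub>P\<^esub> u n) < e" by blast
  qed
  then show ?thesis using u by blast
qed

lemma split_completion_iso: "split_completion \<in> star_iso (completion P) (completion A \<oplus>\<^sub>* completion B)"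
proof -
  have Fh: "completion_map P A f \<in> star_hom (completion P) (completion A)"
    and Gh: "completion_map P B g \<in> star_hom (completion P) (completion B)"
    using F.completion_map_contractive G.completion_map_contractive by (auto simp: contractive_hom_def)
  have h: "split_completion \<in> star_hom (completion P) (completion A \<oplus>\<^sub>* completion B)"
    by (rule star_homI) (simp_all add: split_completion_def direct_sum_simps star_hom_simps[OF Fh] star_hom_simps[OF Gh])
  have eq: "X = Y" if X: "X \<in> carrier (completion P)" and Y: "Y \<in> carrier (completion P)"
    and XY: "split_completion X = split_completion Y" for X Y
  proof -
    obtain s where s: "s \<in> cauchy_seqs P" "X = cauchy_class P s" using X by (auto simp: P.carrier_completion)
    obtain t where t: "t \<in> cauchy_seqs P" "Y = cauchy_class P t" using Y by (auto simp: P.carrier_completion)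
    have "(\<lambda>n. f (s n), \<lambda>n. f (t n)) \<in> cauchy_rel A" "(\<lambda>n. g (s n), \<lambda>n. g (t n)) \<in> cauchy_rel B"
      using XY s t by (simp_all add: split_completion_cls A.cls_eq_iff B.cls_eq_iff F.cauchy_image G.cauchy_image)
    then have lim: "(\<lambda>n. nrm A (f (s n) \<ominus>\<^bsub>A\<^esub> f (t n))) \<longlonglongrightarrow> 0" "(\<lambda>n. nrm B (g (s n) \<ominus>\<^bsub>B\<^esub> g (t n))) \<longlonglongrightarrow> 0"
      by (simp_all add: A.cauchy_rel_iff B.cauchy_rel_iff)
    have lim2: "(\<lambda>n. max (nrm A (f (s n) \<ominus>\<^bsub>A\<^esub> f (t n))) (nrm B (g (s n) \<ominus>\<^bsub>B\<^esub> g (t n)))) \<longlonglongrightarrow> 0"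
      using tendsto_max[OF lim] by simp
    note c = P.cauchy_seqs_carrier[OF s(1)] P.cauchy_seqs_carrier[OF t(1)]
    have "norm (nrm P (s n \<ominus>\<^bsub>P\<^esub> t n)) \<le> max (nrm A (f (s n) \<ominus>\<^bsub>A\<^esub> f (t n))) (nrm B (g (s n) \<ominus>\<^bsub>B\<^esub> g (t n)))" for n
      using nrm_le_max[of "s n \<ominus>\<^bsub>P\<^esub> t n"] c P.nrm_nonneg[of "s n \<ominus>\<^bsub>P\<^esub> t n"]
        star_hom_minus[OF P.star_algebra_axioms A.star_algebra_axioms F.hom, of "s n" "t n"]
        star_hom_minus[OF P.star_algebra_axioms B.star_algebra_axioms G.hom, of "s n" "t n"] by simp
    then have "(\<lambda>n. nrm P (s n \<ominus>\<^bsub>P\<^esub> t n)) \<longlonglongrightarrow> 0"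
      by (intro Lim_null_comparison[OF always_eventually lim2]) blast
    then show ?thesis using s t by (simp add: P.cls_eq_iff P.cauchy_rel_iff)
  qed
  have "Z \<in> split_completion ` carrier (completion P)" if Z: "Z \<in> carrier (completion A \<oplus>\<^sub>* completion B)" for Z
  proof -
    obtain s t where st: "s \<in> cauchy_seqs A" "t \<in> cauchy_seqs B" "Z = (cauchy_class A s, cauchy_class B t)"
      using Z by (auto simp: direct_sum_simps A.carrier_completion B.carrier_completion)
    obtain u where u: "u \<in> cauchy_seqs P" "\<And>n. f (u n) = s n" "\<And>n. g (u n) = t n"
      using cauchy_seq_lift[OF st(1,2)] by blast
    then have "Z = split_completion (cauchy_class P u)" using st(3) by (simp add: split_completion_cls)
    then show ?thesis using P.cls_closed[OF u(1)] by blast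
  qed
  then show ?thesis
    using h eq star_hom_closed[OF h] by (auto simp: star_iso_def bij_betw_def inj_on_def)
qed

text \<open>\<open>closure_to_completion\<close> describes the closures by Cauchy sequences in the
  sets, so it remains to project such sequences and to lift pairs of them.\<close>

lemma split_completion_closure:
  assumes "S \<subseteq> carrier P" "S1 \<subseteq> carrier A" "S2 \<subseteq> carrier B"
    and S: "\<And>x. x \<in> carrier P \<Longrightarrow> x \<in> S \<longleftrightarrow> f x \<in> S1 \<and> g x \<in> S2"
  shows "split_completion ` (ctop (completion P) closure_of (to_completion P ` S)) =
    (ctop (completion A) closure_of (to_completion A ` S1)) \<times> (ctop (completion B) closure_of (to_completion B ` S2))"
  unfolding P.closure_to_completion[OF assms(1)] A.closure_to_completion[OF assms(2)] B.closure_to_completion[OF assms(3)]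
proof (intro equalityI subsetI)
  fix Z assume "Z \<in> split_completion ` {cauchy_class P s |s. s \<in> cauchy_seqs P \<and> (\<forall>n. s n \<in> S)}"
  then obtain s where s: "s \<in> cauchy_seqs P" "\<And>n. s n \<in> S" "Z = split_completion (cauchy_class P s)" by blast
  have "f (s n) \<in> S1" "g (s n) \<in> S2" for n using s S P.cauchy_seqs_carrier by blast+
  then show "Z \<in> {cauchy_class A s |s. s \<in> cauchy_seqs A \<and> (\<forall>n. s n \<in> S1)} \<times>
      {cauchy_class B s |s. s \<in> cauchy_seqs B \<and> (\<forall>n. s n \<in> S2)}"
    using s F.cauchy_image[OF s(1)] G.cauchy_image[OF s(1)] by (auto simp: split_completion_cls)
next
  fix Z assume "Z \<in> {cauchy_class A s |s. s \<in> cauchy_seqs A \<and> (\<forall>n. s n \<in> S1)} \<times>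
      {cauchy_class B s |s. s \<in> cauchy_seqs B \<and> (\<forall>n. s n \<in> S2)}"
  then obtain s t where st: "s \<in> cauchy_seqs A" "t \<in> cauchy_seqs B" "\<And>n. s n \<in> S1" "\<And>n. t n \<in> S2"
    "Z = (cauchy_class A s, cauchy_class B t)" by blast
  obtain u where u: "u \<in> cauchy_seqs P" "\<And>n. f (u n) = s n" "\<And>n. g (u n) = t n"
    using cauchy_seq_lift[OF st(1,2)] by blast
  then have "Z = split_completion (cauchy_class P u)" using st(5) by (simp add: split_completion_cls)
  moreover have "u n \<in> S" for n using S[OF P.cauchy_seqs_carrier[OF u(1)]] u st by simp
  ultimately show "Z \<in> split_completion ` {cauchy_class P s |s. s \<in> cauchy_seqs P \<and> (\<forall>n. s n \<in> S)}"
    using u(1) by blast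
qed

end

text \<open>It restricts the isomorphism of the completions to the closures of the ideals of series
  without constant term.\<close>

lemma star_iso_direct_sum_restrict:
  assumes "h \<in> star_iso C (C1 \<oplus>\<^sub>* C2)" "X \<subseteq> carrier C" "h ` X = X1 \<times> X2"
  shows "h \<in> star_iso (C\<lparr>carrier := X\<rparr>) ((C1\<lparr>carrier := X1\<rparr>) \<oplus>\<^sub>* (C2\<lparr>carrier := X2\<rparr>))"
proof -
  have h: "h \<in> star_hom C (C1 \<oplus>\<^sub>* C2)" "inj_on h X"
    using assms(1,2) by (auto simp: star_iso_def bij_betw_def intro: inj_on_subset)
  note [simp] = star_hom_simps(2-5)[OF h(1) subsetD[OF assms(2)]] subsetD[OF assms(2)]
  have "h \<in> star_hom (C\<lparr>carrier := X\<rparr>) ((C1\<lparr>carrier := X1\<rparr>) \<oplus>\<^sub>* (C2\<lparr>carrier := X2\<rparr>))"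
    using assms(3) by (intro star_homI) (auto simp: direct_sum_def split: prod.splits)
  then show ?thesis using h(2) assms(3) by (simp add: star_iso_def bij_betw_def direct_sum_simps(1))
qed

text \<open>Evaluation is componentwise, so at each t the norm is the maximum of the norms of the
  two values. Pairing coefficients preserves summability because a maximum is at most the
  sum.\<close>

lemma power_series_direct_sum:
  assumes "cstar_algebra A" "cstar_algebra B" "evaluation_set K"
  shows "direct_sum_decomposition (power_series_algebra K (A \<oplus>\<^sub>* B)) (power_series_algebra K A)
    (power_series_algebra K B) (ps_map fst) (ps_map snd)"
proof -
  interpret A: cstar_algebra A by fact
  interpret B: cstar_algebra B by fact
  interpret evaluation_set K by fact
  interpret S: cstar_algebra "A \<oplus>\<^sub>* B" by (rule cstar_direct_sum[OF assms(1,2)])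
  interpret F: power_series_hom "A \<oplus>\<^sub>* B" A K fst by unfold_locales (rule direct_sum_projections)
  interpret G: power_series_hom "A \<oplus>\<^sub>* B" B K snd by unfold_locales (rule direct_sum_projections)
  show ?thesis
  proof
    show "ps_map fst \<in> contractive_hom F.PA.P F.PB.P" by (rule F.ps_map_contractive)
    show "ps_map snd \<in> contractive_hom F.PA.P G.PB.P" by (rule G.ps_map_contractive)
    fix H assume "H \<in> carrier F.PA.P"
    then have H: "H \<in> power_series (A \<oplus>\<^sub>* B)" by (simp add: power_series_algebra_simps(1))
    show "nrm F.PA.P H \<le> max (nrm F.PB.P (ps_map fst H)) (nrm G.PB.P (ps_map snd H))"
    proof (rule F.PA.nrm_power_series_leI)
      fix t assume t: "t \<in> K"
      define p where "p = ps_eval (A \<oplus>\<^sub>* B) H t"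
      have "nrm (A \<oplus>\<^sub>* B) p = max (nrm A (fst p)) (nrm B (snd p))"
        using direct_sum_simps(7)[of A B "fst p" "snd p"] by simp
      also have "\<dots> = max (nrm A (ps_eval A (ps_map fst H) t)) (nrm B (ps_eval B (ps_map snd H) t))"
        unfolding p_def using F.ps_eval_map[OF H K_abs[OF t]] G.ps_eval_map[OF H K_abs[OF t]] by simp
      also have "\<dots> \<le> max (nrm F.PB.P (ps_map fst H)) (nrm G.PB.P (ps_map snd H))"
        using F.PB.nrm_eval_le[OF F.ps_map_closed[OF H] t] G.PB.nrm_eval_le[OF G.ps_map_closed[OF H] t]
        by (rule max.mono)
      finally show "nrm (A \<oplus>\<^sub>* B) (ps_eval (A \<oplus>\<^sub>* B) H t) \<le>
          max (nrm F.PB.P (ps_map fst H)) (nrm G.PB.P (ps_map snd H))" by (simp add: p_def)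
    qed
  next
    fix F G assume "F \<in> carrier F.PB.P" "G \<in> carrier G.PB.P"
    then have FG: "F \<in> power_series A" "G \<in> power_series B" by (simp_all add: power_series_algebra_simps(1))
    define H where "H = (\<lambda>n. (F n, G n))"
    have c: "F n \<in> carrier A" "G n \<in> carrier B" for n using FG by auto
    have "summable (\<lambda>n. nrm A (F n) + nrm B (G n))"
      using FG by (intro summable_add) (auto simp: power_series_def)
    moreover have "norm (nrm (A \<oplus>\<^sub>* B) (H n)) \<le> nrm A (F n) + nrm B (G n)" for n
      using A.nrm_nonneg[OF c(1)[of n]] B.nrm_nonneg[OF c(2)[of n]] by (simp add: H_def direct_sum_simps(7))
    ultimately have "summable (\<lambda>n. nrm (A \<oplus>\<^sub>* B) (H n))"
      by (rule summable_comparison_test')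
    then have "H \<in> power_series (A \<oplus>\<^sub>* B)" by (simp add: power_series_def H_def direct_sum_simps(1) c)
    moreover have "ps_map fst H = F" "ps_map snd H = G" by (simp_all add: ps_map_def H_def)
    ultimately show "\<exists>H\<in>carrier F.PA.P. ps_map fst H = F \<and> ps_map snd H = G"
      by (auto simp: power_series_algebra_simps(1))
  qed
qed

theorem proposition8:
  fixes A :: "'a normed_star_algebra" and B :: "'b normed_star_algebra"
    and f :: "'a \<Rightarrow> 'b" and K :: "real set"
  assumes "K \<subseteq> {-1..1}" and "0 islimpt K"
    and "cstar_algebra A" and "cstar_algebra B" and "f \<in> star_hom A B"
  shows
    "ps_map f \<in> contractive_hom (power_series_algebra K A) (power_series_algebra K B)
    \<and>
    (f \<in> isometric_hom A B \<longrightarrow>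
      ps_map f \<in> isometric_hom (power_series_algebra K A) (power_series_algebra K B) \<and>
      ps_completion_map K A B f \<in> isometric_hom (ps_completion K A) (ps_completion K B))
    \<and>
    (f ` carrier A = carrier B \<longrightarrow> ps_map f ` power_series A = power_series B)
    \<and>
    (f \<in> star_iso A B \<longrightarrow>
      ps_map f \<in> star_iso (power_series_algebra K A) (power_series_algebra K B) \<and>
      ps_completion_map K A B f \<in> star_iso (ps_completion K A) (ps_completion K B))
    \<and>
    a_kernel (power_series_algebra K A) (power_series_algebra K B) (ps_map f)
      = power_series (A\<lparr>carrier := a_kernel A B f\<rparr>)
    \<and>
    ps_map f ` power_series A = power_series (B\<lparr>carrier := f ` carrier A\<rparr>)
    \<and>
    (\<forall>I. closed_ideal I A \<longrightarrow>
      closed_ideal (power_series (A\<lparr>carrier := I\<rparr>)) (power_series_algebra K A) \<and>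
      short_exact (power_series_algebra K (A\<lparr>carrier := I\<rparr>)) (power_series_algebra K A)
        (quotient_algebra (power_series_algebra K A) (power_series (A\<lparr>carrier := I\<rparr>)))
        (\<lambda>F. F)
        (\<lambda>F. power_series (A\<lparr>carrier := I\<rparr>) +>\<^bsub>power_series_algebra K A\<^esub> F) \<and>
      short_exact (power_series_algebra K (A\<lparr>carrier := I\<rparr>)) (power_series_algebra K A)
        (power_series_algebra K (quotient_algebra A I))
        (\<lambda>F. F) (ps_map (\<lambda>a. I +>\<^bsub>A\<^esub> a)))
    \<and>
    ps_completion K (A \<oplus>\<^sub>* B) \<cong>\<^sub>* ps_completion K A \<oplus>\<^sub>* ps_completion K B
    \<and>
    ps_ideal1_completion K (A \<oplus>\<^sub>* B) \<cong>\<^sub>* ps_ideal1_completion K A \<oplus>\<^sub>* ps_ideal1_completion K B"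
proof -
  interpret A: cstar_algebra A by fact
  interpret B: cstar_algebra B by fact
  interpret evaluation_set K by unfold_locales fact+
  interpret power_series_hom A B K f by unfold_locales fact
  interpret ext: completion_hom PA.P PB.P "ps_map f"
    by unfold_locales (rule ps_map_contractive)
  interpret D: direct_sum_decomposition "power_series_algebra K (A \<oplus>\<^sub>* B)" PA.P PB.P "ps_map fst" "ps_map snd"
    by (rule power_series_direct_sum) unfold_locales

  have isometric: "ps_map f \<in> isometric_hom PA.P PB.P \<and>
      ps_completion_map K A B f \<in> isometric_hom (ps_completion K A) (ps_completion K B)"
    if "f \<in> isometric_hom A B"
    unfolding ps_completion_map_def
    using ps_map_isometric[OF that] ext.completion_map_isometric[OF ps_map_isometric[OF that]] by blast

  have iso: "ps_map f \<in> star_iso PA.P PB.P \<and>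
      ps_completion_map K A B f \<in> star_iso (ps_completion K A) (ps_completion K B)"
    if f: "f \<in> star_iso A B"
  proof -
    have m: "ps_map f \<in> star_iso PA.P PB.P" by (rule ps_map_iso[OF f])
    then have "ps_map f ` carrier PA.P = carrier PB.P" by (simp add: star_iso_def bij_betw_def)
    moreover have "ps_map f \<in> isometric_hom PA.P PB.P"
      by (rule ps_map_isometric[OF star_iso_isometric[OF assms(3,4) f]])
    ultimately show ?thesis
      unfolding ps_completion_map_def using m ext.completion_map_iso by blast
  qed

  have onto: "ps_map f ` power_series A = power_series B" if "f ` carrier A = carrier B"
    using ps_map_image that by (simp add: power_series_def)

  have ideals: "closed_ideal (power_series (A\<lparr>carrier := I\<rparr>)) PA.P \<and>
      short_exact (power_series_algebra K (A\<lparr>carrier := I\<rparr>)) PA.P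
        (quotient_algebra PA.P (power_series (A\<lparr>carrier := I\<rparr>)))
        (\<lambda>F. F) (\<lambda>F. power_series (A\<lparr>carrier := I\<rparr>) +>\<^bsub>PA.P\<^esub> F) \<and>
      short_exact (power_series_algebra K (A\<lparr>carrier := I\<rparr>)) PA.P
        (power_series_algebra K (quotient_algebra A I)) (\<lambda>F. F) (ps_map (\<lambda>a. I +>\<^bsub>A\<^esub> a))"
    if I: "closed_ideal I A" for I
  proof -
    interpret I: seminormed_star_ideal A I by (rule A.closed_ideal_seminormed_star_ideal[OF I])
    show ?thesis
      using PA.closed_ideal_power_series[OF I] I.short_exact_quotient I.short_exact_power_series_quotient by blast
  qed

  have sum: "ps_completion K (A \<oplus>\<^sub>* B) \<cong>\<^sub>* ps_completion K A \<oplus>\<^sub>* ps_completion K B"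
    using D.split_completion_iso unfolding star_isomorphic_def by blast

  have ideal1: "{F \<in> power_series C. F 0 = \<zero>\<^bsub>C\<^esub>} \<subseteq> carrier (power_series_algebra K C)" for C
    by (auto simp: power_series_algebra_simps(1))
  let ?X = "ctop (ps_completion K (A \<oplus>\<^sub>* B)) closure_of (to_completion (power_series_algebra K (A \<oplus>\<^sub>* B)) `
    {F \<in> power_series (A \<oplus>\<^sub>* B). F 0 = \<zero>\<^bsub>A \<oplus>\<^sub>* B\<^esub>})"
  \<comment> \<open>A series of pairs has zero constant term exactly when both component series
    do.\<close>
  have "D.split_completion ` ?X =
      (ctop (ps_completion K A) closure_of (to_completion PA.P ` {F \<in> power_series A. F 0 = \<zero>\<^bsub>A\<^esub>})) \<times>
      (ctop (ps_completion K B) closure_of (to_completion PB.P ` {F \<in> power_series B. F 0 = \<zero>\<^bsub>B\<^esub>}))"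
  proof (rule D.split_completion_closure[OF ideal1 ideal1 ideal1])
    fix F assume F: "F \<in> carrier (power_series_algebra K (A \<oplus>\<^sub>* B))"
    have "ps_map fst F \<in> power_series A" "ps_map snd F \<in> power_series B"
      using F star_hom_closed[OF D.F.hom F] star_hom_closed[OF D.G.hom F] by (simp_all add: power_series_algebra_simps(1))
    then show "F \<in> {F \<in> power_series (A \<oplus>\<^sub>* B). F 0 = \<zero>\<^bsub>A \<oplus>\<^sub>* B\<^esub>} \<longleftrightarrow>
        ps_map fst F \<in> {F \<in> power_series A. F 0 = \<zero>\<^bsub>A\<^esub>} \<and> ps_map snd F \<in> {F \<in> power_series B. F 0 = \<zero>\<^bsub>B\<^esub>}"
      using F by (auto simp: power_series_algebra_simps(1) ps_map_def direct_sum_simps(3) prod_eq_iff)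
  qed
  moreover have "?X \<subseteq> carrier (ps_completion K (A \<oplus>\<^sub>* B))"
    unfolding D.P.closure_to_completion[OF ideal1] using D.P.cls_closed by blast
  ultimately have "ps_ideal1_completion K (A \<oplus>\<^sub>* B) \<cong>\<^sub>* ps_ideal1_completion K A \<oplus>\<^sub>* ps_ideal1_completion K B"
    using star_iso_direct_sum_restrict[OF D.split_completion_iso]
    unfolding star_isomorphic_def ps_ideal1_completion_def by blast
  then show ?thesis
    using ps_map_contractive isometric iso onto ps_map_kernel ps_map_image ideals sum by blast
qed

end
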